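(* Assume $$c_v := \sup_{0 \neq q \in H^1_0(\Omega)} \frac{\|q\,\boldsymbol{v}\|_{L^2(\Omega)}}{\|\nabla q\|_{L^2(\Omega)}} < \infty$$ and $\operatorname{div} \boldsymbol{v}(x) \leq 0$ for almost all $x \in \Omega$. Then for any $f \in Y^*$ there exists a unique solution $u \in X_v$ of the variational formulation $$b(u,q) = \langle f,q\rangle_\Omega \quad \text{for all } q \in Y,$$ and it satisfies $$\|u\|_{X_v} \leq \|f\|_{Y^*}.$$
   Context: $\Omega \subset \mathbb{R}^n$, $n=1,2,3$, is a bounded Lipschitz domain. The diffusion coefficient $\alpha:\Omega\to\mathbb{R}$ is measurable and satisfies $0 < \underline{\alpha} \leq \alpha(x) \leq \overline{\alpha}$ for all $x \in \Omega$, with constants $\underline\alpha,\overline\alpha$. $\boldsymbol{v}$ is a given, possibly unbounded, locally integrable velocity field on $\Omega$ with values in $\mathbb{R}^n$ whose divergence, understood in the weak sense, is a locally integrable function. $Y := H^1_0(\Omega)$ is equipped with the norm $\|q\|_Y^2 := \int_\Omega \alpha(x)\,|\nabla q(x)|^2\,dx$, and $Y^*=H^{-1}(\Omega)$ is its dual with norm $\|f\|_{Y^*} := \sup_{0\neq q\in Y} \langle f,q\rangle_\Omega/\|q\|_Y$, where $\langle\cdot,\cdot\rangle_\Omega$ is the duality pairing extending the $L^2(\Omega)$ inner product. The velocity dependent ansatz space is $X_v := \{u \in Y : \boldsymbol{v}\cdot\nabla u \in Y^*\}$ with the graph norm $$\|u\|_{X_v} := \sqrt{\|u\|_Y^2 +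 \|\boldsymbol{v}\cdot\nabla u\|_{Y^*}^2}.$$ The bilinear form $b : X_v\times Y\to\mathbb{R}$ is $$b(u,q) := \int_\Omega \alpha(x)\,\nabla u(x)\cdot\nabla q(x)\,dx + \int_\Omega \boldsymbol{v}(x)\cdot\nabla u(x)\,q(x)\,dx,$$ where for $u \in X_v$ and $q \in Y$ the last integral is understood as the duality pairing $\langle \boldsymbol{v}\cdot\nabla u, q\rangle_\Omega$. The variational formulation is that of the Dirichlet problem $-\operatorname{div}[\alpha\nabla u] + \boldsymbol{v}\cdot\nabla u = f$ in $\Omega$, $u=0$ on $\partial\Omega$. *)

theory Defs
  imports "HOL-Analysis.Analysis"
begin

section \<open>Bounded Lipschitz domains\<close>

text \<open>Near every boundary point the domain is, in a rotated coordinate system, the set below the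
  graph of a Lipschitz function. The rotation is encoded by a unit vector e (the vertical
  direction); the horizontal part of y is its orthogonal projection onto the complement of e.
  In dimension one that complement is the origin, and the condition holds for every bounded open
  interval.\<close>

definition bounded_lipschitz_domain :: "'a::euclidean_space set \<Rightarrow> bool" where
  "bounded_lipschitz_domain \<Omega> \<longleftrightarrow>
     \<Omega> \<noteq> {} \<and> open \<Omega> \<and> connected \<Omega> \<and> bounded \<Omega> \<and>
     (\<forall>x\<in>frontier \<Omega>. \<exists>r>0. \<exists>e L. \<exists>\<gamma> :: 'a \<Rightarrow> real.
        norm e = 1 \<and> L-lipschitz_on {y. y \<bullet> e = 0} \<gamma> \<and>
        \<Omega> \<inter> ball x r = {y \<in> ball x r. y \<bullet> e < \<gamma> (y - (y \<bullet> e) *\<^sub>R e)})"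

section \<open>Test functions, weak derivatives and Sobolev spaces\<close>

text \<open>Functions on \<open>\<Omega>\<close> are represented by total functions, of which only the almost everywhere
  equivalence class on \<open>\<Omega>\<close> matters.\<close>

definition locally_integrable ::
    "'a::euclidean_space set \<Rightarrow> ('a \<Rightarrow> 'b::euclidean_space) \<Rightarrow> bool" where
  "locally_integrable \<Omega> f \<longleftrightarrow> (\<forall>K. compact K \<and> K \<subseteq> \<Omega> \<longrightarrow> f absolutely_integrable_on K)"

primrec Ck :: "nat \<Rightarrow> ('a::euclidean_space \<Rightarrow> real) \<Rightarrow> bool" where
  "Ck 0 f \<longleftrightarrow> continuous_on UNIV f"
| "Ck (Suc k) f \<longleftrightarrow>
     (\<forall>x. f differentiable (at x)) \<and> (\<forall>b\<in>Basis. Ck k (\<lambda>x. frechet_derivative f (at x) b))"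

definition test_functions :: "'a::euclidean_space set \<Rightarrow> ('a \<Rightarrow> real) set" where
  "test_functions \<Omega> =
     {\<phi>. (\<forall>k. Ck k \<phi>) \<and> compact (closure {x. \<phi> x \<noteq> 0}) \<and> closure {x. \<phi> x \<noteq> 0} \<subseteq> \<Omega>}"

definition has_weak_grad ::
    "'a::euclidean_space set \<Rightarrow> ('a \<Rightarrow> real) \<Rightarrow> ('a \<Rightarrow> 'a) \<Rightarrow> bool" where
  "has_weak_grad \<Omega> u G \<longleftrightarrow>
     locally_integrable \<Omega> u \<and> locally_integrable \<Omega> G \<and>
     (\<forall>\<phi>\<in>test_functions \<Omega>. \<forall>b\<in>Basis.
        (LINT x|lebesgue_on \<Omega>. u x * frechet_derivative \<phi> (at x) b) =
        - (LINT x|lebesgue_on \<Omega>. (G x \<bullet> b) * \<phi> x))"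

definition weak_grad :: "'a::euclidean_space set \<Rightarrow> ('a \<Rightarrow> real) \<Rightarrow> 'a \<Rightarrow> 'a" where
  "weak_grad \<Omega> u = (SOME G. has_weak_grad \<Omega> u G)"

text \<open>Here \<open>frechet_derivative \<phi> (at x) (v x)\<close> is the inner product of \<open>v\<close> and the gradient of \<open>\<phi>\<close>
  at x.\<close>

definition has_weak_div ::
    "'a::euclidean_space set \<Rightarrow> ('a \<Rightarrow> 'a) \<Rightarrow> ('a \<Rightarrow> real) \<Rightarrow> bool" where
  "has_weak_div \<Omega> v d \<longleftrightarrow>
     locally_integrable \<Omega> v \<and> locally_integrable \<Omega> d \<and>
     (\<forall>\<phi>\<in>test_functions \<Omega>.
        (LINT x|lebesgue_on \<Omega>. frechet_derivative \<phi> (at x) (v x)) =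
        - (LINT x|lebesgue_on \<Omega>. d x * \<phi> x))"

definition L2_space :: "'a::euclidean_space set \<Rightarrow> ('a \<Rightarrow> 'b::euclidean_space) set" where
  "L2_space \<Omega> = {w. w \<in> borel_measurable (lebesgue_on \<Omega>) \<and>
                    integrable (lebesgue_on \<Omega>) (\<lambda>x. (norm (w x))\<^sup>2)}"

definition L2_norm :: "'a::euclidean_space set \<Rightarrow> ('a \<Rightarrow> 'b::euclidean_space) \<Rightarrow> real" where
  "L2_norm \<Omega> w = sqrt (LINT x|lebesgue_on \<Omega>. (norm (w x))\<^sup>2)"

definition H1 :: "'a::euclidean_space set \<Rightarrow> ('a \<Rightarrow> real) set" where
  "H1 \<Omega> = {u \<in> L2_space \<Omega>. (\<exists>G. has_weak_grad \<Omega> u G) \<and> weak_grad \<Omega> u \<in> L2_space \<Omega>}"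

definition H1_norm :: "'a::euclidean_space set \<Rightarrow> ('a \<Rightarrow> real) \<Rightarrow> real" where
  "H1_norm \<Omega> u = sqrt ((L2_norm \<Omega> u)\<^sup>2 + (L2_norm \<Omega> (weak_grad \<Omega> u))\<^sup>2)"

definition H10 :: "'a::euclidean_space set \<Rightarrow> ('a \<Rightarrow> real) set" where
  "H10 \<Omega> = {u \<in> H1 \<Omega>. \<exists>\<phi> :: nat \<Rightarrow> 'a \<Rightarrow> real. (\<forall>k. \<phi> k \<in> test_functions \<Omega>) \<and>
                       (\<lambda>k. H1_norm \<Omega> (\<lambda>x. u x - \<phi> k x)) \<longlonglongrightarrow> 0}"

definition H10_nonzero :: "'a::euclidean_space set \<Rightarrow> ('a \<Rightarrow> real) set" where
  "H10_nonzero \<Omega> = {q \<in> H10 \<Omega>. \<not> (AE x in lebesgue_on \<Omega>. q x = 0)}"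

section \<open>The energy norm and the dual space\<close>

definition Y_norm :: "'a::euclidean_space set \<Rightarrow> ('a \<Rightarrow> real) \<Rightarrow> ('a \<Rightarrow> real) \<Rightarrow> real" where
  "Y_norm \<Omega> \<alpha> q = sqrt (LINT x|lebesgue_on \<Omega>. \<alpha> x * (norm (weak_grad \<Omega> q x))\<^sup>2)"

text \<open>Elements of the dual space are functionals on representatives, of which only the values on
  \<open>H10 \<Omega>\<close> matter. Boundedness and linearity force them to respect almost everywhere equality.
  The duality pairing is application.\<close>

definition Y_dual ::
    "'a::euclidean_space set \<Rightarrow> ('a \<Rightarrow> real) \<Rightarrow> (('a \<Rightarrow> real) \<Rightarrow> real) set" where
  "Y_dual \<Omega> \<alpha> = {f.
     (\<forall>p\<in>H10 \<Omega>. \<forall>q\<in>H10 \<Omega>. f (\<lambda>x. p x + q x) = f p + f q) \<and>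
     (\<forall>c. \<forall>q\<in>H10 \<Omega>. f (\<lambda>x. c * q x) = c * f q) \<and>
     (\<exists>C. \<forall>q\<in>H10 \<Omega>. \<bar>f q\<bar> \<le> C * Y_norm \<Omega> \<alpha> q)}"

definition Y_dual_norm ::
    "'a::euclidean_space set \<Rightarrow> ('a \<Rightarrow> real) \<Rightarrow> (('a \<Rightarrow> real) \<Rightarrow> real) \<Rightarrow> real" where
  "Y_dual_norm \<Omega> \<alpha> f = (SUP q\<in>H10_nonzero \<Omega>. f q / Y_norm \<Omega> \<alpha> q)"

text \<open>A locally integrable function \<open>w\<close> belongs to the dual space if integration against \<open>w\<close> on test
  functions extends to a bounded functional \<open>g\<close>; by density \<open>g\<close> is then unique on \<open>H10 \<Omega>\<close>.\<close>

definition represents ::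
    "'a::euclidean_space set \<Rightarrow> ('a \<Rightarrow> real) \<Rightarrow> ('a \<Rightarrow> real) \<Rightarrow> (('a \<Rightarrow> real) \<Rightarrow> real) \<Rightarrow> bool" where
  "represents \<Omega> \<alpha> w g \<longleftrightarrow>
     locally_integrable \<Omega> w \<and> g \<in> Y_dual \<Omega> \<alpha> \<and>
     (\<forall>\<phi>\<in>test_functions \<Omega>. g \<phi> = (LINT x|lebesgue_on \<Omega>. w x * \<phi> x))"

section \<open>The convection-diffusion problem\<close>

definition X_space ::
    "'a::euclidean_space set \<Rightarrow> ('a \<Rightarrow> real) \<Rightarrow> ('a \<Rightarrow> 'a) \<Rightarrow> ('a \<Rightarrow> real) set" where
  "X_space \<Omega> \<alpha> v = {u \<in> H10 \<Omega>. \<exists>g. represents \<Omega> \<alpha> (\<lambda>x. v x \<bullet> weak_grad \<Omega> u x) g}"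

definition convection ::
    "'a::euclidean_space set \<Rightarrow> ('a \<Rightarrow> real) \<Rightarrow> ('a \<Rightarrow> 'a) \<Rightarrow> ('a \<Rightarrow> real) \<Rightarrow> ('a \<Rightarrow> real) \<Rightarrow> real" where
  "convection \<Omega> \<alpha> v u = (SOME g. represents \<Omega> \<alpha> (\<lambda>x. v x \<bullet> weak_grad \<Omega> u x) g)"

definition X_norm ::
    "'a::euclidean_space set \<Rightarrow> ('a \<Rightarrow> real) \<Rightarrow> ('a \<Rightarrow> 'a) \<Rightarrow> ('a \<Rightarrow> real) \<Rightarrow> real" where
  "X_norm \<Omega> \<alpha> v u =
     sqrt ((Y_norm \<Omega> \<alpha> u)\<^sup>2 + (Y_dual_norm \<Omega> \<alpha> (convection \<Omega> \<alpha> v u))\<^sup>2)"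

definition b_form ::
    "'a::euclidean_space set \<Rightarrow> ('a \<Rightarrow> real) \<Rightarrow> ('a \<Rightarrow> 'a) \<Rightarrow> ('a \<Rightarrow> real) \<Rightarrow> ('a \<Rightarrow> real) \<Rightarrow> real" where
  "b_form \<Omega> \<alpha> v u q =
     (LINT x|lebesgue_on \<Omega>. \<alpha> x * (weak_grad \<Omega> u x \<bullet> weak_grad \<Omega> q x)) + convection \<Omega> \<alpha> v u q"

definition variational_solution ::
    "'a::euclidean_space set \<Rightarrow> ('a \<Rightarrow> real) \<Rightarrow> ('a \<Rightarrow> 'a) \<Rightarrow> (('a \<Rightarrow> real) \<Rightarrow> real) \<Rightarrow> ('a \<Rightarrow> real) \<Rightarrow> bool"
  where
  "variational_solution \<Omega> \<alpha> v f u \<longleftrightarrow>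
     u \<in> X_space \<Omega> \<alpha> v \<and> (\<forall>q\<in>H10 \<Omega>. b_form \<Omega> \<alpha> v u q = f q)"

text \<open>The value is infinite as soon as \<open>q v\<close> fails to be square integrable for some \<open>q\<close>.\<close>

definition L2_ennorm :: "'a::euclidean_space set \<Rightarrow> ('a \<Rightarrow> 'b::euclidean_space) \<Rightarrow> ennreal" where
  "L2_ennorm \<Omega> w = (if w \<in> L2_space \<Omega> then ennreal (L2_norm \<Omega> w) else \<infinity>)"

definition c_vel :: "'a::euclidean_space set \<Rightarrow> ('a \<Rightarrow> 'a) \<Rightarrow> ennreal" where
  "c_vel \<Omega> v =
     (SUP q\<in>H10_nonzero \<Omega>. L2_ennorm \<Omega> (\<lambda>x. q x *\<^sub>R v x) / L2_ennorm \<Omega> (weak_grad \<Omega> q))"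

end

theory Submission
  imports Defs
begin

text \<open>The proof rests on two facts about the convection form
  \<open>conv u q = \<integral> (v \<bullet> \<nabla>u) q\<close>. Finiteness of \<open>c_vel\<close> bounds \<open>q v\<close> in \<open>L\<^sup>2\<close> by the gradient of \<open>q\<close>, so the form is
  bounded on the whole of \<open>H10\<close> and the ansatz space is \<open>H10\<close> itself (\<open>conv_bounded\<close>, \<open>X_space_eq_H10\<close>).
  The sign of the divergence gives \<open>conv u u \<ge> 0\<close>: on a test function the term equals
  \<open>- 1/2 \<integral> div v \<phi>\<^sup>2\<close>, and boundedness extends the sign to the closure (\<open>conv_nonneg\<close>). Adding the
  convection form to the energy form \<open>energy u q = \<integral> \<alpha> \<nabla>u \<bullet> \<nabla>q\<close> therefore keeps it coercive, with constant 1
  in the energy norm. Existence is the Lax-Milgram theorem, and uniqueness is coercivity applied to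
  the difference of two solutions.

  The sharp constant in the estimate comes from the Riesz isometry. If \<open>z\<close> represents the functional
  \<open>conv u\<close> in the energy inner product, then \<open>u + z\<close> represents \<open>f\<close>, and
  \<open>\<parallel>f\<parallel>\<^sup>2 = \<parallel>u + z\<parallel>\<^sup>2 = \<parallel>u\<parallel>\<^sup>2 + 2 conv u u + \<parallel>z\<parallel>\<^sup>2\<close>. Dropping the nonnegative middle term leaves the squared
  graph norm of \<open>u\<close>.

  The Hilbert space theory behind this works with functions rather than with equivalence classes:
  Riesz and Lax-Milgram are proved for a semi-inner product on a carrier set of functions, and
  \<open>H10\<close> is shown to be complete for the energy form. Completeness needs the Riesz-Fischer theorem
  (\<open>L2_complete\<close>), the almost everywhere uniqueness of weak gradients, which follows from the
  fundamental lemma of the calculus of variations, and the Poincare inequality.\<close>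

section \<open>Smooth functions\<close>

lemma Ck_SucI:
  assumes "\<And>x. (f has_derivative f' x) (at x)" and "\<And>b. b \<in> Basis \<Longrightarrow> Ck k (\<lambda>x. f' x b)"
  shows "Ck (Suc k) f"
proof -
  have "frechet_derivative f (at x) = f' x" for x
    using assms(1) frechet_derivative_at by metis
  then show ?thesis
    using assms by (auto simp: differentiable_def)
qed

lemma Ck_Suc_has_derivative:
  "Ck (Suc k) f \<Longrightarrow> (f has_derivative frechet_derivative f (at x)) (at x)"
  by (simp add: frechet_derivative_works)

lemma Ck_Suc_imp: "Ck (Suc k) f \<Longrightarrow> Ck k f"
  by (induction k arbitrary: f)
     (auto intro!: continuous_at_imp_continuous_on differentiable_imp_continuous_within)

lemma Ck_const: "Ck k (\<lambda>x. c)"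
  by (induction k arbitrary: c) (auto intro!: Ck_SucI[where f' = "\<lambda>_ _. 0"] simp del: Ck.simps(2))

lemma Ck_add: "Ck k f \<Longrightarrow> Ck k g \<Longrightarrow> Ck k (\<lambda>x. f x + g x)"
proof (induction k arbitrary: f g)
  case 0
  then show ?case by (auto intro: continuous_intros)
next
  case (Suc k)
  show ?case
  proof (rule Ck_SucI)
    show "((\<lambda>x. f x + g x) has_derivative
        (\<lambda>h. frechet_derivative f (at x) h + frechet_derivative g (at x) h)) (at x)" for x
      using Suc.prems by (intro has_derivative_add Ck_Suc_has_derivative)
    show "Ck k (\<lambda>x. frechet_derivative f (at x) b + frechet_derivative g (at x) b)"
      if "b \<in> Basis" for b
      using Suc that by simp
  qed
qed

lemma Ck_mult: "Ck k f \<Longrightarrow> Ck k g \<Longrightarrow> Ck k (\<lambda>x. f x * g x)"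
proof (induction k arbitrary: f g)
  case 0
  then show ?case by (auto intro: continuous_intros)
next
  case (Suc k)
  show ?case
  proof (rule Ck_SucI)
    show "((\<lambda>x. f x * g x) has_derivative
        (\<lambda>h. f x * frechet_derivative g (at x) h + frechet_derivative f (at x) h * g x)) (at x)" for x
      using Suc.prems by (intro has_derivative_mult Ck_Suc_has_derivative)
    show "Ck k (\<lambda>x. f x * frechet_derivative g (at x) b + frechet_derivative f (at x) b * g x)"
      if "b \<in> Basis" for b
    proof -
      have "Ck k f" "Ck k g"
        using Suc.prems Ck_Suc_imp by blast+
      moreover have "Ck k (\<lambda>x. frechet_derivative g (at x) b)"
          "Ck k (\<lambda>x. frechet_derivative f (at x) b)"
        using Suc.prems that by simp_all
      ultimately show ?thesis
        by (intro Ck_add Suc.IH)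
    qed
  qed
qed

lemma Ck_prod: "(\<And>i. i \<in> A \<Longrightarrow> Ck k (f i)) \<Longrightarrow> Ck k (\<lambda>x. \<Prod>i\<in>A. f i x)"
  by (induction A rule: infinite_finite_induct) (auto intro: Ck_const Ck_mult)

lemma Ck_inner: "Ck k (\<lambda>x. x \<bullet> w)"
  by (cases k) (auto intro!: continuous_intros Ck_SucI[where f' = "\<lambda>_ h. h \<bullet> w"] derivative_eq_intros
       Ck_const simp del: Ck.simps(2))

lemma smooth_frechet:
  assumes "\<And>k. Ck k f" and "b \<in> Basis"
  shows "Ck k (\<lambda>x. frechet_derivative f (at x) b)"
  using assms(1)[of "Suc k"] assms(2) by simp

section \<open>Smooth bump functions\<close>

text \<open>These functions, with \<open>flat 0\<close> the standard smooth function that vanishes to infinite order at 0,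
  span a space closed under differentiation. Smoothness can therefore be proved for all of them at
  once by induction on the order.\<close>

definition flat :: "nat \<Rightarrow> real \<Rightarrow> real" where
  "flat m t = (if t \<le> 0 then 0 else exp (- 1 / t) / t ^ m)"

text \<open>The term of order \<open>m + 2\<close> of the exponential series of \<open>1 / t\<close> bounds \<open>exp (1 / t)\<close> from below. The
  square on the right is what differentiability at 0 with derivative 0 requires.\<close>

lemma flat_le_square: "\<bar>flat m t\<bar> \<le> fact (m + 2) * t\<^sup>2"
proof (cases "t > 0")
  case True
  have "(1 / t) ^ (m + 2) / fact (m + 2) \<le> exp (1 / t)"
  proof -
    have "(\<Sum>n\<in>{m + 2}. (1 / t) ^ n /\<^sub>R fact n) \<le> (\<Sum>n. (1 / t) ^ n /\<^sub>R fact n)"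
      using True by (intro sum_le_suminf summable_exp_generic) auto
    then show ?thesis
      by (simp add: exp_def divide_inverse mult.commute)
  qed
  moreover have "(1 / t) ^ (m + 2) / fact (m + 2) = 1 / (fact (m + 2) * t\<^sup>2 * t ^ m)"
    by (simp only: power_add power_one_over divide_divide_eq_left mult_ac times_divide_times_eq mult_1)
  moreover have "0 < fact (m + 2) * t\<^sup>2 * t ^ m"
    using True by (intro mult_pos_pos) auto
  ultimately have "1 \<le> fact (m + 2) * t\<^sup>2 * t ^ m * exp (1 / t)"
    by (simp only: pos_divide_le_eq mult.commute[of "exp (1 / t)"])
  then have "1 / (t ^ m * exp (1 / t)) \<le> fact (m + 2) * t\<^sup>2"
    using True by (subst pos_divide_le_eq) (auto simp only: mult.assoc zero_less_mult_iff zero_less_power exp_gt_zero)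
  then have "exp (- 1 / t) / t ^ m \<le> fact (m + 2) * t\<^sup>2"
    by (simp add: exp_minus inverse_eq_divide mult.commute del: fact_Suc)
  then show ?thesis
    using True by (simp add: flat_def)
qed (simp add: flat_def)

lemma flat_has_derivative:
  "(flat m has_real_derivative flat (m + 2) t - real m * flat (m + 1) t) (at t)"
proof -
  consider "t > 0" | "t < 0" | "t = 0" by linarith
  then show ?thesis
  proof cases
    case 1
    have "((\<lambda>t. exp (- 1 / t) / t ^ m) has_real_derivative
           flat (m + 2) t - real m * flat (m + 1) t) (at t)"
    proof (cases m)
      case (Suc k)
      then show ?thesis
        using 1 by (auto intro!: derivative_eq_intros simp: flat_def)
          (cases k; simp add: field_simps power2_eq_square power_add)
    qed (use 1 in \<open>auto intro!: derivative_eq_intros simp: flat_def field_simps power2_eq_square\<close>)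
    then show ?thesis
      by (rule has_field_derivative_transform_within_open[where S = "{0<..}"])
         (use 1 in \<open>auto simp: flat_def\<close>)
  next
    case 2
    have "((\<lambda>t. 0) has_real_derivative flat (m + 2) t - real m * flat (m + 1) t) (at t)"
      using 2 by (auto simp: flat_def)
    then show ?thesis
      by (rule has_field_derivative_transform_within_open[where S = "{..<0}"])
         (use 2 in \<open>auto simp: flat_def\<close>)
  next
    case 3
    have "((\<lambda>h. fact (m + 2) * \<bar>h\<bar>) \<longlongrightarrow> 0) (at (0::real))"
      by (auto intro!: tendsto_eq_intros)
    then have "((\<lambda>h. flat m h / h) \<longlongrightarrow> 0) (at 0)"
    proof (rule Lim_null_comparison[rotated])
      have "norm (flat m h / h) \<le> fact (m + 2) * \<bar>h\<bar>" for h
        using flat_le_square[of m h]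
        by (cases "h = 0") (auto simp: divide_le_eq power2_eq_square mult.assoc simp del: fact_Suc)
      then show "\<forall>\<^sub>F h in at 0. norm (flat m h / h) \<le> fact (m + 2) * \<bar>h\<bar>"
        by simp
    qed
    then show ?thesis
      using 3 by (simp add: DERIV_def flat_def)
  qed
qed

lemma Ck_flat_affine: "Ck k (\<lambda>x. flat m (x \<bullet> w + a))"
proof (induction k arbitrary: m)
  case 0
  have "continuous_on UNIV (flat m)"
    using flat_has_derivative DERIV_isCont continuous_at_imp_continuous_on by blast
  then have "continuous_on UNIV (flat m \<circ> (\<lambda>x. x \<bullet> w + a))"
    by (intro continuous_on_compose continuous_intros) (auto intro: continuous_on_subset)
  then show ?case
    by (simp add: o_def)
next
  case (Suc k)
  show ?case
  proof (rule Ck_SucI)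
    show "((\<lambda>x. flat m (x \<bullet> w + a)) has_derivative
      (\<lambda>h. (flat (m + 2) (x \<bullet> w + a) + - real m * flat (m + 1) (x \<bullet> w + a)) * (h \<bullet> w))) (at x)" for x
      by (rule has_derivative_compose[OF _ flat_has_derivative
            [unfolded has_field_derivative_def], THEN has_derivative_eq_rhs])
         (auto intro!: derivative_eq_intros)
    show "Ck k (\<lambda>x. (flat (m + 2) (x \<bullet> w + a) + - real m * flat (m + 1) (x \<bullet> w + a)) * (b \<bullet> w))"
      for b
      by (intro Ck_mult Ck_add Suc.IH Ck_const)
  qed
qed

text \<open>For \<open>s > 0\<close> a smooth function that is positive exactly on the open box from \<open>c\<close> to \<open>d\<close>; growing \<open>s\<close>
  steepens it.\<close>

definition bump :: "real \<Rightarrow> 'a \<Rightarrow> 'a \<Rightarrow> 'a::euclidean_space \<Rightarrow> real" where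
  "bump s c d x = (\<Prod>i\<in>Basis. flat 0 (s * (x \<bullet> i - c \<bullet> i)) * flat 0 (s * (d \<bullet> i - x \<bullet> i)))"

lemma Ck_bump: "Ck k (bump s c d)"
proof -
  have "Ck k (\<lambda>x. \<Prod>i\<in>Basis. flat 0 (x \<bullet> (s *\<^sub>R i) + (- s * (c \<bullet> i))) *
      flat 0 (x \<bullet> (- s *\<^sub>R i) + s * (d \<bullet> i)))"
    by (intro Ck_prod Ck_mult Ck_flat_affine)
  then show ?thesis
    by (simp add: bump_def[abs_def] algebra_simps)
qed

lemma flat_0_bounds: "0 \<le> flat 0 t" "flat 0 t \<le> 1" "flat 0 t = 0 \<longleftrightarrow> t \<le> 0"
  by (auto simp: flat_def)

lemma bump_bounds: "0 \<le> bump s c d x" "bump s c d x \<le> 1"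
  unfolding bump_def by (auto intro!: prod_nonneg prod_le_1 mult_nonneg_nonneg mult_le_one flat_0_bounds)

lemma bump_eq_0_iff: "s > 0 \<Longrightarrow> bump s c d x = 0 \<longleftrightarrow> x \<notin> box c d"
  by (auto simp: bump_def flat_0_bounds box_def mult_le_0_iff not_le not_less)

text \<open>For every positive \<open>t\<close> the value \<open>exp (-1 / (s * t))\<close> tends to 1 as \<open>s\<close> grows, so steepening a bump
  approximates the indicator of its box.\<close>

lemma bump_tendsto_indicator: "(\<lambda>n. bump (real (Suc n)) c d x) \<longlonglongrightarrow> indicat_real (box c d) x"
proof (cases "x \<in> box c d")
  case True
  have *: "(\<lambda>n. flat 0 (real (Suc n) * t)) \<longlonglongrightarrow> 1" if "t > 0" for t
  proof -
    have "(\<lambda>n. exp (- (1 / t) * inverse (real (Suc n)))) \<longlonglongrightarrow> exp (- (1 / t) * 0)"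
      by (intro tendsto_intros LIMSEQ_inverse_real_of_nat)
    then show ?thesis
      using that by (simp add: flat_def field_simps mult_le_0_iff not_le del: of_nat_Suc)
  qed
  have "(\<lambda>n. bump (real (Suc n)) c d x) \<longlonglongrightarrow> (\<Prod>i\<in>(Basis::'a set). 1 * 1)"
    unfolding bump_def using True
    by (intro tendsto_prod tendsto_mult *) (auto simp: box_def)
  then show ?thesis using True by simp
next
  case False
  then have "bump (real (Suc n)) c d x = 0" for n
    by (subst bump_eq_0_iff) auto
  then show ?thesis using False by simp
qed

section \<open>Test functions\<close>

lemma test_functionI:
  assumes "\<And>k. Ck k \<phi>" and "compact K" "K \<subseteq> \<Omega>" and "\<And>x. x \<notin> K \<Longrightarrow> \<phi> x = 0"
  shows "\<phi> \<in> test_functions \<Omega>"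
proof -
  have "closure {x. \<phi> x \<noteq> 0} \<subseteq> K"
    using assms by (intro closure_minimal) (auto intro: compact_imp_closed)
  then show ?thesis
    using assms(1,3) compact_Int_closed[OF assms(2) closed_closure, of "{x. \<phi> x \<noteq> 0}"]
    by (auto simp: test_functions_def Int_absorb1 simp del: compact_closure)
qed

lemma test_function_smooth: "\<phi> \<in> test_functions \<Omega> \<Longrightarrow> Ck k \<phi>"
  by (simp add: test_functions_def)

lemma test_function_support:
  assumes "\<phi> \<in> test_functions \<Omega>"
  obtains K where "compact K" "K \<subseteq> \<Omega>" "\<And>x. x \<notin> K \<Longrightarrow> \<phi> x = 0"
proof
  show "x \<notin> closure {x. \<phi> x \<noteq> 0} \<Longrightarrow> \<phi> x = 0" for x
    using closure_subset[of "{x. \<phi> x \<noteq> 0}"] by auto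
qed (use assms in \<open>auto simp: test_functions_def\<close>)

lemma test_function_outside: "\<phi> \<in> test_functions \<Omega> \<Longrightarrow> x \<notin> \<Omega> \<Longrightarrow> \<phi> x = 0"
  by (metis subsetD test_function_support)

lemma test_function_has_derivative:
  "\<phi> \<in> test_functions \<Omega> \<Longrightarrow> (\<phi> has_derivative frechet_derivative \<phi> (at x)) (at x)"
  by (rule Ck_Suc_has_derivative[OF test_function_smooth])

lemma test_function_mult_smooth:
  assumes "\<phi> \<in> test_functions \<Omega>" "\<And>k. Ck k g"
  shows "(\<lambda>x. g x * \<phi> x) \<in> test_functions \<Omega>"
proof -
  obtain K where "compact K" "K \<subseteq> \<Omega>" "\<And>x. x \<notin> K \<Longrightarrow> \<phi> x = 0"
    using test_function_support[OF assms(1)] by blast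
  then show ?thesis
    using assms by (intro test_functionI[of _ K] Ck_mult) (auto intro: test_function_smooth)
qed

lemma test_function_add_scaled:
  assumes "\<phi> \<in> test_functions \<Omega>" "\<psi> \<in> test_functions \<Omega>"
  shows "(\<lambda>x. \<phi> x + c * \<psi> x) \<in> test_functions \<Omega>"
proof -
  obtain K where "compact K" "K \<subseteq> \<Omega>" "\<And>x. x \<notin> K \<Longrightarrow> \<phi> x = 0"
    using test_function_support[OF assms(1)] by blast
  moreover obtain L where "compact L" "L \<subseteq> \<Omega>" "\<And>x. x \<notin> L \<Longrightarrow> \<psi> x = 0"
    using test_function_support[OF assms(2)] by blast
  ultimately show ?thesis
    using assms by (intro test_functionI[of _ "K \<union> L"] Ck_add Ck_mult Ck_const)
      (auto intro: test_function_smooth compact_Un)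
qed

lemma test_function_zero: "(\<lambda>x. 0) \<in> test_functions \<Omega>"
  by (rule test_functionI[of _ "{}"]) (auto intro: Ck_const)

lemma test_function_frechet:
  assumes "\<phi> \<in> test_functions \<Omega>" "b \<in> Basis"
  shows "(\<lambda>x. frechet_derivative \<phi> (at x) b) \<in> test_functions \<Omega>"
proof -
  obtain K where K: "compact K" "K \<subseteq> \<Omega>" "\<And>x. x \<notin> K \<Longrightarrow> \<phi> x = 0"
    using test_function_support[OF assms(1)] by blast
  have "frechet_derivative \<phi> (at x) b = 0" if "x \<notin> K" for x
  proof -
    have "((\<lambda>_. 0) has_derivative (\<lambda>_. 0)) (at x)"
      by simp
    then have "(\<phi> has_derivative (\<lambda>_. 0)) (at x)"
      by (rule has_derivative_transform_within_open[where s = "- K"])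
         (use K that compact_imp_closed in auto)
    then show ?thesis
      using frechet_derivative_at by metis
  qed
  then show ?thesis
    using K assms by (intro test_functionI[of _ K] smooth_frechet) (auto intro: test_function_smooth)
qed

lemma bump_test_function:
  assumes "cbox c d \<subseteq> \<Omega>" "s > 0"
  shows "bump s c d \<in> test_functions \<Omega>"
proof (rule test_functionI[of _ "cbox c d"])
  show "bump s c d x = 0" if "x \<notin> cbox c d" for x
    using that box_subset_cbox[of c d] bump_eq_0_iff[OF assms(2)] by blast
qed (use assms Ck_bump in \<open>auto simp del: Ck.simps\<close>)

lemma test_function_continuous: "\<phi> \<in> test_functions \<Omega> \<Longrightarrow> continuous_on UNIV \<phi>"
  using test_function_smooth[of \<phi> \<Omega> 0] by simp

lemma test_function_borel: "\<phi> \<in> test_functions \<Omega> \<Longrightarrow> \<phi> \<in> borel_measurable borel"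
  by (rule borel_measurable_continuous_onI[OF test_function_continuous])

lemma test_function_bounded:
  assumes "\<phi> \<in> test_functions \<Omega>"
  obtains B where "B > 0" "\<And>x. \<bar>\<phi> x\<bar> \<le> B"
proof -
  obtain K where K: "compact K" "K \<subseteq> \<Omega>" "\<And>x. x \<notin> K \<Longrightarrow> \<phi> x = 0"
    using test_function_support[OF assms] by blast
  have "bounded (\<phi> ` K)"
    using K(1) test_function_continuous[OF assms]
    by (intro compact_imp_bounded compact_continuous_image) (auto intro: continuous_on_subset)
  then obtain B where B: "B > 0" "\<And>x. x \<in> K \<Longrightarrow> norm (\<phi> x) \<le> B"
    by (auto simp: bounded_pos)
  have "\<bar>\<phi> x\<bar> \<le> B" for x
    using B K(3)[of x] by (cases "x \<in> K") auto
  then show ?thesis using that B(1) by blast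
qed

lemma test_function_integrable:
  assumes "\<phi> \<in> test_functions \<Omega>"
  shows "integrable lborel \<phi>"
proof -
  obtain K where K: "compact K" "K \<subseteq> \<Omega>" "\<And>x. x \<notin> K \<Longrightarrow> \<phi> x = 0"
    using test_function_support[OF assms] by blast
  have "integrable lborel (\<lambda>x. indicator K x *\<^sub>R \<phi> x)"
    using K(1) test_function_continuous[OF assms]
    by (intro borel_integrable_compact) (auto intro: continuous_on_subset)
  moreover have "(\<lambda>x. indicator K x *\<^sub>R \<phi> x) = \<phi>"
    using K(3) by (intro ext) (auto simp: indicator_def)
  ultimately show ?thesis by simp
qed

definition grad :: "('a::euclidean_space \<Rightarrow> real) \<Rightarrow> 'a \<Rightarrow> 'a" where
  "grad \<phi> x = (\<Sum>b\<in>Basis. frechet_derivative \<phi> (at x) b *\<^sub>R b)"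

lemma grad_inner_Basis: "b \<in> Basis \<Longrightarrow> grad \<phi> x \<bullet> b = frechet_derivative \<phi> (at x) b"
  by (simp add: grad_def)

lemma grad_inner:
  assumes "\<phi> \<in> test_functions \<Omega>"
  shows "frechet_derivative \<phi> (at x) h = grad \<phi> x \<bullet> h"
proof -
  have "linear (frechet_derivative \<phi> (at x))"
    using test_function_has_derivative[OF assms] has_derivative_linear by blast
  then have "frechet_derivative \<phi> (at x) (\<Sum>b\<in>Basis. (h \<bullet> b) *\<^sub>R b) =
      (\<Sum>b\<in>Basis. (h \<bullet> b) * frechet_derivative \<phi> (at x) b)"
    by (simp add: linear_sum linear_cmul)
  then show ?thesis
    unfolding euclidean_representation by (simp add: grad_def inner_sum_left mult.commute inner_commute[of h])
qed

lemma grad_eqI: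
  assumes "\<phi> \<in> test_functions \<Omega>" "(\<phi> has_derivative (\<lambda>h. g \<bullet> h)) (at x)"
  shows "grad \<phi> x = g"
proof (rule euclidean_eqI)
  fix b :: 'a assume "b \<in> Basis"
  then show "grad \<phi> x \<bullet> b = g \<bullet> b"
    using frechet_derivative_at[OF assms(2)] by (simp add: grad_inner_Basis)
qed

lemma grad_has_derivative:
  "\<phi> \<in> test_functions \<Omega> \<Longrightarrow> (\<phi> has_derivative (\<lambda>h. grad \<phi> x \<bullet> h)) (at x)"
  using test_function_has_derivative grad_inner by (metis (no_types, lifting) ext)

lemma grad_add_scaled:
  assumes "\<phi> \<in> test_functions \<Omega>" "\<psi> \<in> test_functions \<Omega>"
  shows "grad (\<lambda>x. \<phi> x + c * \<psi> x) x = grad \<phi> x + c *\<^sub>R grad \<psi> x"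
  by (rule grad_eqI[OF test_function_add_scaled[OF assms]])
     (auto intro!: derivative_eq_intros grad_has_derivative[OF assms(1)]
        grad_has_derivative[OF assms(2)] simp: inner_add_left)

lemma grad_mult:
  assumes "\<phi> \<in> test_functions \<Omega>" "\<psi> \<in> test_functions \<Omega>"
  shows "grad (\<lambda>x. \<phi> x * \<psi> x) x = \<phi> x *\<^sub>R grad \<psi> x + \<psi> x *\<^sub>R grad \<phi> x"
  by (rule grad_eqI[OF test_function_mult_smooth[OF assms(2) test_function_smooth[OF assms(1)]]])
     (auto intro!: derivative_eq_intros grad_has_derivative[OF assms(1)]
        grad_has_derivative[OF assms(2)] simp: inner_add_left)

lemma integral_lebesgue_on_eq_lborel:
  fixes f :: "'a::euclidean_space \<Rightarrow> real"
  assumes "\<Omega> \<in> sets lebesgue" "f \<in> borel_measurable borel" "\<And>x. x \<notin> \<Omega> \<Longrightarrow> f x = 0"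
  shows "(LINT x|lebesgue_on \<Omega>. f x) = (LINT x|lborel. f x)"
proof -
  have "(\<lambda>x. if x \<in> \<Omega> then f x else 0) = f"
    using assms(3) by auto
  then have "(LINT x|lebesgue_on \<Omega>. f x) = (LINT x|lebesgue. f x)"
    using Lebesgue_Measure.integral_restrict_UNIV[OF assms(1), of f] by simp
  also have "\<dots> = (LINT x|lborel. f x)"
    using assms(2) by (intro integral_completion) simp
  finally show ?thesis .
qed

text \<open>The integral of \<open>\<phi> (x + h b)\<close> does not depend on \<open>h\<close> because Lebesgue measure is translation
  invariant. Differentiating under the integral sign gives the divergence theorem for compactly
  supported functions without any boundary.\<close>

lemma integral_derivative_test_function:
  assumes \<phi>: "\<phi> \<in> test_functions \<Omega>" and b: "b \<in> Basis"
  shows "(LINT x|lborel. frechet_derivative \<phi> (at x) b) = 0"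
proof -
  obtain K where K: "compact K" "K \<subseteq> \<Omega>" "\<And>x. x \<notin> K \<Longrightarrow> \<phi> x = 0"
    using test_function_support[OF \<phi>] by blast
  obtain B where B: "B > 0" "\<And>x. \<bar>frechet_derivative \<phi> (at x) b\<bar> \<le> B"
    using test_function_bounded[OF test_function_frechet[OF \<phi> b]] by blast
  obtain R where R: "\<And>x. x \<in> K \<Longrightarrow> norm x \<le> R"
    using compact_imp_bounded[OF K(1)] by (auto simp: bounded_iff)
  define h where "h n = inverse (real (Suc n))" for n
  have h: "0 < h n" "h n \<le> 1" for n
    by (simp_all add: h_def inverse_le_1_iff)
  define D where "D n x = (\<phi> (x + h n *\<^sub>R b) - \<phi> x) / h n" for n x
  have [measurable]: "\<phi> \<in> borel_measurable borel" "(\<lambda>x. frechet_derivative \<phi> (at x) b) \<in> borel_measurable borel"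
    using test_function_borel \<phi> test_function_frechet[OF \<phi> b] by blast+
  have line: "((\<lambda>t. \<phi> (x + t *\<^sub>R b)) has_real_derivative frechet_derivative \<phi> (at (x + t *\<^sub>R b)) b) (at t)"
    for x t
  proof -
    have "((\<lambda>t. \<phi> (x + t *\<^sub>R b)) has_derivative (\<lambda>s. grad \<phi> (x + t *\<^sub>R b) \<bullet> (s *\<^sub>R b))) (at t)"
      by (rule has_derivative_compose[OF _ grad_has_derivative[OF \<phi>]])
         (auto intro!: derivative_eq_intros)
    then show ?thesis
      unfolding has_field_derivative_def
      by (rule has_derivative_eq_rhs) (use b in \<open>auto simp: grad_inner_Basis\<close>)
  qed
  have lim: "(\<lambda>n. D n x) \<longlonglongrightarrow> frechet_derivative \<phi> (at x) b" for x
  proof -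
    have "((\<lambda>t. (\<phi> (x + t *\<^sub>R b) - \<phi> x) / t) \<longlongrightarrow> frechet_derivative \<phi> (at x) b) (at 0)"
      using line[of x 0] by (simp add: DERIV_def)
    moreover have "filterlim h (at 0) sequentially"
    proof (rule filterlim_atI)
      show "h \<longlonglongrightarrow> 0"
        unfolding h_def by (rule LIMSEQ_inverse_real_of_nat)
      show "\<forall>\<^sub>F n in sequentially. h n \<noteq> 0"
        using h(1) by (simp add: less_imp_neq[symmetric])
    qed
    ultimately show ?thesis
      unfolding D_def by (rule filterlim_compose)
  qed
  have bound: "norm (D n x) \<le> indicator (cball 0 (R + 1)) x * B" for n x
  proof (cases "x \<in> cball 0 (R + 1)")
    case True
    obtain z where "\<phi> (x + h n *\<^sub>R b) - \<phi> (x + 0 *\<^sub>R b) =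
        (h n - 0) * frechet_derivative \<phi> (at (x + z *\<^sub>R b)) b"
      using MVT2[OF h(1)[of n], of "\<lambda>t. \<phi> (x + t *\<^sub>R b)"
          "\<lambda>t. frechet_derivative \<phi> (at (x + t *\<^sub>R b)) b"] line by blast
    then have "D n x = frechet_derivative \<phi> (at (x + z *\<^sub>R b)) b"
      using h(1)[of n] by (simp add: D_def)
    then show ?thesis using True B(2) by simp
  next
    case False
    have "norm x \<le> norm (x + h n *\<^sub>R b) + h n"
      using norm_triangle_ineq4[of "x + h n *\<^sub>R b" "h n *\<^sub>R b"] b h(1)[of n] by simp
    then have "x \<notin> K" "x + h n *\<^sub>R b \<notin> K"
      using False h(2)[of n] R by (force simp: )+
    then show ?thesis using K(3) False by (simp add: D_def)
  qed
  have D0: "(LINT x|lborel. D n x) = 0" for n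
  proof -
    have "integrable (distr lborel borel ((+) (h n *\<^sub>R b))) \<phi>"
      using test_function_integrable[OF \<phi>] by (simp add: lborel_distr_plus)
    then have int: "integrable lborel (\<lambda>x. \<phi> (x + h n *\<^sub>R b))"
      by (subst (asm) integrable_distr_eq) (auto simp: add.commute)
    have "(LINT x|lborel. \<phi> x) = (LINT x|distr lborel borel ((+) (h n *\<^sub>R b)). \<phi> x)"
      by (simp add: lborel_distr_plus)
    also have "\<dots> = (LINT x|lborel. \<phi> (x + h n *\<^sub>R b))"
      by (subst integral_distr) (auto simp: add.commute)
    finally show ?thesis
      using int test_function_integrable[OF \<phi>] by (simp add: D_def)
  qed
  have "(\<lambda>n. LINT x|lborel. D n x) \<longlonglongrightarrow> (LINT x|lborel. frechet_derivative \<phi> (at x) b)"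
  proof (rule integral_dominated_convergence[where w = "\<lambda>x. indicator (cball 0 (R + 1)) x * B"])
    show "integrable lborel (\<lambda>x. indicator (cball 0 (R + 1)) x * B)"
      by (intro integrable_mult_left integrable_real_indicator)
        (use emeasure_compact_finite[of "cball 0 (R + 1)"] in auto)
  qed (use lim bound in \<open>auto simp: D_def[abs_def]\<close>)
  then show ?thesis
    by (simp add: D0 LIMSEQ_const_iff)
qed

lemma continuous_imp_locally_integrable:
  fixes f :: "'a::euclidean_space \<Rightarrow> 'b::euclidean_space"
  assumes "continuous_on UNIV f"
  shows "locally_integrable \<Omega> f"
  unfolding locally_integrable_def
proof (intro allI impI)
  fix K :: "'a set" assume K: "compact K \<and> K \<subseteq> \<Omega>"
  have "integrable lborel (\<lambda>x. indicator K x *\<^sub>R f x)"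
    using K assms by (intro borel_integrable_compact) (auto intro: continuous_on_subset)
  moreover have "(\<lambda>x. indicator K x *\<^sub>R f x) \<in> borel_measurable borel"
    using K assms by (intro borel_measurable_continuous_on_indicator borel_compact)
      (auto intro: continuous_on_subset)
  ultimately show "f absolutely_integrable_on K"
    unfolding set_integrable_def by (subst integrable_completion) auto
qed

text \<open>The product rule turns the vanishing integral of the derivative of \<open>\<phi> * \<psi>\<close> into integration by
  parts.\<close>

lemma has_weak_grad_test_function:
  assumes "open \<Omega>" and \<phi>: "\<phi> \<in> test_functions \<Omega>"
  shows "has_weak_grad \<Omega> \<phi> (grad \<phi>)"
proof -
  have cont: "continuous_on UNIV (grad \<phi>)"
    unfolding grad_def by (intro continuous_intros test_function_continuous[OF test_function_frechet[OF \<phi>]])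
  have "(LINT x|lebesgue_on \<Omega>. \<phi> x * frechet_derivative \<psi> (at x) b) =
        - (LINT x|lebesgue_on \<Omega>. (grad \<phi> x \<bullet> b) * \<psi> x)"
    if \<psi>: "\<psi> \<in> test_functions \<Omega>" and b: "b \<in> Basis" for \<psi> b
  proof -
    have \<Omega>: "\<Omega> \<in> sets lebesgue"
      using assms(1) by (simp add: borel_open)
    have p: "(\<lambda>x. \<phi> x * \<psi> x) \<in> test_functions \<Omega>"
      using test_function_mult_smooth[OF \<psi> test_function_smooth[OF \<phi>]] .
    have q: "(\<lambda>x. \<phi> x * frechet_derivative \<psi> (at x) b) \<in> test_functions \<Omega>"
      using test_function_mult_smooth[OF test_function_frechet[OF \<psi> b] test_function_smooth[OF \<phi>]] .
    have r: "(\<lambda>x. frechet_derivative \<phi> (at x) b * \<psi> x) \<in> test_functions \<Omega>"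
      using test_function_mult_smooth[OF \<psi> test_function_smooth[OF test_function_frechet[OF \<phi> b]]] .
    have "frechet_derivative (\<lambda>x. \<phi> x * \<psi> x) (at x) b =
        \<phi> x * frechet_derivative \<psi> (at x) b + frechet_derivative \<phi> (at x) b * \<psi> x" for x
      using grad_mult[OF \<phi> \<psi>, of x] b
      by (simp add: inner_add_left mult.commute flip: grad_inner_Basis)
    then have "0 = (LINT x|lborel. \<phi> x * frechet_derivative \<psi> (at x) b +
        frechet_derivative \<phi> (at x) b * \<psi> x)"
      using integral_derivative_test_function[OF p b] by simp
    also have "\<dots> = (LINT x|lborel. \<phi> x * frechet_derivative \<psi> (at x) b) +
        (LINT x|lborel. frechet_derivative \<phi> (at x) b * \<psi> x)"
      by (intro Bochner_Integration.integral_add test_function_integrable[OF q] test_function_integrable[OF r])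
    finally show ?thesis
      using b integral_lebesgue_on_eq_lborel[OF \<Omega> test_function_borel[OF q] test_function_outside[OF q]]
        integral_lebesgue_on_eq_lborel[OF \<Omega> test_function_borel[OF r] test_function_outside[OF r]]
      by (simp add: grad_inner_Basis)
  qed
  then show ?thesis
    using continuous_imp_locally_integrable[OF cont]
      continuous_imp_locally_integrable[OF test_function_continuous[OF \<phi>]]
    by (auto simp: has_weak_grad_def)
qed

section \<open>Semi-inner products, Riesz representation and the Lax-Milgram theorem\<close>

text \<open>Used twice: for the Cauchy-Schwarz inequality, and for the residual of an approximate minimiser in
  the Riesz theorem.\<close>

lemma quadratic_nonneg_imp_discriminant:
  fixes a b d :: real
  assumes nonneg: "\<And>c. 0 \<le> a + 2 * c * b + c\<^sup>2 * d" and "0 \<le> d"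
  shows "b\<^sup>2 \<le> a * d"
proof (cases "d = 0")
  case True
  have "b = 0"
  proof (rule ccontr)
    assume "b \<noteq> 0"
    then have "2 * (- (a + 1) / (2 * b)) * b = - (a + 1)"
      by simp
    then show False
      using nonneg[of "- (a + 1) / (2 * b)"] True by simp
  qed
  then show ?thesis using True by simp
next
  case False
  have "0 \<le> (a + 2 * (- b / d) * b + (- b / d)\<^sup>2 * d) * d"
    using nonneg[of "- b / d"] \<open>0 \<le> d\<close> by (intro mult_nonneg_nonneg) auto
  also have "\<dots> = a * d - b\<^sup>2"
    using False by (simp add: field_simps power2_eq_square)
  finally show ?thesis by simp
qed

text \<open>The elements of Sobolev spaces are functions that matter only up to null sets, so the bilinear
  forms on them are only semidefinite on representatives. A carrier set of functions together with
  a semi-inner product avoids quotients.\<close>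

locale semi_inner_space =
  fixes V :: "('a \<Rightarrow> 'b::real_vector) set" and I :: "('a \<Rightarrow> 'b) \<Rightarrow> ('a \<Rightarrow> 'b) \<Rightarrow> real"
  assumes closed: "p \<in> V \<Longrightarrow> q \<in> V \<Longrightarrow> (\<lambda>x. p x + c *\<^sub>R q x) \<in> V"
    and linear: "p \<in> V \<Longrightarrow> q \<in> V \<Longrightarrow> r \<in> V \<Longrightarrow> I (\<lambda>x. p x + c *\<^sub>R q x) r = I p r + c * I q r"
    and sym: "p \<in> V \<Longrightarrow> q \<in> V \<Longrightarrow> I p q = I q p"
    and nonneg: "p \<in> V \<Longrightarrow> 0 \<le> I p p"
begin

lemma diff_closed: "p \<in> V \<Longrightarrow> q \<in> V \<Longrightarrow> (\<lambda>x. p x - q x) \<in> V"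
  using closed[of p q "-1"] by simp

lemma diff_left: "p \<in> V \<Longrightarrow> q \<in> V \<Longrightarrow> r \<in> V \<Longrightarrow> I (\<lambda>x. p x - q x) r = I p r - I q r"
  using linear[of p q r "-1"] by simp

lemma expand:
  assumes "p \<in> V" "q \<in> V"
  shows "I (\<lambda>x. p x + c *\<^sub>R q x) (\<lambda>x. p x + c *\<^sub>R q x) = I p p + 2 * c * I p q + c\<^sup>2 * I q q"
proof -
  note pq = closed[OF assms, of c]
  have "I (\<lambda>x. p x + c *\<^sub>R q x) (\<lambda>x. p x + c *\<^sub>R q x) =
      I p (\<lambda>x. p x + c *\<^sub>R q x) + c * I q (\<lambda>x. p x + c *\<^sub>R q x)"
    by (rule linear[OF assms pq])
  also have "I p (\<lambda>x. p x + c *\<^sub>R q x) = I p p + c * I q p"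
    using linear[OF assms assms(1)] sym[OF assms(1) pq] by simp
  also have "I q (\<lambda>x. p x + c *\<^sub>R q x) = I p q + c * I q q"
    using linear[OF assms assms(2)] sym[OF assms(2) pq] by simp
  finally show ?thesis
    using sym[OF assms] by (simp add: algebra_simps power2_eq_square)
qed

lemma Cauchy_Schwarz:
  assumes "p \<in> V" "q \<in> V"
  shows "(I p q)\<^sup>2 \<le> I p p * I q q"
proof (rule quadratic_nonneg_imp_discriminant)
  show "0 \<le> I p p + 2 * c * I p q + c\<^sup>2 * I q q" for c
    using nonneg[OF closed[OF assms]] expand[OF assms] by metis
qed (rule nonneg[OF assms(2)])

lemma Cauchy_Schwarz_sqrt:
  assumes "p \<in> V" "q \<in> V"
  shows "\<bar>I p q\<bar> \<le> sqrt (I p p) * sqrt (I q q)"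
  using real_sqrt_le_mono[OF Cauchy_Schwarz[OF assms]] by (simp add: real_sqrt_mult)

lemma triangle:
  assumes "p \<in> V" "q \<in> V"
  shows "sqrt (I (\<lambda>x. p x + q x) (\<lambda>x. p x + q x)) \<le> sqrt (I p p) + sqrt (I q q)"
proof (rule real_le_lsqrt)
  have "I (\<lambda>x. p x + q x) (\<lambda>x. p x + q x) = I p p + 2 * I p q + I q q"
    using expand[OF assms, of 1] by simp
  also have "\<dots> \<le> I p p + 2 * (sqrt (I p p) * sqrt (I q q)) + I q q"
    using Cauchy_Schwarz_sqrt[OF assms] by simp
  also have "\<dots> = (sqrt (I p p) + sqrt (I q q))\<^sup>2"
    using nonneg assms by (simp add: power2_sum algebra_simps)
  finally show "I (\<lambda>x. p x + q x) (\<lambda>x. p x + q x) \<le> (sqrt (I p p) + sqrt (I q q))\<^sup>2" .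
qed (simp add: assms nonneg)

definition nrm :: "('a \<Rightarrow> 'b) \<Rightarrow> real" where
  "nrm p = sqrt (I p p)"

lemma nrm_nonneg: "p \<in> V \<Longrightarrow> 0 \<le> nrm p"
  by (simp add: nrm_def nonneg)

lemma nrm_power2: "p \<in> V \<Longrightarrow> (nrm p)\<^sup>2 = I p p"
  by (simp add: nrm_def nonneg)

definition complete_carrier :: bool where
  "complete_carrier \<longleftrightarrow> (\<forall>s. (\<forall>n. s n \<in> V) \<longrightarrow>
     (\<forall>e>0. \<exists>N. \<forall>m\<ge>N. \<forall>n\<ge>N. nrm (\<lambda>x. s m x - s n x) < e) \<longrightarrow>
     (\<exists>u\<in>V. (\<lambda>n. nrm (\<lambda>x. u x - s n x)) \<longlonglongrightarrow> 0))"

definition bounded_functional :: "(('a \<Rightarrow> 'b) \<Rightarrow> real) \<Rightarrow> bool" where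
  "bounded_functional l \<longleftrightarrow> (\<forall>p\<in>V. \<forall>q\<in>V. \<forall>c. l (\<lambda>x. p x + c *\<^sub>R q x) = l p + c * l q) \<and>
     (\<exists>C. \<forall>q\<in>V. \<bar>l q\<bar> \<le> C * nrm q)"

text \<open>The representer minimises the energy \<open>I u u - 2 * l u\<close>. The parallelogram identity makes every
  minimising sequence a Cauchy sequence. Instead of passing to the limit in the energy, the
  proof passes to the limit in the approximate Euler equation: an energy within \<open>\<epsilon>\<close> of the infimum
  forces the residual \<open>I u q - l q\<close> to be at most \<open>sqrt \<epsilon> * nrm q\<close>.\<close>

theorem Riesz:
  assumes complete: complete_carrier and l: "bounded_functional l" and "V \<noteq> {}"
  obtains u where "u \<in> V" "\<And>q. q \<in> V \<Longrightarrow> I u q = l q"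
proof -
  have l_lin: "l (\<lambda>x. p x + c *\<^sub>R q x) = l p + c * l q" if "p \<in> V" "q \<in> V" for p q c
    using l that by (simp add: bounded_functional_def)
  obtain C where C: "\<And>q. q \<in> V \<Longrightarrow> \<bar>l q\<bar> \<le> C * nrm q"
    using l unfolding bounded_functional_def by blast
  define J where "J u = I u u - 2 * l u" for u
  have J_expand: "J (\<lambda>x. p x + c *\<^sub>R q x) = J p + 2 * c * (I p q - l q) + c\<^sup>2 * I q q"
    if "p \<in> V" "q \<in> V" for p q c
    using that by (simp add: J_def expand l_lin algebra_simps)
  have J_lower: "- C\<^sup>2 \<le> J u" if "u \<in> V" for u
  proof -
    have "0 \<le> (nrm u - C)\<^sup>2" by simp
    also have "\<dots> = I u u - 2 * (C * nrm u) + C\<^sup>2"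
      using nrm_power2[OF that] by (simp add: power2_diff algebra_simps)
    finally show ?thesis
      using C[OF that] by (simp add: J_def)
  qed
  then have bdd: "bdd_below (J ` V)" by (rule bdd_belowI2)
  define m where "m = Inf (J ` V)"
  have m: "m \<le> J u" if "u \<in> V" for u
    unfolding m_def using that bdd by (intro cInf_lower) auto
  define \<epsilon> where "\<epsilon> n = inverse (real (Suc n))" for n
  have \<epsilon>: "\<epsilon> \<longlonglongrightarrow> 0" "0 < \<epsilon> n" for n
    unfolding \<epsilon>_def[abs_def] by (rule LIMSEQ_inverse_real_of_nat) simp
  have "\<exists>u\<in>V. J u < m + \<epsilon> n" for n
    using cInf_lessD[of "J ` V" "m + \<epsilon> n"] \<open>V \<noteq> {}\<close> \<epsilon>(2)[of n] by (auto simp: m_def)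
  then obtain s where s: "\<And>n. s n \<in> V" "\<And>n. J (s n) < m + \<epsilon> n"
    by metis
  have dist: "I (\<lambda>x. s i x - s j x) (\<lambda>x. s i x - s j x) \<le> 2 * \<epsilon> i + 2 * \<epsilon> j" for i j
  proof -
    define d where "d x = s i x - s j x" for x
    have d: "d \<in> V"
      unfolding d_def by (rule diff_closed[OF s(1) s(1)])
    \<comment> \<open>Comparing the energy at \<open>s i\<close> with the energy at the midpoint, which is at least \<open>m\<close>.\<close>
    have "J (s i) = J (s j) + 2 * (I (s j) d - l d) + I d d"
      using J_expand[OF s(1)[of j] d, of 1] by (simp add: d_def)
    moreover have "m \<le> J (s j) + (I (s j) d - l d) + I d d / 4"
      using m[OF closed[OF s(1)[of j] d, of "1 / 2"]] J_expand[OF s(1)[of j] d, of "1 / 2"]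
      by (simp add: power2_eq_square)
    ultimately show ?thesis
      using s(2)[of i] s(2)[of j] by (simp add: d_def[abs_def])
  qed
  have Cauchy: "\<exists>N. \<forall>i\<ge>N. \<forall>j\<ge>N. nrm (\<lambda>x. s i x - s j x) < e" if "e > 0" for e
  proof -
    obtain N where N: "\<And>n. n \<ge> N \<Longrightarrow> \<epsilon> n < e\<^sup>2 / 4"
      using order_tendstoD(2)[OF \<epsilon>(1), of "e\<^sup>2 / 4"] \<open>e > 0\<close> by (auto simp: eventually_sequentially)
    have "nrm (\<lambda>x. s i x - s j x) < e" if "i \<ge> N" "j \<ge> N" for i j
    proof -
      have "I (\<lambda>x. s i x - s j x) (\<lambda>x. s i x - s j x) < e\<^sup>2"
        using dist[of i j] N[OF that(1)] N[OF that(2)] by linarith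
      then have "nrm (\<lambda>x. s i x - s j x) < sqrt (e\<^sup>2)"
        unfolding nrm_def by (rule real_sqrt_less_mono)
      then show ?thesis
        using \<open>e > 0\<close> by simp
    qed
    then show ?thesis by blast
  qed
  then obtain u where u: "u \<in> V" "(\<lambda>n. nrm (\<lambda>x. u x - s n x)) \<longlonglongrightarrow> 0"
    using complete[unfolded complete_carrier_def, rule_format, of s] s(1) by blast
  have "I u q = l q" if q: "q \<in> V" for q
  proof -
    have residual: "(I (s n) q - l q)\<^sup>2 \<le> \<epsilon> n * I q q" for n
    proof (rule quadratic_nonneg_imp_discriminant[OF _ nonneg[OF q]])
      show "0 \<le> \<epsilon> n + 2 * c * (I (s n) q - l q) + c\<^sup>2 * I q q" for c
        using m[OF closed[OF s(1)[of n] q, of c]] J_expand[OF s(1)[of n] q, of c] s(2)[of n] by simp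
    qed
    have "(\<lambda>n. (I (s n) q - l q)\<^sup>2) \<longlonglongrightarrow> 0"
    proof (rule tendsto_sandwich[OF _ _ tendsto_const])
      show "(\<lambda>n. \<epsilon> n * I q q) \<longlonglongrightarrow> 0"
        using tendsto_mult_right[OF \<epsilon>(1), of "I q q"] by simp
    qed (use residual in auto)
    then have "(\<lambda>n. sqrt ((I (s n) q - l q)\<^sup>2)) \<longlonglongrightarrow> sqrt 0"
      by (rule tendsto_real_sqrt)
    then have "(\<lambda>n. I (s n) q - l q) \<longlonglongrightarrow> 0"
      by (simp add: tendsto_rabs_zero_iff)
    moreover have "(\<lambda>n. I u q - I (s n) q) \<longlonglongrightarrow> 0"
    proof (rule Lim_null_comparison)
      show "(\<lambda>n. nrm (\<lambda>x. u x - s n x) * nrm q) \<longlonglongrightarrow> 0"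
        using tendsto_mult_right[OF u(2), of "nrm q"] by simp
      have "\<bar>I u q - I (s n) q\<bar> \<le> nrm (\<lambda>x. u x - s n x) * nrm q" for n
        using Cauchy_Schwarz_sqrt[OF diff_closed[OF u(1) s(1)[of n]] q] diff_left[OF u(1) s(1)[of n] q]
        by (simp add: nrm_def)
      then show "\<forall>\<^sub>F n in sequentially. norm (I u q - I (s n) q) \<le> nrm (\<lambda>x. u x - s n x) * nrm q"
        by simp
    qed
    ultimately have "(\<lambda>n. (I (s n) q - l q) + (I u q - I (s n) q)) \<longlonglongrightarrow> 0 + 0"
      by (rule tendsto_add)
    then show ?thesis
      by (simp add: LIMSEQ_const_iff)
  qed
  with u(1) that show ?thesis by blast
qed

lemma null_imp_orthogonal:
  assumes "e \<in> V" "nrm e = 0" "q \<in> V"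
  shows "I e q = 0"
  using Cauchy_Schwarz_sqrt[OF assms(1,3)] assms(2) by (simp add: nrm_def)

text \<open>Let \<open>A\<close> represent the form, so that \<open>a p q = I (A p) q\<close>, and let \<open>z\<close> represent the functional.
  Coercivity makes \<open>I (A p) (A q)\<close> a semi-inner product with an equivalent norm, so Riesz applies
  to it and yields the least squares solution of \<open>A u = z\<close>. Its residual \<open>e\<close> satisfies
  \<open>a w e = 0\<close> for all \<open>w\<close>, and coercivity at \<open>w = e\<close> makes it vanish.\<close>

theorem Lax_Milgram:
  assumes complete: complete_carrier and ne: "V \<noteq> {}" and l: "bounded_functional l"
    and left: "\<And>p q r c. p \<in> V \<Longrightarrow> q \<in> V \<Longrightarrow> r \<in> V \<Longrightarrow> a (\<lambda>x. p x + c *\<^sub>R q x) r = a p r + c * a q r"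
    and right: "\<And>p q r c. p \<in> V \<Longrightarrow> q \<in> V \<Longrightarrow> r \<in> V \<Longrightarrow> a r (\<lambda>x. p x + c *\<^sub>R q x) = a r p + c * a r q"
    and bounded: "\<And>p q. p \<in> V \<Longrightarrow> q \<in> V \<Longrightarrow> \<bar>a p q\<bar> \<le> C * nrm p * nrm q"
    and coercive: "\<And>p. p \<in> V \<Longrightarrow> \<kappa> * (nrm p)\<^sup>2 \<le> a p p" and \<kappa>: "0 < \<kappa>"
  obtains u where "u \<in> V" "\<And>q. q \<in> V \<Longrightarrow> a u q = l q"
proof -
  have "\<exists>w\<in>V. \<forall>q\<in>V. I w q = a p q" if p: "p \<in> V" for p
  proof -
    have "bounded_functional (a p)"
      unfolding bounded_functional_def using right[OF _ _ p] bounded[OF p] by blast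
    then show ?thesis
      using Riesz[OF complete _ ne] by metis
  qed
  then obtain A where A: "\<And>p. p \<in> V \<Longrightarrow> A p \<in> V" "\<And>p q. p \<in> V \<Longrightarrow> q \<in> V \<Longrightarrow> I (A p) q = a p q"
    by metis
  obtain z where z: "z \<in> V" "\<And>q. q \<in> V \<Longrightarrow> I z q = l q"
    using Riesz[OF complete l ne] by blast
  have lower: "\<kappa> * nrm p \<le> nrm (A p)" if p: "p \<in> V" for p
  proof (cases "nrm p = 0")
    case False
    then have "0 < nrm p" using nrm_nonneg[OF p] by simp
    have "\<kappa> * nrm p * nrm p \<le> a p p"
      using coercive[OF p] by (simp add: power2_eq_square mult.assoc)
    also have "\<dots> \<le> nrm (A p) * nrm p"
      using Cauchy_Schwarz_sqrt[OF A(1)[OF p] p] A(2)[OF p p] by (simp add: nrm_def)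
    finally show ?thesis
      using \<open>0 < nrm p\<close> by simp
  qed (simp add: nrm_nonneg A(1) p)
  have upper: "nrm (A p) \<le> C * nrm p" if p: "p \<in> V" for p
  proof (cases "nrm (A p) = 0")
    case True
    then have "nrm p = 0"
      using lower[OF p] nrm_nonneg[OF p] \<kappa> by (simp add: mult_le_0_iff)
    with True show ?thesis by simp
  next
    case False
    then have "0 < nrm (A p)" using nrm_nonneg[OF A(1)[OF p]] by simp
    moreover have "nrm (A p) * nrm (A p) \<le> C * nrm p * nrm (A p)"
      using nrm_power2[OF A(1)[OF p]] A(2)[OF p A(1)[OF p]] bounded[OF p A(1)[OF p]]
      by (simp add: power2_eq_square)
    ultimately show ?thesis by simp
  qed
  interpret K: semi_inner_space V "\<lambda>p q. I (A p) (A q)"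
  proof
    show "I (A (\<lambda>x. p x + c *\<^sub>R q x)) (A r) = I (A p) (A r) + c * I (A q) (A r)"
      if "p \<in> V" "q \<in> V" "r \<in> V" for p q r c
      using that A left[OF that(1,2) A(1)[OF that(3)]] closed by simp
    show "0 \<le> I (A p) (A p)" if "p \<in> V" for p
      by (rule nonneg[OF A(1)[OF that]])
    show "I (A p) (A q) = I (A q) (A p)" if "p \<in> V" "q \<in> V" for p q
      by (rule sym[OF A(1)[OF that(1)] A(1)[OF that(2)]])
  qed (rule closed)
  have K_nrm: "K.nrm p = nrm (A p)" for p
    by (simp add: K.nrm_def nrm_def)
  have "K.complete_carrier"
    unfolding K.complete_carrier_def
  proof (intro allI impI)
    fix s :: "nat \<Rightarrow> 'a \<Rightarrow> 'b"
    assume "\<forall>n. s n \<in> V"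
    then have s: "\<And>n. s n \<in> V" by blast
    assume Cauchy: "\<forall>e>0. \<exists>N. \<forall>m\<ge>N. \<forall>n\<ge>N. K.nrm (\<lambda>x. s m x - s n x) < e"
    have "\<exists>N. \<forall>m\<ge>N. \<forall>n\<ge>N. nrm (\<lambda>x. s m x - s n x) < e" if "e > 0" for e
    proof -
      obtain N where N: "\<And>m n. m \<ge> N \<Longrightarrow> n \<ge> N \<Longrightarrow> K.nrm (\<lambda>x. s m x - s n x) < \<kappa> * e"
        using Cauchy[rule_format, OF mult_pos_pos[OF \<kappa> \<open>e > 0\<close>]] by blast
      have "nrm (\<lambda>x. s m x - s n x) < e" if "m \<ge> N" "n \<ge> N" for m n
      proof -
        have "\<kappa> * nrm (\<lambda>x. s m x - s n x) < \<kappa> * e"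
          using lower[OF diff_closed[OF s[of m] s[of n]]] N[OF that] by (simp add: K_nrm)
        then show ?thesis using \<kappa> by simp
      qed
      then show ?thesis by blast
    qed
    then obtain u where u: "u \<in> V" "(\<lambda>n. nrm (\<lambda>x. u x - s n x)) \<longlonglongrightarrow> 0"
      using complete[unfolded complete_carrier_def, rule_format, of s] s by blast
    have "(\<lambda>n. K.nrm (\<lambda>x. u x - s n x)) \<longlonglongrightarrow> 0"
    proof (rule tendsto_sandwich[OF _ _ tendsto_const])
      show "(\<lambda>n. C * nrm (\<lambda>x. u x - s n x)) \<longlonglongrightarrow> 0"
        using tendsto_mult_left[OF u(2), of C] by simp
    qed (use upper[OF diff_closed[OF u(1) s]] K.nrm_nonneg[OF diff_closed[OF u(1) s]] in \<open>auto simp: K_nrm\<close>)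
    then show "\<exists>u\<in>V. (\<lambda>n. K.nrm (\<lambda>x. u x - s n x)) \<longlonglongrightarrow> 0"
      using u(1) by blast
  qed
  moreover have "K.bounded_functional (\<lambda>w. a w z)"
    unfolding K.bounded_functional_def
  proof (intro conjI ballI allI exI[of _ "\<bar>C\<bar> * nrm z / \<kappa>"])
    show "a (\<lambda>x. p x + c *\<^sub>R q x) z = a p z + c * a q z" if "p \<in> V" "q \<in> V" for p q c
      by (rule left[OF that z(1)])
    show "\<bar>a q z\<bar> \<le> \<bar>C\<bar> * nrm z / \<kappa> * K.nrm q" if q: "q \<in> V" for q
    proof -
      have "\<bar>a q z\<bar> \<le> C * nrm q * nrm z"
        by (rule bounded[OF q z(1)])
      also have "\<dots> \<le> \<bar>C\<bar> * nrm q * nrm z"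
        using nrm_nonneg[OF q] nrm_nonneg[OF z(1)] by (intro mult_right_mono) auto
      also have "\<dots> = \<bar>C\<bar> * nrm z / \<kappa> * (\<kappa> * nrm q)"
        using \<kappa> by simp
      also have "\<dots> \<le> \<bar>C\<bar> * nrm z / \<kappa> * K.nrm q"
        using lower[OF q] nrm_nonneg[OF z(1)] \<kappa> unfolding K_nrm by (intro mult_left_mono) auto
      finally show ?thesis .
    qed
  qed
  ultimately obtain u where u: "u \<in> V" "\<And>w. w \<in> V \<Longrightarrow> I (A u) (A w) = a w z"
    using K.Riesz[OF _ _ ne] by blast
  define e where "e x = A u x - z x" for x
  have e: "e \<in> V"
    unfolding e_def[abs_def] by (rule diff_closed[OF A(1)[OF u(1)] z(1)])
  have orth: "a w e = 0" if w: "w \<in> V" for w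
  proof -
    have "a w e = I e (A w)"
      using A(2)[OF w e] sym[OF A(1)[OF w] e] by simp
    also have "\<dots> = I (A u) (A w) - I z (A w)"
      unfolding e_def[abs_def] by (rule diff_left[OF A(1)[OF u(1)] z(1) A(1)[OF w]])
    also have "I z (A w) = a w z"
      using A(2)[OF w z(1)] sym[OF A(1)[OF w] z(1)] by simp
    finally show ?thesis using u(2)[OF w] by simp
  qed
  have "nrm e = 0"
    using coercive[OF e] orth[OF e] \<kappa> nrm_nonneg[OF e] by (simp add: mult_le_0_iff)
  have "a u q = l q" if q: "q \<in> V" for q
    using null_imp_orthogonal[OF e \<open>nrm e = 0\<close> q] diff_left[OF A(1)[OF u(1)] z(1) q] A(2)[OF u(1) q] z(2)[OF q]
    by (simp add: e_def[abs_def])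
  with u(1) that show ?thesis by blast
qed

end

section \<open>Square integrable functions\<close>

lemma L2_inner_integrable:
  assumes "w \<in> L2_space \<Omega>" "z \<in> L2_space \<Omega>"
  shows "integrable (lebesgue_on \<Omega>) (\<lambda>x. w x \<bullet> z x)"
proof (rule Bochner_Integration.integrable_bound)
  show "integrable (lebesgue_on \<Omega>) (\<lambda>x. (norm (w x))\<^sup>2 + (norm (z x))\<^sup>2)"
    using assms by (auto simp: L2_space_def)
  have "\<bar>a \<bullet> b\<bar> \<le> (norm a)\<^sup>2 + (norm b)\<^sup>2" for a b :: 'b
    using Cauchy_Schwarz_ineq2[of a b] sum_squares_bound[of "norm a" "norm b"]
      mult_nonneg_nonneg[of "norm a" "norm b"]
    by (simp add: power2_eq_square)
  then show "AE x in lebesgue_on \<Omega>. norm (w x \<bullet> z x) \<le> norm ((norm (w x))\<^sup>2 + (norm (z x))\<^sup>2)"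
    by simp
qed (use assms in \<open>auto simp: L2_space_def\<close>)

lemma L2_add_scaled:
  assumes "w \<in> L2_space \<Omega>" "z \<in> L2_space \<Omega>"
  shows "(\<lambda>x. w x + c *\<^sub>R z x) \<in> L2_space \<Omega>"
proof -
  have [measurable]: "w \<in> borel_measurable (lebesgue_on \<Omega>)" "z \<in> borel_measurable (lebesgue_on \<Omega>)"
    using assms by (auto simp: L2_space_def)
  have "integrable (lebesgue_on \<Omega>) (\<lambda>x. w x \<bullet> w x + 2 * c * (w x \<bullet> z x) + c\<^sup>2 * (z x \<bullet> z x))"
    using assms by (intro Bochner_Integration.integrable_add integrable_mult_right L2_inner_integrable)
  also have "(\<lambda>x. w x \<bullet> w x + 2 * c * (w x \<bullet> z x) + c\<^sup>2 * (z x \<bullet> z x)) = (\<lambda>x. (norm (w x + c *\<^sub>R z x))\<^sup>2)"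
    unfolding power2_norm_eq_inner
    by (simp add: inner_add_left inner_add_right inner_commute algebra_simps power2_eq_square)
  finally show ?thesis
    by (simp add: L2_space_def)
qed

lemma L2_semi_inner_space: "semi_inner_space (L2_space \<Omega>) (\<lambda>w z. LINT x|lebesgue_on \<Omega>. w x \<bullet> z x)"
proof
  show "(LINT x|lebesgue_on \<Omega>. (p x + c *\<^sub>R q x) \<bullet> r x) =
        (LINT x|lebesgue_on \<Omega>. p x \<bullet> r x) + c * (LINT x|lebesgue_on \<Omega>. q x \<bullet> r x)"
    if "p \<in> L2_space \<Omega>" "q \<in> L2_space \<Omega>" "r \<in> L2_space \<Omega>" for p q r :: "'a \<Rightarrow> 'b" and c
    using that by (simp add: inner_add_left L2_inner_integrable)
qed (auto simp: L2_add_scaled inner_commute)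

interpretation L2: semi_inner_space "L2_space \<Omega>" "\<lambda>w z. LINT x|lebesgue_on \<Omega>. w x \<bullet> z x" for \<Omega>
  by (rule L2_semi_inner_space)

lemma L2_norm_eq_inner: "L2_norm \<Omega> w = sqrt (LINT x|lebesgue_on \<Omega>. w x \<bullet> w x)"
  by (simp add: L2_norm_def power2_norm_eq_inner)

lemma L2_norm_nonneg: "0 \<le> L2_norm \<Omega> w"
  by (simp add: L2_norm_def)

lemma L2_norm_power2: "(L2_norm \<Omega> w)\<^sup>2 = (LINT x|lebesgue_on \<Omega>. (norm (w x))\<^sup>2)"
  by (simp add: L2_norm_def)

lemma L2_Cauchy_Schwarz:
  "w \<in> L2_space \<Omega> \<Longrightarrow> z \<in> L2_space \<Omega> \<Longrightarrow>
    \<bar>LINT x|lebesgue_on \<Omega>. w x \<bullet> z x\<bar> \<le> L2_norm \<Omega> w * L2_norm \<Omega> z"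
  unfolding L2_norm_eq_inner by (rule L2.Cauchy_Schwarz_sqrt)

lemma L2_diff: "w \<in> L2_space \<Omega> \<Longrightarrow> z \<in> L2_space \<Omega> \<Longrightarrow> (\<lambda>x. w x - z x) \<in> L2_space \<Omega>"
  by (rule L2.diff_closed)

lemma L2_norm_triangle:
  "w \<in> L2_space \<Omega> \<Longrightarrow> z \<in> L2_space \<Omega> \<Longrightarrow>
    L2_norm \<Omega> (\<lambda>x. w x + z x) \<le> L2_norm \<Omega> w + L2_norm \<Omega> z"
  unfolding L2_norm_eq_inner by (rule L2.triangle)

lemma L2_norm_scaled: "L2_norm \<Omega> (\<lambda>x. c *\<^sub>R w x) = \<bar>c\<bar> * L2_norm \<Omega> w"
  by (simp add: L2_norm_def power_mult_distrib real_sqrt_mult)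

lemma L2_norm_minus_commute: "L2_norm \<Omega> (\<lambda>x. w x - z x) = L2_norm \<Omega> (\<lambda>x. z x - w x)"
  by (simp add: L2_norm_def norm_minus_commute)

lemma L2_norm_diff_triangle:
  assumes "w \<in> L2_space \<Omega>" "y \<in> L2_space \<Omega>" "z \<in> L2_space \<Omega>"
  shows "L2_norm \<Omega> (\<lambda>x. w x - z x) \<le> L2_norm \<Omega> (\<lambda>x. w x - y x) + L2_norm \<Omega> (\<lambda>x. y x - z x)"
  using L2_norm_triangle[OF L2_diff[OF assms(1,2)] L2_diff[OF assms(2,3)]] by simp

lemma L2_norm_cong_AE:
  assumes "AE x in lebesgue_on \<Omega>. w x = z x"
    and "w \<in> borel_measurable (lebesgue_on \<Omega>)" "z \<in> borel_measurable (lebesgue_on \<Omega>)"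
  shows "L2_norm \<Omega> w = L2_norm \<Omega> z"
  unfolding L2_norm_def
  by (rule arg_cong[where f = sqrt], rule integral_cong_AE) (use assms in auto)

lemma L2_space_cong_AE:
  assumes "AE x in lebesgue_on \<Omega>. w x = z x"
    and "w \<in> L2_space \<Omega>" and [measurable]: "z \<in> borel_measurable (lebesgue_on \<Omega>)"
  shows "z \<in> L2_space \<Omega>"
proof -
  have [measurable]: "w \<in> borel_measurable (lebesgue_on \<Omega>)"
    using assms(2) by (simp add: L2_space_def)
  have "integrable (lebesgue_on \<Omega>) (\<lambda>x. (norm (z x))\<^sup>2) \<longleftrightarrow> integrable (lebesgue_on \<Omega>) (\<lambda>x. (norm (w x))\<^sup>2)"
    by (rule integrable_cong_AE) (use assms(1) in auto)
  then show ?thesis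
    using assms by (auto simp: L2_space_def)
qed

lemma L2_norm_eq_0_AE:
  assumes "w \<in> L2_space \<Omega>" "L2_norm \<Omega> w = 0"
  shows "AE x in lebesgue_on \<Omega>. w x = 0"
proof -
  have "(LINT x|lebesgue_on \<Omega>. (norm (w x))\<^sup>2) = 0"
    using assms(2) by (simp add: L2_norm_def)
  then have "AE x in lebesgue_on \<Omega>. (norm (w x))\<^sup>2 = 0"
    using assms(1) by (subst (asm) integral_nonneg_eq_0_iff_AE) (auto simp: L2_space_def)
  then show ?thesis by simp
qed

lemma nn_integral_L2_norm:
  assumes "w \<in> L2_space \<Omega>"
  shows "(\<integral>\<^sup>+x. ennreal ((norm (w x))\<^sup>2) \<partial>lebesgue_on \<Omega>) = ennreal ((L2_norm \<Omega> w)\<^sup>2)"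
  unfolding L2_norm_power2
  by (rule nn_integral_eq_integral) (use assms in \<open>auto simp: L2_space_def\<close>)

text \<open>Along a subsequence whose consecutive distances decay geometrically, the weighted sum of the
  squared increments is integrable and hence finite almost everywhere; this gives pointwise
  convergence. Fatou's lemma turns the pointwise limit into a limit in norm.\<close>

lemma L2_complete:
  fixes w :: "nat \<Rightarrow> 'a::euclidean_space \<Rightarrow> 'b::euclidean_space"
  assumes w: "\<And>n. w n \<in> L2_space \<Omega>"
    and Cauchy: "\<And>e. e > 0 \<Longrightarrow> \<exists>N. \<forall>m\<ge>N. \<forall>n\<ge>N. L2_norm \<Omega> (\<lambda>x. w m x - w n x) < e"
  obtains z where "z \<in> L2_space \<Omega>" "(\<lambda>n. L2_norm \<Omega> (\<lambda>x. w n x - z x)) \<longlonglongrightarrow> 0"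
proof -
  let ?M = "lebesgue_on \<Omega>"
  have [measurable]: "w n \<in> borel_measurable ?M" for n
    using w by (simp add: L2_space_def)
  have "\<forall>k. \<exists>N. \<forall>m\<ge>N. \<forall>n\<ge>N. L2_norm \<Omega> (\<lambda>x. w m x - w n x) < (1 / 4) ^ k"
    using Cauchy by simp
  then obtain N where N: "\<And>k m n. m \<ge> N k \<Longrightarrow> n \<ge> N k \<Longrightarrow> L2_norm \<Omega> (\<lambda>x. w m x - w n x) < (1 / 4) ^ k"
    by metis
  \<comment> \<open>Summing puts both \<open>r k\<close> and \<open>r (Suc k)\<close> beyond \<open>N k\<close>, so consecutive terms are close.\<close>
  define r where "r k = k + (\<Sum>i\<le>k. N i)" for k
  have r: "N k \<le> r k" "N k \<le> r (Suc k)" "k \<le> r k" for k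
    using member_le_sum[of k "{..k}" N] by (auto simp: r_def)
  define d where "d k x = w (r (Suc k)) x - w (r k) x" for k x
  have d: "d k \<in> L2_space \<Omega>" for k
    unfolding d_def[abs_def] by (intro L2_diff w)
  have [measurable]: "d k \<in> borel_measurable ?M" for k
    using d by (simp add: L2_space_def)
  \<comment> \<open>The squared norms of the increments are at most \<open>16 ^ -k\<close>, so the weights \<open>4 ^ k\<close> keep the sum finite
      and force \<open>d k x\<close> to decay like \<open>2 ^ -k\<close> pointwise.\<close>
  have "(\<integral>\<^sup>+x. (\<Sum>k. ennreal (4 ^ k * (norm (d k x))\<^sup>2)) \<partial>?M) = (\<Sum>k. \<integral>\<^sup>+x. ennreal (4 ^ k * (norm (d k x))\<^sup>2) \<partial>?M)"
    by (rule nn_integral_suminf) simp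
  also have "\<dots> \<le> (\<Sum>k. ennreal ((1 / 4) ^ k))"
  proof (rule suminf_le)
    fix k
    have "(\<integral>\<^sup>+x. ennreal (4 ^ k * (norm (d k x))\<^sup>2) \<partial>?M) = ennreal (4 ^ k * (L2_norm \<Omega> (d k))\<^sup>2)"
      by (simp add: ennreal_mult' nn_integral_cmult nn_integral_L2_norm[OF d])
    also have "\<dots> \<le> ennreal (4 ^ k * ((1 / 4) ^ k)\<^sup>2)"
      using N[OF r(2) r(1), of k] L2_norm_nonneg
      by (intro ennreal_leI mult_left_mono power_mono) (auto simp: d_def[abs_def])
    also have "4 ^ k * ((1 / 4) ^ k)\<^sup>2 = (1 / 4 :: real) ^ k"
      by (simp add: power_one_over power2_eq_square)
    finally show "(\<integral>\<^sup>+x. ennreal (4 ^ k * (norm (d k x))\<^sup>2) \<partial>?M) \<le> ennreal ((1 / 4) ^ k)" .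
  qed auto
  also have "\<dots> = ennreal (\<Sum>k. (1 / 4) ^ k)"
    by (intro suminf_ennreal2) (auto intro: summable_geometric)
  also have "\<dots> < \<infinity>" by simp
  finally have "AE x in ?M. (\<Sum>k. ennreal (4 ^ k * (norm (d k x))\<^sup>2)) \<noteq> \<infinity>"
    by (intro nn_integral_PInf_AE) auto
  then have conv: "AE x in ?M. convergent (\<lambda>k. w (r k) x)"
  proof (rule eventually_mono)
    fix x assume "(\<Sum>k. ennreal (4 ^ k * (norm (d k x))\<^sup>2)) \<noteq> \<infinity>"
    then have "summable (\<lambda>k. 4 ^ k * (norm (d k x))\<^sup>2)"
      by (intro summable_suminf_not_top) auto
    then have "bounded (range (\<lambda>k. 4 ^ k * (norm (d k x))\<^sup>2))"
      using summable_LIMSEQ_zero convergent_imp_bounded by blast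
    then obtain C where C: "C > 0" "\<And>k. \<bar>4 ^ k * (norm (d k x))\<^sup>2\<bar> \<le> C"
      by (auto simp: bounded_pos)
    have "norm (d k x) \<le> sqrt C * (1 / 2) ^ k" for k
    proof -
      have "(2 ^ k)\<^sup>2 = (4 :: real) ^ k"
        by (simp add: power2_eq_square flip: power_mult_distrib)
      then have "(2 ^ k * norm (d k x))\<^sup>2 \<le> C"
        using C(2)[of k] by (simp add: power_mult_distrib)
      then have "2 ^ k * norm (d k x) \<le> sqrt C"
        by (rule real_le_rsqrt)
      then show ?thesis
        by (simp add: power_one_over field_simps)
    qed
    moreover have "summable (\<lambda>k. sqrt C * (1 / 2) ^ k)"
      by (intro summable_mult summable_geometric) simp
    ultimately have "summable (\<lambda>k. d k x)"
      using summable_comparison_test'[of "\<lambda>k. sqrt C * (1 / 2) ^ k" 0 "\<lambda>k. d k x"] by blast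
    then have "convergent (\<lambda>k. (\<Sum>i<k. d i x) + w (r 0) x)"
      by (intro convergent_add convergent_const) (simp add: summable_iff_convergent)
    moreover have "(\<Sum>i<k. d i x) + w (r 0) x = w (r k) x" for k
      unfolding d_def by (simp add: sum_lessThan_telescope[of "\<lambda>i. w (r i) x" k])
    ultimately show "convergent (\<lambda>k. w (r k) x)" by simp
  qed
  define z where "z x = lim (\<lambda>k. w (r k) x)" for x
  have [measurable]: "z \<in> borel_measurable ?M"
    unfolding z_def[abs_def] by (rule borel_measurable_lim_metric) simp
  have lim: "AE x in ?M. (\<lambda>k. w (r k) x) \<longlonglongrightarrow> z x"
    using conv by (rule eventually_mono) (simp add: z_def convergent_LIMSEQ_iff)
  have Fatou: "(\<integral>\<^sup>+x. ennreal ((norm (w n x - z x))\<^sup>2) \<partial>?M) \<le> ennreal (e\<^sup>2)"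
    if n: "\<And>m. m \<ge> K \<Longrightarrow> L2_norm \<Omega> (\<lambda>x. w n x - w m x) < e" for n K e
  proof -
    have "(\<integral>\<^sup>+x. ennreal ((norm (w n x - z x))\<^sup>2) \<partial>?M) =
        (\<integral>\<^sup>+x. liminf (\<lambda>k. ennreal ((norm (w n x - w (r k) x))\<^sup>2)) \<partial>?M)"
    proof (rule nn_integral_cong_AE, use lim in \<open>rule eventually_mono\<close>)
      fix x assume "(\<lambda>k. w (r k) x) \<longlonglongrightarrow> z x"
      then have "(\<lambda>k. ennreal ((norm (w n x - w (r k) x))\<^sup>2)) \<longlonglongrightarrow> ennreal ((norm (w n x - z x))\<^sup>2)"
        by (intro tendsto_intros)
      then show "ennreal ((norm (w n x - z x))\<^sup>2) = liminf (\<lambda>k. ennreal ((norm (w n x - w (r k) x))\<^sup>2))"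
        by (rule lim_imp_Liminf[OF trivial_limit_sequentially, symmetric])
    qed
    also have "\<dots> \<le> liminf (\<lambda>k. \<integral>\<^sup>+x. ennreal ((norm (w n x - w (r k) x))\<^sup>2) \<partial>?M)"
      by (rule nn_integral_liminf) simp
    also have "\<dots> \<le> ennreal (e\<^sup>2)"
    proof (rule Liminf_le)
      have "(\<integral>\<^sup>+x. ennreal ((norm (w n x - w (r k) x))\<^sup>2) \<partial>?M) \<le> ennreal (e\<^sup>2)" if "k \<ge> K" for k
      proof -
        have "L2_norm \<Omega> (\<lambda>x. w n x - w (r k) x) < e"
          using n r(3)[of k] that by simp
        then show ?thesis
          using L2_norm_nonneg
          by (subst nn_integral_L2_norm[OF L2_diff[OF w w]])
             (intro ennreal_leI power_mono, auto)
      qed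
      then show "\<forall>\<^sub>F k in sequentially. (\<integral>\<^sup>+x. ennreal ((norm (w n x - w (r k) x))\<^sup>2) \<partial>?M) \<le> ennreal (e\<^sup>2)"
        by (rule eventually_sequentiallyI)
    qed simp
    finally show ?thesis .
  qed
  have diff_L2: "(\<lambda>x. w n x - z x) \<in> L2_space \<Omega>"
    if n: "\<And>m. m \<ge> K \<Longrightarrow> L2_norm \<Omega> (\<lambda>x. w n x - w m x) < e" for n K e
  proof -
    have "(\<integral>\<^sup>+x. ennreal ((norm (w n x - z x))\<^sup>2) \<partial>?M) < \<infinity>"
      using Fatou[OF n] ennreal_less_top le_less_trans unfolding infinity_ennreal_def by blast
    then have "integrable ?M (\<lambda>x. (norm (w n x - z x))\<^sup>2)"
      by (intro integrableI_nonneg) simp_all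
    then show ?thesis by (simp add: L2_space_def)
  qed
  have z: "z \<in> L2_space \<Omega>"
  proof -
    obtain K where K: "\<And>m n. m \<ge> K \<Longrightarrow> n \<ge> K \<Longrightarrow> L2_norm \<Omega> (\<lambda>x. w m x - w n x) < 1"
      using Cauchy[of 1] by auto
    have "(\<lambda>x. w K x - z x) \<in> L2_space \<Omega>"
      by (rule diff_L2[of K K 1]) (simp add: K)
    from L2_diff[OF w[of K] this] show ?thesis by simp
  qed
  moreover have "(\<lambda>n. L2_norm \<Omega> (\<lambda>x. w n x - z x)) \<longlonglongrightarrow> 0"
  proof (rule LIMSEQ_I)
    fix e :: real assume "e > 0"
    then obtain K where K: "\<And>m n. m \<ge> K \<Longrightarrow> n \<ge> K \<Longrightarrow> L2_norm \<Omega> (\<lambda>x. w m x - w n x) < e / 2"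
      using Cauchy[of "e / 2"] by auto
    have "L2_norm \<Omega> (\<lambda>x. w n x - z x) < e" if "n \<ge> K" for n
    proof -
      have "ennreal ((L2_norm \<Omega> (\<lambda>x. w n x - z x))\<^sup>2) \<le> ennreal ((e / 2)\<^sup>2)"
        using Fatou[OF K[OF that]] unfolding nn_integral_L2_norm[OF L2_diff[OF w z]] .
      then have "(L2_norm \<Omega> (\<lambda>x. w n x - z x))\<^sup>2 \<le> (e / 2)\<^sup>2"
        by (subst (asm) ennreal_le_iff) auto
      then have "L2_norm \<Omega> (\<lambda>x. w n x - z x) \<le> e / 2"
        by (rule power2_le_imp_le) (use \<open>e > 0\<close> in simp)
      then show ?thesis using \<open>e > 0\<close> by simp
    qed
    then show "\<exists>N. \<forall>n\<ge>N. norm (L2_norm \<Omega> (\<lambda>x. w n x - z x) - 0) < e"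
      by (intro exI[of _ K]) (simp add: L2_norm_nonneg abs_of_nonneg)
  qed
  ultimately show ?thesis using that by blast
qed

section \<open>Uniqueness of weak gradients\<close>

text \<open>The Borel sets over which the integral vanishes form a Dynkin system that contains the boxes, a
  generator stable under intersection. The hypothesis on the total integral provides closure under
  complements.\<close>

lemma AE_zero_if_box_integrals_zero:
  fixes F :: "'a::euclidean_space \<Rightarrow> real"
  assumes F: "integrable lebesgue F" and total: "(LINT x|lebesgue. F x) = 0"
    and box: "\<And>a b. (LINT x|lebesgue. indicator (box a b) x * F x) = 0"
  shows "AE x in lebesgue. F x = 0"
proof -
  obtain g where [measurable]: "g \<in> borel_measurable lborel" and g: "AE x in lborel. F x = g x"
    using completion_ex_borel_measurable_real[of F lborel] F by auto
  have [measurable]: "F \<in> borel_measurable lebesgue"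
    using F by simp
  have gF: "AE x in lebesgue. F x = g x"
    by (rule AE_completion[OF g])
  have "integrable lebesgue g"
    using F by (subst integrable_cong_AE[of g lebesgue F]) (use gF in \<open>auto intro: measurable_completion\<close>)
  then have g_int: "integrable lborel g"
    by (simp add: integrable_completion)
  have transfer: "(LINT x|lborel. indicator A x * g x) = (LINT x|lebesgue. indicator A x * F x)"
    if [measurable]: "A \<in> sets borel" for A
  proof -
    have [measurable]: "A \<in> sets lebesgue" "g \<in> borel_measurable lebesgue"
      by (simp_all add: measurable_completion)
    have "(LINT x|lborel. indicator A x * g x) = (LINT x|lebesgue. indicator A x * g x)"
      by (rule integral_completion[symmetric]) simp
    also have "\<dots> = (LINT x|lebesgue. indicator A x * F x)"
      by (rule integral_cong_AE) (use gF in auto)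
    finally show ?thesis .
  qed
  have zero: "(LINT x|lborel. indicator A x * g x) = 0" if "A \<in> sets borel" for A
  proof -
    have sets: "sets borel = sigma_sets UNIV (range (\<lambda>(a, b). box a b :: 'a set))"
      by (subst borel_eq_box) simp
    have "Int_stable (range (\<lambda>(a, b). box a b :: 'a set))"
      by (auto simp: Int_stable_def box_Int_box)
    moreover have "range (\<lambda>(a, b). box a b :: 'a set) \<subseteq> Pow UNIV"
      by simp
    moreover have "A \<in> sigma_sets UNIV (range (\<lambda>(a, b). box a b :: 'a set))"
      using that sets by simp
    ultimately show ?thesis
    proof (induction rule: sigma_sets_induct_disjoint)
      case (compl A)
      then have [measurable]: "A \<in> sets borel" using sets by simp
      have "(LINT x|lborel. indicator (UNIV - A) x * g x) = (LINT x|lborel. g x - indicator A x * g x)"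
        by (intro Bochner_Integration.integral_cong) (auto simp: indicator_def)
      also have "\<dots> = (LINT x|lborel. g x) - (LINT x|lborel. indicator A x * g x)"
        using integrable_mult_indicator[of A lborel g] g_int by (intro Bochner_Integration.integral_diff) auto
      also have "\<dots> = 0"
        using compl transfer[of UNIV] total by simp
      finally show ?case .
    next
      case (union A)
      then have [measurable]: "A i \<in> sets borel" for i using sets by auto
      have "(LINT x:(\<Union>i. A i)|lborel. g x) = (\<Sum>i. (LINT x:(A i)|lborel. g x))"
      proof (rule lebesgue_integral_countable_add)
        show "set_integrable lborel (\<Union> (range A)) g"
          unfolding set_integrable_def using g_int by (intro integrable_mult_indicator) auto
      qed (use union(1) in \<open>auto simp: disjoint_family_on_def\<close>)
      then show ?case
        using union by (simp add: set_lebesgue_integral_def)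
    qed (auto simp: transfer box)
  qed
  have "AE x in lborel. g x = 0"
    by (rule sigma_finite_measure.density_zero[OF sigma_finite_lborel g_int]) (simp add: set_lebesgue_integral_def zero)
  then have "AE x in lebesgue. g x = 0"
    by (rule AE_completion)
  with gF show ?thesis by eventually_elim simp
qed

lemma sets_lebesgue_open: "open \<Omega> \<Longrightarrow> \<Omega> \<in> sets lebesgue"
  by (simp add: borel_open)

lemma compact_lebesgue: "compact K \<Longrightarrow> K \<in> sets lebesgue"
  by (simp add: borel_compact)

lemma locally_integrable_measurable:
  assumes "open \<Omega>" "locally_integrable \<Omega> f"
  shows "f \<in> borel_measurable (lebesgue_on \<Omega>)"
proof -
  obtain D where D: "countable D" "D \<subseteq> Pow \<Omega>" "\<And>X. X \<in> D \<Longrightarrow> \<exists>a b. X = cbox a b" "\<Union>D = \<Omega>"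
    using open_countable_Union_open_cbox[OF assms(1)] by metis
  have K: "compact K" "K \<subseteq> \<Omega>" if "K \<in> D" for K
    using D(2,3) that compact_cbox by blast+
  show ?thesis
  proof (rule measurable_piecewise_restrict[OF D(1)])
    fix K assume "K \<in> D"
    note K = K[OF this]
    show "K \<inter> space (lebesgue_on \<Omega>) \<in> sets (lebesgue_on \<Omega>)"
      using K compact_lebesgue[OF K(1)] by (auto simp: sets_restrict_space)
    have "f \<in> borel_measurable (lebesgue_on K)"
      using assms(2) K compact_lebesgue by (auto simp: locally_integrable_def
          intro!: absolutely_integrable_imp_borel_measurable)
    then show "f \<in> borel_measurable (restrict_space (lebesgue_on \<Omega>) K)"
      using K compact_lebesgue[OF K(1)] sets_lebesgue_open[OF assms(1)]
      by (simp add: restrict_restrict_space Int_absorb1)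
  qed (use D(4) in simp)
qed

lemma lebesgue_on_integrable_outside:
  fixes f :: "'a::euclidean_space \<Rightarrow> real"
  assumes "K \<in> sets lebesgue" "\<Omega> \<in> sets lebesgue" "K \<subseteq> \<Omega>" "integrable (lebesgue_on K) f"
    and "\<And>x. x \<in> \<Omega> - K \<Longrightarrow> f x = 0"
  shows "integrable (lebesgue_on \<Omega>) f"
proof -
  have "(\<lambda>x. if x \<in> K then f x else 0) = (\<lambda>x. if x \<in> \<Omega> then f x else 0)"
    using assms(3,5) by fastforce
  then show ?thesis
    using assms(4) Lebesgue_Measure.integrable_restrict_UNIV[OF assms(1), of f]
      Lebesgue_Measure.integrable_restrict_UNIV[OF assms(2), of f] by simp
qed

lemma locally_integrable_mult_test_function:
  fixes h :: "'a::euclidean_space \<Rightarrow> real"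
  assumes "open \<Omega>" "locally_integrable \<Omega> h" and \<phi>: "\<phi> \<in> test_functions \<Omega>"
  shows "integrable (lebesgue_on \<Omega>) (\<lambda>x. h x * \<phi> x)"
proof -
  obtain K where K: "compact K" "K \<subseteq> \<Omega>" "\<And>x. x \<notin> K \<Longrightarrow> \<phi> x = 0"
    using test_function_support[OF \<phi>] by blast
  obtain B where B: "\<And>x. \<bar>\<phi> x\<bar> \<le> B"
    using test_function_bounded[OF \<phi>] by blast
  have h: "integrable (lebesgue_on K) h"
    using assms(2) K(1,2) compact_lebesgue[OF K(1)]
    unfolding locally_integrable_def set_integrable_def by (subst integrable_restrict_space) simp_all
  have "integrable (lebesgue_on K) (\<lambda>x. h x * \<phi> x)"
  proof (rule Bochner_Integration.integrable_bound)
    show "integrable (lebesgue_on K) (\<lambda>x. B * h x)"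
      using h by simp
    have "\<phi> \<in> borel_measurable (lebesgue_on K)"
      using continuous_on_subset[OF test_function_continuous[OF \<phi>] subset_UNIV]
      by (rule continuous_imp_measurable_on_sets_lebesgue) (rule compact_lebesgue[OF K(1)])
    then show "(\<lambda>x. h x * \<phi> x) \<in> borel_measurable (lebesgue_on K)"
      using h by (intro borel_measurable_times) simp_all
    have "\<bar>h x * \<phi> x\<bar> \<le> \<bar>B * h x\<bar>" for x
      using B[of x] by (simp add: abs_mult mult.commute mult_right_mono)
    then show "AE x in lebesgue_on K. norm (h x * \<phi> x) \<le> norm (B * h x)"
      by simp
  qed
  then show ?thesis
    by (rule lebesgue_on_integrable_outside[OF compact_lebesgue[OF K(1)] sets_lebesgue_open[OF assms(1)] K(2)])
       (simp add: K(3))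
qed

text \<open>Multiplying by bump functions that converge to the indicator of a box shows that all integrals
  of the localised function over boxes vanish, and boxes generate the Borel sets.\<close>

lemma fundamental_lemma_calculus_of_variations:
  fixes h :: "'a::euclidean_space \<Rightarrow> real"
  assumes \<Omega>: "open \<Omega>" and h: "locally_integrable \<Omega> h"
    and zero: "\<And>\<phi>. \<phi> \<in> test_functions \<Omega> \<Longrightarrow> (LINT x|lebesgue_on \<Omega>. h x * \<phi> x) = 0"
  shows "AE x in lebesgue_on \<Omega>. h x = 0"
proof -
  have local: "AE x in lebesgue. x \<in> cbox c d \<longrightarrow> h x = 0" if cd: "cbox c d \<subseteq> \<Omega>" for c d
  proof -
    note b = bump_test_function[OF cd, of 1, simplified]
    define F where "F x = (if x \<in> \<Omega> then h x * bump 1 c d x else 0)" for x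
    have F_int: "integrable lebesgue F"
      unfolding F_def using locally_integrable_mult_test_function[OF \<Omega> h b] sets_lebesgue_open[OF \<Omega>]
      by (subst Lebesgue_Measure.integrable_restrict_UNIV) auto
    then have [measurable]: "F \<in> borel_measurable lebesgue" by simp
    have F_smooth: "(LINT x|lebesgue. g x * F x) = 0" if "\<And>k. Ck k g" for g
    proof -
      have "(LINT x|lebesgue. g x * F x) =
          (LINT x|lebesgue. (if x \<in> \<Omega> then h x * (g x * bump 1 c d x) else 0))"
        by (intro Bochner_Integration.integral_cong) (auto simp: F_def)
      also have "\<dots> = (LINT x|lebesgue_on \<Omega>. h x * (g x * bump 1 c d x))"
        by (rule Lebesgue_Measure.integral_restrict_UNIV[OF sets_lebesgue_open[OF \<Omega>]])
      also have "\<dots> = 0"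
        by (rule zero[OF test_function_mult_smooth[OF b that]])
      finally show ?thesis .
    qed
    have "AE x in lebesgue. F x = 0"
    proof (rule AE_zero_if_box_integrals_zero[OF F_int])
      show "(LINT x|lebesgue. F x) = 0"
        using F_smooth[OF Ck_const[of _ 1]] by simp
      fix p q :: 'a
      have "(\<lambda>n. LINT x|lebesgue. bump (real (Suc n)) p q x * F x) \<longlonglongrightarrow>
          (LINT x|lebesgue. indicator (box p q) x * F x)"
      proof (rule integral_dominated_convergence[where w = "\<lambda>x. \<bar>F x\<bar>"])
        have "bump (real (Suc n)) p q \<in> borel_measurable borel" for n
          using Ck_bump[of 0] by (intro borel_measurable_continuous_onI) simp
        then have "bump (real (Suc n)) p q \<in> borel_measurable lebesgue" for n
          by (intro measurable_completion) simp
        then show "(\<lambda>x. bump (real (Suc n)) p q x * F x) \<in> borel_measurable lebesgue" for n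
          by (intro borel_measurable_times) simp_all
        have [measurable]: "box p q \<in> sets lebesgue"
          by simp
        show "(\<lambda>x. indicator (box p q) x * F x) \<in> borel_measurable lebesgue"
          by measurable
        show "integrable lebesgue (\<lambda>x. \<bar>F x\<bar>)"
          using F_int by simp
        show "AE x in lebesgue. (\<lambda>n. bump (real (Suc n)) p q x * F x) \<longlonglongrightarrow> indicator (box p q) x * F x"
          by (intro AE_I2 tendsto_mult bump_tendsto_indicator tendsto_const)
        show "AE x in lebesgue. norm (bump (real (Suc n)) p q x * F x) \<le> \<bar>F x\<bar>" for n
          using bump_bounds[of "real (Suc n)" p q]
          by (auto simp: abs_mult intro!: mult_left_le_one_le)
      qed
      then show "(LINT x|lebesgue. indicator (box p q) x * F x) = 0"
        by (simp add: F_smooth Ck_bump LIMSEQ_const_iff)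
    qed
    moreover have "AE x in lebesgue. x \<notin> cbox c d - box c d"
      using negligible_frontier_interval negligible_iff_null_sets AE_not_in by blast
    ultimately show ?thesis
    proof eventually_elim
      case (elim x)
      then show ?case
        using cd bump_eq_0_iff[of 1 c d x] by (auto simp: F_def split: if_splits)
    qed
  qed
  obtain D where D: "countable D" "D \<subseteq> Pow \<Omega>" "\<And>X. X \<in> D \<Longrightarrow> \<exists>a b. X = cbox a b" "\<Union>D = \<Omega>"
    using open_countable_Union_open_cbox[OF \<Omega>] by metis
  have "AE x in lebesgue. x \<in> X \<longrightarrow> h x = 0" if "X \<in> D" for X
    using D(2,3) that local by blast
  then have "AE x in lebesgue. \<forall>X\<in>D. x \<in> X \<longrightarrow> h x = 0"
    unfolding AE_ball_countable[OF D(1)] by blast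
  then have "AE x in lebesgue. x \<in> \<Omega> \<longrightarrow> h x = 0"
    by (rule eventually_mono) (use D(4) in blast)
  then show ?thesis
    using sets_lebesgue_open[OF \<Omega>] by (simp add: AE_restrict_space_iff)
qed

lemma locally_integrable_add_scaled:
  assumes "locally_integrable \<Omega> f" "locally_integrable \<Omega> g"
  shows "locally_integrable \<Omega> (\<lambda>x. f x + c *\<^sub>R g x)"
  unfolding locally_integrable_def
proof (intro allI impI)
  fix K assume K: "compact K \<and> K \<subseteq> \<Omega>"
  have "f absolutely_integrable_on K" "g absolutely_integrable_on K"
    using assms K unfolding locally_integrable_def by blast+
  then show "(\<lambda>x. f x + c *\<^sub>R g x) absolutely_integrable_on K"
    unfolding set_integrable_def
    by (simp only: scaleR_add_right scaleR_left_commute[of _ c])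
      (intro Bochner_Integration.integrable_add integrable_scaleR_right)
qed

lemma locally_integrable_inner:
  assumes "locally_integrable \<Omega> f"
  shows "locally_integrable \<Omega> (\<lambda>x. f x \<bullet> b)"
proof -
  have "integrable lebesgue (\<lambda>x. (indicat_real K x *\<^sub>R f x) \<bullet> b)" if "f absolutely_integrable_on K" for K
    using that unfolding set_integrable_def by (intro integrable_inner_left)
  then show ?thesis
    using assms unfolding locally_integrable_def set_integrable_def inner_scaleR_left real_scaleR_def
    by blast
qed

lemma has_weak_grad_locally_integrable:
  assumes "has_weak_grad \<Omega> u G"
  shows "locally_integrable \<Omega> u" "locally_integrable \<Omega> G"
  using assms unfolding has_weak_grad_def by blast+

lemma has_weak_grad_by_parts:
  assumes "has_weak_grad \<Omega> u G" "\<phi> \<in> test_functions \<Omega>" "b \<in> Basis"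
  shows "(LINT x|lebesgue_on \<Omega>. u x * frechet_derivative \<phi> (at x) b) =
    - (LINT x|lebesgue_on \<Omega>. (G x \<bullet> b) * \<phi> x)"
  using assms unfolding has_weak_grad_def by blast

lemma has_weak_grad_unique:
  assumes \<Omega>: "open \<Omega>" and "has_weak_grad \<Omega> u G" "has_weak_grad \<Omega> u H"
  shows "AE x in lebesgue_on \<Omega>. G x = H x"
proof -
  have G: "locally_integrable \<Omega> G" and H: "locally_integrable \<Omega> H"
    by (rule has_weak_grad_locally_integrable(2); rule assms(2) assms(3))+
  have "AE x in lebesgue_on \<Omega>. (G x + (-1) *\<^sub>R H x) \<bullet> b = 0" if b: "b \<in> Basis" for b
  proof (rule fundamental_lemma_calculus_of_variations[OF \<Omega>])
    show "locally_integrable \<Omega> (\<lambda>x. (G x + (-1) *\<^sub>R H x) \<bullet> b)"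
      by (intro locally_integrable_inner locally_integrable_add_scaled G H)
    fix \<phi> assume \<phi>: "\<phi> \<in> test_functions \<Omega>"
    have "(LINT x|lebesgue_on \<Omega>. (G x \<bullet> b) * \<phi> x) = (LINT x|lebesgue_on \<Omega>. (H x \<bullet> b) * \<phi> x)"
      using has_weak_grad_by_parts[OF assms(2) \<phi> b] has_weak_grad_by_parts[OF assms(3) \<phi> b] by linarith
    then show "(LINT x|lebesgue_on \<Omega>. ((G x + (-1) *\<^sub>R H x) \<bullet> b) * \<phi> x) = 0"
      using locally_integrable_mult_test_function[OF \<Omega> locally_integrable_inner[OF G] \<phi>]
        locally_integrable_mult_test_function[OF \<Omega> locally_integrable_inner[OF H] \<phi>]
      by (simp add: inner_diff_left left_diff_distrib)
  qed
  then have "AE x in lebesgue_on \<Omega>. \<forall>b\<in>Basis. (G x + (-1) *\<^sub>R H x) \<bullet> b = 0"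
    by (intro AE_finite_allI) auto
  then show ?thesis
    by (rule eventually_mono) (simp add: inner_diff_left euclidean_eq_iff[where 'a = 'a])
qed

lemma has_weak_grad_weak_grad: "has_weak_grad \<Omega> u G \<Longrightarrow> has_weak_grad \<Omega> u (weak_grad \<Omega> u)"
  unfolding weak_grad_def by (rule someI[of "has_weak_grad \<Omega> u"])

lemma weak_grad_AE_eq:
  assumes "open \<Omega>" "has_weak_grad \<Omega> u G"
  shows "AE x in lebesgue_on \<Omega>. weak_grad \<Omega> u x = G x"
  using has_weak_grad_unique[OF assms(1) has_weak_grad_weak_grad[OF assms(2)] assms(2)] .

lemma has_weak_grad_measurable:
  assumes "open \<Omega>" "has_weak_grad \<Omega> u G"
  shows "G \<in> borel_measurable (lebesgue_on \<Omega>)" "weak_grad \<Omega> u \<in> borel_measurable (lebesgue_on \<Omega>)"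
  by (rule locally_integrable_measurable[OF assms(1) has_weak_grad_locally_integrable(2)];
    rule assms(2) has_weak_grad_weak_grad[OF assms(2)])+

lemma has_weak_grad_add_scaled:
  assumes \<Omega>: "open \<Omega>" and u: "has_weak_grad \<Omega> u G" and w: "has_weak_grad \<Omega> w H"
  shows "has_weak_grad \<Omega> (\<lambda>x. u x + c * w x) (\<lambda>x. G x + c *\<^sub>R H x)"
  unfolding has_weak_grad_def
proof (intro conjI ballI)
  note u' = has_weak_grad_locally_integrable[OF u] and w' = has_weak_grad_locally_integrable[OF w]
  show "locally_integrable \<Omega> (\<lambda>x. G x + c *\<^sub>R H x)"
    by (rule locally_integrable_add_scaled[OF u'(2) w'(2)])
  show "locally_integrable \<Omega> (\<lambda>x. u x + c * w x)"
    using locally_integrable_add_scaled[OF u'(1) w'(1), of c] by simp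
  fix \<phi> and b :: 'a assume \<phi>: "\<phi> \<in> test_functions \<Omega>" and b: "b \<in> Basis"
  define D where "D x = frechet_derivative \<phi> (at x) b" for x
  have "integrable (lebesgue_on \<Omega>) (\<lambda>x. u x * D x)" "integrable (lebesgue_on \<Omega>) (\<lambda>x. w x * D x)"
    unfolding D_def by (rule locally_integrable_mult_test_function[OF \<Omega> _ test_function_frechet[OF \<phi> b]];
      rule u'(1) w'(1))+
  then have "(LINT x|lebesgue_on \<Omega>. (u x + c * w x) * D x) =
      (LINT x|lebesgue_on \<Omega>. u x * D x) + c * (LINT x|lebesgue_on \<Omega>. w x * D x)"
    by (simp add: distrib_right mult.assoc)
  moreover have "integrable (lebesgue_on \<Omega>) (\<lambda>x. (G x \<bullet> b) * \<phi> x)"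
      "integrable (lebesgue_on \<Omega>) (\<lambda>x. (H x \<bullet> b) * \<phi> x)"
    by (rule locally_integrable_mult_test_function[OF \<Omega> locally_integrable_inner \<phi>];
      rule u'(2) w'(2))+
  then have "(LINT x|lebesgue_on \<Omega>. ((G x + c *\<^sub>R H x) \<bullet> b) * \<phi> x) =
      (LINT x|lebesgue_on \<Omega>. (G x \<bullet> b) * \<phi> x) + c * (LINT x|lebesgue_on \<Omega>. (H x \<bullet> b) * \<phi> x)"
    by (simp add: inner_add_left distrib_right mult.assoc)
  moreover have "(LINT x|lebesgue_on \<Omega>. u x * D x) = - (LINT x|lebesgue_on \<Omega>. (G x \<bullet> b) * \<phi> x)"
      "(LINT x|lebesgue_on \<Omega>. w x * D x) = - (LINT x|lebesgue_on \<Omega>. (H x \<bullet> b) * \<phi> x)"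
    unfolding D_def by (rule has_weak_grad_by_parts[OF _ \<phi> b]; rule u w)+
  ultimately show "(LINT x|lebesgue_on \<Omega>. (u x + c * w x) * frechet_derivative \<phi> (at x) b) =
      - (LINT x|lebesgue_on \<Omega>. ((G x + c *\<^sub>R H x) \<bullet> b) * \<phi> x)"
    unfolding D_def by simp
qed

section \<open>The space of limits of test functions\<close>

lemma L2_scaled: "w \<in> L2_space \<Omega> \<Longrightarrow> (\<lambda>x. c *\<^sub>R w x) \<in> L2_space \<Omega>"
  by (auto simp: L2_space_def power_mult_distrib intro!: borel_measurable_scaleR)

lemma L2_tendsto_inner:
  assumes w: "\<And>n. w n \<in> L2_space \<Omega>" and l: "l \<in> L2_space \<Omega>" and z: "z \<in> L2_space \<Omega>"
    and lim: "(\<lambda>n. L2_norm \<Omega> (\<lambda>x. l x - w n x)) \<longlonglongrightarrow> 0"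
  shows "(\<lambda>n. LINT x|lebesgue_on \<Omega>. w n x \<bullet> z x) \<longlonglongrightarrow> (LINT x|lebesgue_on \<Omega>. l x \<bullet> z x)"
proof -
  have "(\<lambda>n. (LINT x|lebesgue_on \<Omega>. l x \<bullet> z x) - (LINT x|lebesgue_on \<Omega>. w n x \<bullet> z x)) \<longlonglongrightarrow> 0"
  proof (rule Lim_null_comparison)
    show "(\<lambda>n. L2_norm \<Omega> (\<lambda>x. l x - w n x) * L2_norm \<Omega> z) \<longlonglongrightarrow> 0"
      using tendsto_mult_right[OF lim, of "L2_norm \<Omega> z"] by simp
    have "\<bar>LINT x|lebesgue_on \<Omega>. (l x - w n x) \<bullet> z x\<bar> \<le> L2_norm \<Omega> (\<lambda>x. l x - w n x) * L2_norm \<Omega> z" for n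
      by (rule L2_Cauchy_Schwarz[OF L2_diff[OF l w] z])
    then show "\<forall>\<^sub>F n in sequentially. norm ((LINT x|lebesgue_on \<Omega>. l x \<bullet> z x) - (LINT x|lebesgue_on \<Omega>. w n x \<bullet> z x))
        \<le> L2_norm \<Omega> (\<lambda>x. l x - w n x) * L2_norm \<Omega> z"
      by (simp add: L2.diff_left[OF l w z])
  qed
  from tendsto_diff[OF tendsto_const this, of "LINT x|lebesgue_on \<Omega>. l x \<bullet> z x"] show ?thesis
    by simp
qed

lemma L2_norm_tendsto:
  assumes w: "\<And>n. w n \<in> L2_space \<Omega>" and l: "l \<in> L2_space \<Omega>"
    and lim: "(\<lambda>n. L2_norm \<Omega> (\<lambda>x. l x - w n x)) \<longlonglongrightarrow> 0"
  shows "(\<lambda>n. L2_norm \<Omega> (w n)) \<longlonglongrightarrow> L2_norm \<Omega> l"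
proof (rule LIM_zero_cancel, rule Lim_null_comparison[OF _ lim])
  have "\<bar>L2_norm \<Omega> (w n) - L2_norm \<Omega> l\<bar> \<le> L2_norm \<Omega> (\<lambda>x. l x - w n x)" for n
    using L2_norm_triangle[OF L2_diff[OF l w] w, of n n] L2_norm_triangle[OF L2_diff[OF w l] l, of n]
    by (simp add: L2_norm_minus_commute[of \<Omega> "w n" l])
  then show "\<forall>\<^sub>F n in sequentially. norm (L2_norm \<Omega> (w n) - L2_norm \<Omega> l) \<le> L2_norm \<Omega> (\<lambda>x. l x - w n x)"
    by simp
qed

text \<open>The closure in \<open>L\<^sup>2 \<times> L\<^sup>2\<close> of the graph of the gradient on test functions. Its elements are the pairs of
  an \<open>H10\<close> function and a weak gradient of it; naming the gradient makes linear combinations and limits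
  available without comparing choices of \<open>weak_grad\<close>.\<close>

definition H10_pair :: "'a::euclidean_space set \<Rightarrow> ('a \<Rightarrow> real) \<Rightarrow> ('a \<Rightarrow> 'a) \<Rightarrow> bool" where
  "H10_pair \<Omega> u G \<longleftrightarrow> u \<in> L2_space \<Omega> \<and> G \<in> L2_space \<Omega> \<and>
     (\<exists>\<phi>. (\<forall>k. \<phi> k \<in> test_functions \<Omega>) \<and> (\<lambda>k. L2_norm \<Omega> (\<lambda>x. u x - \<phi> k x)) \<longlonglongrightarrow> 0 \<and>
          (\<lambda>k. L2_norm \<Omega> (\<lambda>x. G x - grad (\<phi> k) x)) \<longlonglongrightarrow> 0)"

locale bounded_open_set =
  fixes \<Omega> :: "'a::euclidean_space set"
  assumes open_dom: "open \<Omega>" and bounded_dom: "bounded \<Omega>"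
begin

abbreviation "T \<equiv> test_functions \<Omega>"
abbreviation "M \<equiv> lebesgue_on \<Omega>"

lemma dom_lebesgue: "\<Omega> \<in> sets lebesgue"
  by (rule sets_lebesgue_open[OF open_dom])

lemma L2_locally_integrable:
  assumes "w \<in> L2_space \<Omega>"
  shows "locally_integrable \<Omega> w"
  unfolding locally_integrable_def
proof (intro allI impI)
  fix K assume K: "compact K \<and> K \<subseteq> \<Omega>"
  interpret finite_measure M
    using bounded_dom dom_lebesgue by (intro finite_measure_lebesgue_on) (simp add: bounded_set_imp_lmeasurable)
  have [measurable]: "w \<in> borel_measurable M"
    using assms by (simp add: L2_space_def)
  have "integrable M w"
  proof (rule Bochner_Integration.integrable_bound)
    show "integrable M (\<lambda>x. 1 + (norm (w x))\<^sup>2)"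
      using assms by (simp add: L2_space_def)
    have "norm y \<le> 1 + (norm y)\<^sup>2" for y :: 'b
    proof -
      have "2 * norm y \<le> (norm y)\<^sup>2 + 1"
        using sum_squares_bound[of "norm y" 1] by simp
      then show ?thesis
        using norm_ge_zero[of y] by linarith
    qed
    then show "AE x in M. norm (w x) \<le> norm (1 + (norm (w x))\<^sup>2)"
      by (simp add: abs_of_nonneg)
  qed simp
  then have "set_integrable lebesgue \<Omega> w"
    using dom_lebesgue by (simp add: set_integrable_def integrable_restrict_space)
  then show "w absolutely_integrable_on K"
    by (rule set_integrable_subset) (use K compact_lebesgue in auto)
qed

lemma test_function_integrable_on:
  assumes "\<phi> \<in> T"
  shows "integrable M \<phi>"
  using locally_integrable_mult_test_function[OF open_dom continuous_imp_locally_integrable assms, of "\<lambda>_. 1"]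
  by simp

lemma continuous_measurable:
  fixes w :: "'a \<Rightarrow> 'b::euclidean_space"
  assumes "continuous_on UNIV w"
  shows "w \<in> borel_measurable M"
  by (rule continuous_imp_measurable_on_sets_lebesgue[OF continuous_on_subset[OF assms subset_UNIV] dom_lebesgue])

lemma test_function_L2:
  assumes "\<phi> \<in> T"
  shows "\<phi> \<in> L2_space \<Omega>"
  using test_function_integrable_on[OF test_function_mult_smooth[OF assms test_function_smooth[OF assms]]]
    continuous_measurable[OF test_function_continuous[OF assms]]
  by (simp add: L2_space_def power2_eq_square)

lemma grad_L2:
  assumes "\<phi> \<in> T"
  shows "grad \<phi> \<in> L2_space \<Omega>"
proof -
  have "continuous_on UNIV (grad \<phi>)"
    unfolding grad_def using test_function_continuous[OF test_function_frechet[OF assms]]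
    by (intro continuous_intros)
  moreover have "integrable M (\<lambda>x. \<Sum>b\<in>Basis. frechet_derivative \<phi> (at x) b * frechet_derivative \<phi> (at x) b)"
  proof (rule Bochner_Integration.integrable_sum)
    fix b :: 'a assume "b \<in> Basis"
    note d = test_function_frechet[OF assms this]
    show "integrable M (\<lambda>x. frechet_derivative \<phi> (at x) b * frechet_derivative \<phi> (at x) b)"
      by (rule test_function_integrable_on[OF test_function_mult_smooth[OF d test_function_smooth[OF d]]])
  qed
  moreover have "(norm (grad \<phi> x))\<^sup>2 = (\<Sum>b\<in>Basis. frechet_derivative \<phi> (at x) b * frechet_derivative \<phi> (at x) b)" for x
    unfolding power2_norm_eq_inner by (subst euclidean_inner) (simp add: grad_inner_Basis)
  ultimately show ?thesis
    using continuous_measurable by (simp add: L2_space_def)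
qed

lemma test_function_weak_grad: "\<phi> \<in> T \<Longrightarrow> has_weak_grad \<Omega> \<phi> (grad \<phi>)"
  by (rule has_weak_grad_test_function[OF open_dom])

lemma H10_pair_test_function: "\<phi> \<in> T \<Longrightarrow> H10_pair \<Omega> \<phi> (grad \<phi>)"
  unfolding H10_pair_def
  by (intro conjI test_function_L2 grad_L2 exI[of _ "\<lambda>_. \<phi>"]) (simp_all add: L2_norm_def)

text \<open>Both sides of the integration by parts formula are \<open>L\<^sup>2\<close> inner products with a fixed function, hence
  continuous along the approximating test functions.\<close>

lemma H10_pair_has_weak_grad:
  assumes "H10_pair \<Omega> u G"
  shows "has_weak_grad \<Omega> u G"
proof -
  have u: "u \<in> L2_space \<Omega>" and G: "G \<in> L2_space \<Omega>"
    using assms by (simp_all add: H10_pair_def)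
  obtain \<phi> where \<phi>: "\<And>k. \<phi> k \<in> T"
    and lim: "(\<lambda>k. L2_norm \<Omega> (\<lambda>x. u x - \<phi> k x)) \<longlonglongrightarrow> 0" "(\<lambda>k. L2_norm \<Omega> (\<lambda>x. G x - grad (\<phi> k) x)) \<longlonglongrightarrow> 0"
    using assms by (auto simp: H10_pair_def)
  show ?thesis
    unfolding has_weak_grad_def
  proof (intro conjI ballI L2_locally_integrable u G)
    fix \<psi> and b :: 'a assume \<psi>: "\<psi> \<in> T" and b: "b \<in> Basis"
    define D where "D x = frechet_derivative \<psi> (at x) b" for x
    have "D \<in> L2_space \<Omega>"
      unfolding D_def[abs_def] by (rule test_function_L2[OF test_function_frechet[OF \<psi> b]])
    then have lim_u: "(\<lambda>k. LINT x|M. \<phi> k x \<bullet> D x) \<longlonglongrightarrow> (LINT x|M. u x \<bullet> D x)"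
      by (intro L2_tendsto_inner test_function_L2[OF \<phi>] u lim)
    have "(\<lambda>x. \<psi> x *\<^sub>R b) \<in> L2_space \<Omega>"
      using test_function_L2[OF \<psi>] b by (auto simp: L2_space_def intro!: borel_measurable_scaleR)
    then have lim_G: "(\<lambda>k. LINT x|M. grad (\<phi> k) x \<bullet> (\<psi> x *\<^sub>R b)) \<longlonglongrightarrow> (LINT x|M. G x \<bullet> (\<psi> x *\<^sub>R b))"
      by (intro L2_tendsto_inner grad_L2[OF \<phi>] G lim)
    have eq: "(LINT x|M. \<phi> k x \<bullet> D x) = - (LINT x|M. grad (\<phi> k) x \<bullet> (\<psi> x *\<^sub>R b))" for k
      using has_weak_grad_by_parts[OF test_function_weak_grad[OF \<phi>] \<psi> b, of k] by (simp add: D_def mult.commute)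
    have "(LINT x|M. u x \<bullet> D x) = - (LINT x|M. G x \<bullet> (\<psi> x *\<^sub>R b))"
      by (rule LIMSEQ_unique[OF lim_u]) (unfold eq, rule tendsto_minus[OF lim_G])
    then show "(LINT x|M. u x * frechet_derivative \<psi> (at x) b) = - (LINT x|M. (G x \<bullet> b) * \<psi> x)"
      by (simp add: D_def mult.commute)
  qed
qed

lemma H10_pair_weak_grad_AE: "H10_pair \<Omega> u G \<Longrightarrow> AE x in M. weak_grad \<Omega> u x = G x"
  by (rule weak_grad_AE_eq[OF open_dom H10_pair_has_weak_grad])

lemma H10_pair_L2:
  assumes "H10_pair \<Omega> u G"
  shows "u \<in> L2_space \<Omega>" "G \<in> L2_space \<Omega>"
  using assms by (simp_all add: H10_pair_def)

lemma weak_grad_diff_test_function: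
  assumes u: "has_weak_grad \<Omega> u G" and \<phi>: "\<phi> \<in> T"
  shows "L2_norm \<Omega> (weak_grad \<Omega> (\<lambda>x. u x - \<phi> x)) = L2_norm \<Omega> (\<lambda>x. G x - grad \<phi> x)"
proof (rule L2_norm_cong_AE)
  have d: "has_weak_grad \<Omega> (\<lambda>x. u x - \<phi> x) (\<lambda>x. G x - grad \<phi> x)"
    using has_weak_grad_add_scaled[OF open_dom u test_function_weak_grad[OF \<phi>], of "-1"] by simp
  show "AE x in M. weak_grad \<Omega> (\<lambda>x. u x - \<phi> x) x = G x - grad \<phi> x"
    by (rule weak_grad_AE_eq[OF open_dom d])
  show "weak_grad \<Omega> (\<lambda>x. u x - \<phi> x) \<in> borel_measurable M" "(\<lambda>x. G x - grad \<phi> x) \<in> borel_measurable M"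
    by (rule has_weak_grad_measurable[OF open_dom d])+
qed

lemma H10_pair_weak_grad:
  assumes "u \<in> H10 \<Omega>"
  shows "H10_pair \<Omega> u (weak_grad \<Omega> u)"
proof -
  have u: "u \<in> L2_space \<Omega>" "weak_grad \<Omega> u \<in> L2_space \<Omega>" and g: "has_weak_grad \<Omega> u (weak_grad \<Omega> u)"
    using assms has_weak_grad_weak_grad by (auto simp: H10_def H1_def)
  obtain \<phi> where \<phi>: "\<And>k. \<phi> k \<in> T" and lim: "(\<lambda>k. H1_norm \<Omega> (\<lambda>x. u x - \<phi> k x)) \<longlonglongrightarrow> 0"
    using assms by (auto simp: H10_def)
  have "L2_norm \<Omega> (\<lambda>x. u x - \<phi> k x) \<le> H1_norm \<Omega> (\<lambda>x. u x - \<phi> k x)"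
    "L2_norm \<Omega> (\<lambda>x. weak_grad \<Omega> u x - grad (\<phi> k) x) \<le> H1_norm \<Omega> (\<lambda>x. u x - \<phi> k x)" for k
    unfolding weak_grad_diff_test_function[OF g \<phi>, symmetric] H1_norm_def
    by (auto intro!: real_le_rsqrt)
  then have "(\<lambda>k. L2_norm \<Omega> (\<lambda>x. u x - \<phi> k x)) \<longlonglongrightarrow> 0"
    "(\<lambda>k. L2_norm \<Omega> (\<lambda>x. weak_grad \<Omega> u x - grad (\<phi> k) x)) \<longlonglongrightarrow> 0"
    by (auto intro!: tendsto_sandwich[OF _ _ tendsto_const lim] simp: L2_norm_nonneg)
  then show ?thesis
    using u \<phi> by (auto simp: H10_pair_def)
qed

lemma H10_pair_imp_H10:
  assumes "H10_pair \<Omega> u G"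
  shows "u \<in> H10 \<Omega>"
proof -
  note g = H10_pair_has_weak_grad[OF assms]
  obtain \<phi> where \<phi>: "\<And>k. \<phi> k \<in> T"
    and lim: "(\<lambda>k. L2_norm \<Omega> (\<lambda>x. u x - \<phi> k x)) \<longlonglongrightarrow> 0" "(\<lambda>k. L2_norm \<Omega> (\<lambda>x. G x - grad (\<phi> k) x)) \<longlonglongrightarrow> 0"
    using assms by (auto simp: H10_pair_def)
  have "(\<lambda>k. sqrt ((L2_norm \<Omega> (\<lambda>x. u x - \<phi> k x))\<^sup>2 + (L2_norm \<Omega> (\<lambda>x. G x - grad (\<phi> k) x))\<^sup>2)) \<longlonglongrightarrow> sqrt (0\<^sup>2 + 0\<^sup>2)"
    by (intro tendsto_intros lim)
  then have "(\<lambda>k. H1_norm \<Omega> (\<lambda>x. u x - \<phi> k x)) \<longlonglongrightarrow> 0"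
    unfolding H1_norm_def weak_grad_diff_test_function[OF g \<phi>] by simp
  moreover have "AE x in M. G x = weak_grad \<Omega> u x"
    using H10_pair_weak_grad_AE[OF assms] by (rule eventually_mono) simp
  then have "weak_grad \<Omega> u \<in> L2_space \<Omega>"
    using L2_space_cong_AE H10_pair_L2(2)[OF assms] has_weak_grad_measurable(2)[OF open_dom g] by blast
  ultimately show ?thesis
    using \<phi> g H10_pair_L2(1)[OF assms] by (auto simp: H10_def H1_def)
qed

lemma H10_pair_add_scaled:
  assumes "H10_pair \<Omega> u G" "H10_pair \<Omega> w H"
  shows "H10_pair \<Omega> (\<lambda>x. u x + c * w x) (\<lambda>x. G x + c *\<^sub>R H x)"
proof -
  note L2 = H10_pair_L2[OF assms(1)] H10_pair_L2[OF assms(2)]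
  obtain \<phi> where \<phi>: "\<And>k. \<phi> k \<in> T"
    and lim1: "(\<lambda>k. L2_norm \<Omega> (\<lambda>x. u x - \<phi> k x)) \<longlonglongrightarrow> 0" "(\<lambda>k. L2_norm \<Omega> (\<lambda>x. G x - grad (\<phi> k) x)) \<longlonglongrightarrow> 0"
    using assms(1) by (auto simp: H10_pair_def)
  obtain \<psi> where \<psi>: "\<And>k. \<psi> k \<in> T"
    and lim2: "(\<lambda>k. L2_norm \<Omega> (\<lambda>x. w x - \<psi> k x)) \<longlonglongrightarrow> 0" "(\<lambda>k. L2_norm \<Omega> (\<lambda>x. H x - grad (\<psi> k) x)) \<longlonglongrightarrow> 0"
    using assms(2) by (auto simp: H10_pair_def)
  have combine: "(\<lambda>k. L2_norm \<Omega> (\<lambda>x. (p x + c *\<^sub>R q x) - (p' k x + c *\<^sub>R q' k x))) \<longlonglongrightarrow> 0"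
    if mem: "p \<in> L2_space \<Omega>" "q \<in> L2_space \<Omega>" "\<And>k. p' k \<in> L2_space \<Omega>" "\<And>k. q' k \<in> L2_space \<Omega>"
      and lim: "(\<lambda>k. L2_norm \<Omega> (\<lambda>x. p x - p' k x)) \<longlonglongrightarrow> 0" "(\<lambda>k. L2_norm \<Omega> (\<lambda>x. q x - q' k x)) \<longlonglongrightarrow> 0"
    for p q :: "'a \<Rightarrow> 'b::euclidean_space" and p' q'
  proof (rule Lim_null_comparison)
    show "(\<lambda>k. L2_norm \<Omega> (\<lambda>x. p x - p' k x) + \<bar>c\<bar> * L2_norm \<Omega> (\<lambda>x. q x - q' k x)) \<longlonglongrightarrow> 0"
      using tendsto_add[OF lim(1) tendsto_mult_left[OF lim(2), of "\<bar>c\<bar>"]] by simp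
    have "L2_norm \<Omega> (\<lambda>x. (p x + c *\<^sub>R q x) - (p' k x + c *\<^sub>R q' k x)) \<le>
        L2_norm \<Omega> (\<lambda>x. p x - p' k x) + \<bar>c\<bar> * L2_norm \<Omega> (\<lambda>x. q x - q' k x)" for k
    proof -
      have "(\<lambda>x. c *\<^sub>R (q x - q' k x)) \<in> L2_space \<Omega>"
        by (rule L2_scaled[OF L2_diff[OF mem(2,4)]])
      from L2_norm_triangle[OF L2_diff[OF mem(1,3)] this, of k] show ?thesis
        unfolding L2_norm_scaled by (simp add: algebra_simps)
    qed
    then show "\<forall>\<^sub>F k in sequentially. norm (L2_norm \<Omega> (\<lambda>x. (p x + c *\<^sub>R q x) - (p' k x + c *\<^sub>R q' k x)))
        \<le> L2_norm \<Omega> (\<lambda>x. p x - p' k x) + \<bar>c\<bar> * L2_norm \<Omega> (\<lambda>x. q x - q' k x)"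
      by (simp add: L2_norm_nonneg)
  qed
  have "(\<lambda>k. L2_norm \<Omega> (\<lambda>x. (u x + c * w x) - (\<phi> k x + c * \<psi> k x))) \<longlonglongrightarrow> 0"
    using combine[OF L2(1,3) test_function_L2[OF \<phi>] test_function_L2[OF \<psi>] lim1(1) lim2(1)] by simp
  moreover have "(\<lambda>k. L2_norm \<Omega> (\<lambda>x. (G x + c *\<^sub>R H x) - grad (\<lambda>x. \<phi> k x + c * \<psi> k x) x)) \<longlonglongrightarrow> 0"
    using combine[OF L2(2,4) grad_L2[OF \<phi>] grad_L2[OF \<psi>] lim1(2) lim2(2)]
    by (simp add: grad_add_scaled[OF \<phi> \<psi>])
  moreover have "(\<lambda>x. \<phi> k x + c * \<psi> k x) \<in> T" for k
    by (rule test_function_add_scaled[OF \<phi> \<psi>])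
  ultimately show ?thesis
    unfolding H10_pair_def using L2_add_scaled[OF L2(1,3), of c] L2_add_scaled[OF L2(2,4), of c]
    by (auto intro!: exI[of _ "\<lambda>k x. \<phi> k x + c * \<psi> k x"])
qed

lemma H10_add_scaled: "u \<in> H10 \<Omega> \<Longrightarrow> w \<in> H10 \<Omega> \<Longrightarrow> (\<lambda>x. u x + c * w x) \<in> H10 \<Omega>"
  by (rule H10_pair_imp_H10[OF H10_pair_add_scaled[OF H10_pair_weak_grad H10_pair_weak_grad]])

lemma weak_grad_add_scaled_AE:
  "u \<in> H10 \<Omega> \<Longrightarrow> w \<in> H10 \<Omega> \<Longrightarrow>
    AE x in M. weak_grad \<Omega> (\<lambda>x. u x + c * w x) x = weak_grad \<Omega> u x + c *\<^sub>R weak_grad \<Omega> w x"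
  by (rule H10_pair_weak_grad_AE[OF H10_pair_add_scaled[OF H10_pair_weak_grad H10_pair_weak_grad]])

lemma test_function_H10: "\<phi> \<in> T \<Longrightarrow> \<phi> \<in> H10 \<Omega>"
  by (rule H10_pair_imp_H10[OF H10_pair_test_function])

end

context bounded_open_set
begin

section \<open>The Poincare inequality\<close>

text \<open>The derivative in direction \<open>b\<close> of \<open>(x \<bullet> b) \<phi>\<^sup>2\<close> has integral zero. The product rule writes it as
  \<open>\<phi>\<^sup>2 + 2 (x \<bullet> b) \<phi> \<partial>\<phi>\<close>, and \<open>x \<bullet> b\<close> is bounded on the domain.\<close>

lemma Poincare_test_function:
  assumes R: "\<And>x. x \<in> \<Omega> \<Longrightarrow> norm x \<le> R" and \<phi>: "\<phi> \<in> T"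
  shows "L2_norm \<Omega> \<phi> \<le> 2 * R * L2_norm \<Omega> (grad \<phi>)"
proof -
  obtain b :: 'a where b: "b \<in> Basis" using nonempty_Basis by blast
  define D where "D x = frechet_derivative \<phi> (at x) b" for x
  have D: "D \<in> T"
    unfolding D_def[abs_def] by (rule test_function_frechet[OF \<phi> b])
  define z where "z x = (x \<bullet> b) * D x" for x
  have z: "z \<in> T"
    unfolding z_def[abs_def] by (rule test_function_mult_smooth[OF D Ck_inner])
  have \<phi>2: "(\<lambda>x. \<phi> x * \<phi> x) \<in> T"
    by (rule test_function_mult_smooth[OF \<phi> test_function_smooth[OF \<phi>]])
  have \<phi>z: "(\<lambda>x. \<phi> x * z x) \<in> T"
    by (rule test_function_mult_smooth[OF z test_function_smooth[OF \<phi>]])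
  have p: "(\<lambda>x. (x \<bullet> b) * (\<phi> x * \<phi> x)) \<in> T"
    by (rule test_function_mult_smooth[OF \<phi>2 Ck_inner])
  have "frechet_derivative (\<lambda>x. (x \<bullet> b) * (\<phi> x * \<phi> x)) (at x) b = \<phi> x * \<phi> x + 2 * (\<phi> x * z x)" for x
  proof -
    have "((\<lambda>x. (x \<bullet> b) * (\<phi> x * \<phi> x)) has_derivative
        (\<lambda>h. (x \<bullet> b) * (\<phi> x * (grad \<phi> x \<bullet> h) + (grad \<phi> x \<bullet> h) * \<phi> x) + (h \<bullet> b) * (\<phi> x * \<phi> x))) (at x)"
      by (intro has_derivative_mult grad_has_derivative[OF \<phi>]) (auto intro!: derivative_eq_intros)
    from fun_cong[OF frechet_derivative_at[OF this], of b] show ?thesis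
      using b by (simp add: grad_inner_Basis z_def D_def algebra_simps)
  qed
  then have "0 = (LINT x|lborel. \<phi> x * \<phi> x + 2 * (\<phi> x * z x))"
    using integral_derivative_test_function[OF p b] by simp
  also have "\<dots> = (LINT x|lborel. \<phi> x * \<phi> x) + 2 * (LINT x|lborel. \<phi> x * z x)"
    using test_function_integrable[OF \<phi>2] test_function_integrable[OF \<phi>z] by simp
  finally have "(LINT x|lborel. \<phi> x * \<phi> x) = - 2 * (LINT x|lborel. \<phi> x * z x)"
    by simp
  then have "(L2_norm \<Omega> \<phi>)\<^sup>2 = - 2 * (LINT x|M. \<phi> x \<bullet> z x)"
    using integral_lebesgue_on_eq_lborel[OF dom_lebesgue test_function_borel[OF \<phi>2] test_function_outside[OF \<phi>2]]
      integral_lebesgue_on_eq_lborel[OF dom_lebesgue test_function_borel[OF \<phi>z] test_function_outside[OF \<phi>z]]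
    unfolding L2_norm_power2 by (simp add: power2_eq_square)
  also have "\<dots> \<le> 2 * (L2_norm \<Omega> \<phi> * L2_norm \<Omega> z)"
    using L2_Cauchy_Schwarz[OF test_function_L2[OF \<phi>] test_function_L2[OF z]] by simp
  finally have square: "(L2_norm \<Omega> \<phi>)\<^sup>2 \<le> 2 * (L2_norm \<Omega> \<phi> * L2_norm \<Omega> z)" .
  have z_le: "L2_norm \<Omega> z \<le> R * L2_norm \<Omega> (grad \<phi>)"
  proof (cases "\<Omega> = {}")
    case False
    then have "0 \<le> R"
      using R norm_ge_zero order_trans by blast
    have "L2_norm \<Omega> z \<le> L2_norm \<Omega> (\<lambda>x. R *\<^sub>R grad \<phi> x)"
      unfolding L2_norm_def
    proof (rule real_sqrt_le_mono, rule integral_mono)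
      show "integrable M (\<lambda>x. (norm (z x))\<^sup>2)" "integrable M (\<lambda>x. (norm (R *\<^sub>R grad \<phi> x))\<^sup>2)"
        using test_function_L2[OF z] L2_scaled[OF grad_L2[OF \<phi>], of R] by (simp_all add: L2_space_def)
      fix x assume "x \<in> space M"
      then have "x \<in> \<Omega>" by simp
      have "\<bar>x \<bullet> b\<bar> \<le> R"
        using R[OF \<open>x \<in> \<Omega>\<close>] Basis_le_norm[OF b, of x] by simp
      moreover have "\<bar>D x\<bar> \<le> norm (grad \<phi> x)"
        using Basis_le_norm[OF b, of "grad \<phi> x"] b by (simp add: grad_inner_Basis D_def)
      ultimately have "\<bar>z x\<bar> \<le> R * norm (grad \<phi> x)"
        unfolding z_def abs_mult using \<open>0 \<le> R\<close> by (intro mult_mono) auto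
      then show "(norm (z x))\<^sup>2 \<le> (norm (R *\<^sub>R grad \<phi> x))\<^sup>2"
        using \<open>0 \<le> R\<close> by (intro power_mono) auto
    qed
    then show ?thesis
      unfolding L2_norm_scaled using \<open>0 \<le> R\<close> by simp
  qed (simp add: L2_norm_def)
  have *: "L2_norm \<Omega> \<phi> * L2_norm \<Omega> \<phi> \<le> L2_norm \<Omega> \<phi> * (2 * R * L2_norm \<Omega> (grad \<phi>))"
    using square mult_left_mono[OF z_le L2_norm_nonneg[of \<Omega> \<phi>]] by (simp add: power2_eq_square)
  show ?thesis
  proof (cases "L2_norm \<Omega> \<phi> = 0")
    case True
    have "0 \<le> R * L2_norm \<Omega> (grad \<phi>)"
      using z_le L2_norm_nonneg order_trans by blast
    with True show ?thesis by simp
  next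
    case False
    then show ?thesis
      using * L2_norm_nonneg[of \<Omega> \<phi>] by simp
  qed
qed

lemma Poincare:
  obtains C where "C > 0" "\<And>u G. H10_pair \<Omega> u G \<Longrightarrow> L2_norm \<Omega> u \<le> C * L2_norm \<Omega> G"
proof -
  obtain R where R: "R > 0" "\<And>x. x \<in> \<Omega> \<Longrightarrow> norm x \<le> R"
    using bounded_dom by (auto simp: bounded_pos)
  have "L2_norm \<Omega> u \<le> 2 * R * L2_norm \<Omega> G" if uG: "H10_pair \<Omega> u G" for u G
  proof -
    obtain \<phi> where \<phi>: "\<And>k. \<phi> k \<in> T"
      and lim: "(\<lambda>k. L2_norm \<Omega> (\<lambda>x. u x - \<phi> k x)) \<longlonglongrightarrow> 0" "(\<lambda>k. L2_norm \<Omega> (\<lambda>x. G x - grad (\<phi> k) x)) \<longlonglongrightarrow> 0"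
      using uG by (auto simp: H10_pair_def)
    have "(\<lambda>k. L2_norm \<Omega> (\<phi> k)) \<longlonglongrightarrow> L2_norm \<Omega> u"
      by (rule L2_norm_tendsto[OF test_function_L2[OF \<phi>] H10_pair_L2(1)[OF uG] lim(1)])
    moreover have "(\<lambda>k. 2 * R * L2_norm \<Omega> (grad (\<phi> k))) \<longlonglongrightarrow> 2 * R * L2_norm \<Omega> G"
      by (intro tendsto_mult tendsto_const L2_norm_tendsto[OF grad_L2[OF \<phi>] H10_pair_L2(2)[OF uG] lim(2)])
    ultimately show ?thesis
      by (rule LIMSEQ_le) (use Poincare_test_function[OF R(2) \<phi>] in auto)
  qed
  then show ?thesis using that[of "2 * R"] R(1) by simp
qed

section \<open>Completeness in the gradient norm\<close>

text \<open>By the Poincare inequality a Cauchy sequence of gradients forces the functions to be Cauchy as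
  well. A diagonal choice of test functions shows that the two limits form a pair again.\<close>

lemma H10_pair_complete:
  assumes p: "\<And>n. H10_pair \<Omega> (u n) (G n)"
    and Cauchy: "\<And>e. e > 0 \<Longrightarrow> \<exists>N. \<forall>m\<ge>N. \<forall>n\<ge>N. L2_norm \<Omega> (\<lambda>x. G m x - G n x) < e"
  obtains w H where "H10_pair \<Omega> w H" "(\<lambda>n. L2_norm \<Omega> (\<lambda>x. G n x - H x)) \<longlonglongrightarrow> 0"
proof -
  obtain C where C: "C > 0" "\<And>u G. H10_pair \<Omega> u G \<Longrightarrow> L2_norm \<Omega> u \<le> C * L2_norm \<Omega> G"
    using Poincare by metis
  have uL2: "u n \<in> L2_space \<Omega>" and GL2: "G n \<in> L2_space \<Omega>" for n
    using H10_pair_L2[OF p] by auto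
  have "\<exists>N. \<forall>m\<ge>N. \<forall>n\<ge>N. L2_norm \<Omega> (\<lambda>x. u m x - u n x) < e" if "e > 0" for e
  proof -
    obtain N where N: "\<And>m n. m \<ge> N \<Longrightarrow> n \<ge> N \<Longrightarrow> L2_norm \<Omega> (\<lambda>x. G m x - G n x) < e / C"
      using Cauchy[of "e / C"] C(1) \<open>e > 0\<close> by auto
    have "L2_norm \<Omega> (\<lambda>x. u m x - u n x) < e" if "m \<ge> N" "n \<ge> N" for m n
    proof -
      have "L2_norm \<Omega> (\<lambda>x. u m x - u n x) \<le> C * L2_norm \<Omega> (\<lambda>x. G m x - G n x)"
        using C(2)[OF H10_pair_add_scaled[OF p[of m] p[of n], of "-1"]] by simp
      also have "\<dots> < C * (e / C)"
        using N[OF that] C(1) by (intro mult_strict_left_mono)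
      finally show ?thesis using C(1) by simp
    qed
    then show ?thesis by blast
  qed
  then obtain w where w: "w \<in> L2_space \<Omega>" "(\<lambda>n. L2_norm \<Omega> (\<lambda>x. u n x - w x)) \<longlonglongrightarrow> 0"
    by (rule L2_complete[OF uL2])
  obtain H where H: "H \<in> L2_space \<Omega>" "(\<lambda>n. L2_norm \<Omega> (\<lambda>x. G n x - H x)) \<longlonglongrightarrow> 0"
    by (rule L2_complete[OF GL2 Cauchy])
  have "\<exists>\<phi>\<in>T. L2_norm \<Omega> (\<lambda>x. u n x - \<phi> x) < e \<and> L2_norm \<Omega> (\<lambda>x. G n x - grad \<phi> x) < e" if "e > 0" for n e
  proof -
    obtain \<phi> where \<phi>: "\<And>k. \<phi> k \<in> T"
      and lim: "(\<lambda>k. L2_norm \<Omega> (\<lambda>x. u n x - \<phi> k x)) \<longlonglongrightarrow> 0" "(\<lambda>k. L2_norm \<Omega> (\<lambda>x. G n x - grad (\<phi> k) x)) \<longlonglongrightarrow> 0"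
      using p[of n] by (auto simp: H10_pair_def)
    have "\<forall>\<^sub>F k in sequentially. L2_norm \<Omega> (\<lambda>x. u n x - \<phi> k x) < e \<and> L2_norm \<Omega> (\<lambda>x. G n x - grad (\<phi> k) x) < e"
      using order_tendstoD(2)[OF lim(1) that] order_tendstoD(2)[OF lim(2) that] by (rule eventually_conj)
    then obtain k where "L2_norm \<Omega> (\<lambda>x. u n x - \<phi> k x) < e \<and> L2_norm \<Omega> (\<lambda>x. G n x - grad (\<phi> k) x) < e"
      using eventually_happens'[OF trivial_limit_sequentially] by blast
    then show ?thesis using \<phi> by blast
  qed
  then have "\<forall>n. \<exists>\<phi>\<in>T. L2_norm \<Omega> (\<lambda>x. u n x - \<phi> x) < inverse (real (Suc n)) \<and>
      L2_norm \<Omega> (\<lambda>x. G n x - grad \<phi> x) < inverse (real (Suc n))"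
    by simp
  then obtain \<phi> where \<phi>: "\<And>n. \<phi> n \<in> T"
    and close: "\<And>n. L2_norm \<Omega> (\<lambda>x. u n x - \<phi> n x) < inverse (real (Suc n))"
      "\<And>n. L2_norm \<Omega> (\<lambda>x. G n x - grad (\<phi> n) x) < inverse (real (Suc n))"
    by metis
  have diagonal: "(\<lambda>n. L2_norm \<Omega> (\<lambda>x. l x - q n x)) \<longlonglongrightarrow> 0"
    if mem: "l \<in> L2_space \<Omega>" "\<And>n. s n \<in> L2_space \<Omega>" "\<And>n. q n \<in> L2_space \<Omega>"
      and lim: "(\<lambda>n. L2_norm \<Omega> (\<lambda>x. s n x - l x)) \<longlonglongrightarrow> 0"
      and close: "\<And>n. L2_norm \<Omega> (\<lambda>x. s n x - q n x) < inverse (real (Suc n))"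
    for l :: "'a \<Rightarrow> 'b::euclidean_space" and s q
  proof (rule tendsto_sandwich[OF _ _ tendsto_const])
    show "(\<lambda>n. L2_norm \<Omega> (\<lambda>x. s n x - l x) + inverse (real (Suc n))) \<longlonglongrightarrow> 0"
      using tendsto_add[OF lim LIMSEQ_inverse_real_of_nat] by simp
    have "L2_norm \<Omega> (\<lambda>x. l x - q n x) \<le> L2_norm \<Omega> (\<lambda>x. s n x - l x) + inverse (real (Suc n))" for n
      using L2_norm_diff_triangle[OF mem(1,2,3), of n n] close[of n] L2_norm_minus_commute[of \<Omega> l "s n"]
      by simp
    then show "\<forall>\<^sub>F n in sequentially. L2_norm \<Omega> (\<lambda>x. l x - q n x) \<le> L2_norm \<Omega> (\<lambda>x. s n x - l x) + inverse (real (Suc n))"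
      by simp
  qed (simp add: L2_norm_nonneg)
  have "H10_pair \<Omega> w H"
    unfolding H10_pair_def
    using w(1) H(1) \<phi> diagonal[OF w(1) uL2 test_function_L2[OF \<phi>] w(2) close(1)]
      diagonal[OF H(1) GL2 grad_L2[OF \<phi>] H(2) close(2)] by blast
  then show ?thesis using H(2) that by blast
qed

end

lemma squeeze_zero:
  fixes f g :: "nat \<Rightarrow> real"
  assumes "\<And>n. 0 \<le> f n" "\<And>n. f n \<le> g n" "g \<longlonglongrightarrow> 0"
  shows "f \<longlonglongrightarrow> 0"
  by (rule tendsto_sandwich[OF _ _ tendsto_const assms(3)]) (simp_all add: assms)

section \<open>The energy space as a Hilbert space\<close>

locale diffusion = bounded_open_set \<Omega> for \<Omega> :: "'a::euclidean_space set" +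
  fixes \<alpha> :: "'a \<Rightarrow> real" and lo hi :: real
  assumes nonempty: "\<Omega> \<noteq> {}"
    and diffusion_measurable: "\<alpha> \<in> borel_measurable (lebesgue_on \<Omega>)"
    and lo_pos: "0 < lo"
    and diffusion_bounds: "\<And>x. x \<in> \<Omega> \<Longrightarrow> lo \<le> \<alpha> x \<and> \<alpha> x \<le> hi"
begin

lemma hi_pos: "0 < hi"
  using nonempty diffusion_bounds lo_pos by fastforce

definition energy :: "('a \<Rightarrow> real) \<Rightarrow> ('a \<Rightarrow> real) \<Rightarrow> real" where
  "energy p q = (LINT x|M. \<alpha> x * (weak_grad \<Omega> p x \<bullet> weak_grad \<Omega> q x))"

lemma diffusion_scaled_L2:
  assumes "w \<in> L2_space \<Omega>"
  shows "(\<lambda>x. \<alpha> x *\<^sub>R w x) \<in> L2_space \<Omega>"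
proof -
  have [measurable]: "w \<in> borel_measurable M" "\<alpha> \<in> borel_measurable M"
    using assms diffusion_measurable by (auto simp: L2_space_def)
  have meas: "(\<lambda>x. \<alpha> x *\<^sub>R w x) \<in> borel_measurable M"
    by (rule borel_measurable_scaleR) simp_all
  have "integrable M (\<lambda>x. (norm (\<alpha> x *\<^sub>R w x))\<^sup>2)"
  proof (rule Bochner_Integration.integrable_bound)
    show "integrable M (\<lambda>x. hi\<^sup>2 * (norm (w x))\<^sup>2)"
      using assms by (simp add: L2_space_def)
    show "(\<lambda>x. (norm (\<alpha> x *\<^sub>R w x))\<^sup>2) \<in> borel_measurable M"
      using meas by simp
    have "(norm (\<alpha> x *\<^sub>R w x))\<^sup>2 \<le> hi\<^sup>2 * (norm (w x))\<^sup>2" if "x \<in> \<Omega>" for x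
      unfolding norm_scaleR power_mult_distrib
      using diffusion_bounds[OF that] lo_pos by (intro mult_right_mono power_mono) auto
    then show "AE x in M. norm ((norm (\<alpha> x *\<^sub>R w x))\<^sup>2) \<le> norm (hi\<^sup>2 * (norm (w x))\<^sup>2)"
      by (intro AE_I2) simp
  qed
  with meas show ?thesis by (simp add: L2_space_def)
qed

lemma diffusion_integrable:
  assumes "w \<in> L2_space \<Omega>" "z \<in> L2_space \<Omega>"
  shows "integrable M (\<lambda>x. \<alpha> x * (w x \<bullet> z x))"
  using L2_inner_integrable[OF diffusion_scaled_L2[OF assms(1)] assms(2)] by simp

lemma H10_L2: "q \<in> H10 \<Omega> \<Longrightarrow> q \<in> L2_space \<Omega>" "q \<in> H10 \<Omega> \<Longrightarrow> weak_grad \<Omega> q \<in> L2_space \<Omega>"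
  using H10_pair_L2[OF H10_pair_weak_grad] by auto

lemma L2_measurable: "w \<in> L2_space \<Omega> \<Longrightarrow> w \<in> borel_measurable M"
  by (simp add: L2_space_def)

lemma energy_add_scaled:
  assumes "p \<in> H10 \<Omega>" "q \<in> H10 \<Omega>" "r \<in> H10 \<Omega>"
  shows "energy (\<lambda>x. p x + c * q x) r = energy p r + c * energy q r"
proof -
  note [measurable] = L2_measurable[OF H10_L2(2)[OF assms(1)]] L2_measurable[OF H10_L2(2)[OF assms(2)]]
    L2_measurable[OF H10_L2(2)[OF assms(3)]] L2_measurable[OF H10_L2(2)[OF H10_add_scaled[OF assms(1,2), of c]]]
    diffusion_measurable
  have "energy (\<lambda>x. p x + c * q x) r =
      (LINT x|M. \<alpha> x * (weak_grad \<Omega> p x \<bullet> weak_grad \<Omega> r x) + c * (\<alpha> x * (weak_grad \<Omega> q x \<bullet> weak_grad \<Omega> r x)))"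
    unfolding energy_def
    by (rule integral_cong_AE, measurable)
       (use weak_grad_add_scaled_AE[OF assms(1,2), of c] in \<open>rule eventually_mono\<close>,
        simp add: inner_add_left algebra_simps)
  also have "\<dots> = energy p r + c * energy q r"
    unfolding energy_def using diffusion_integrable[OF H10_L2(2) H10_L2(2)] assms by simp
  finally show ?thesis .
qed

lemma energy_nonneg: "0 \<le> energy p p"
  unfolding energy_def
  by (intro integral_nonneg_AE AE_I2 mult_nonneg_nonneg) (use diffusion_bounds lo_pos in \<open>force\<close>)+

sublocale E: semi_inner_space "H10 \<Omega>" energy
proof
  show "energy p q = energy q p" for p q
    by (simp add: energy_def inner_commute)
qed (simp_all add: H10_add_scaled energy_add_scaled energy_nonneg)

lemma nrm_eq_Y_norm: "E.nrm q = Y_norm \<Omega> \<alpha> q"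
  by (simp add: E.nrm_def energy_def Y_norm_def power2_norm_eq_inner)

lemma L2_norm_weak_grad:
  assumes "H10_pair \<Omega> u G"
  shows "L2_norm \<Omega> (weak_grad \<Omega> u) = L2_norm \<Omega> G"
  using L2_norm_cong_AE[OF H10_pair_weak_grad_AE[OF assms]]
    has_weak_grad_measurable[OF open_dom H10_pair_has_weak_grad[OF assms]] by blast

lemma nrm_bounds:
  assumes "q \<in> H10 \<Omega>"
  shows "sqrt lo * L2_norm \<Omega> (weak_grad \<Omega> q) \<le> E.nrm q" "E.nrm q \<le> sqrt hi * L2_norm \<Omega> (weak_grad \<Omega> q)"
proof -
  let ?G = "weak_grad \<Omega> q"
  note G = H10_L2(2)[OF assms]
  have int: "integrable M (\<lambda>x. (norm (?G x))\<^sup>2)" "integrable M (\<lambda>x. \<alpha> x * (norm (?G x))\<^sup>2)"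
    using G diffusion_integrable[OF G G] by (simp_all add: L2_space_def power2_norm_eq_inner)
  have "lo * (LINT x|M. (norm (?G x))\<^sup>2) \<le> (LINT x|M. \<alpha> x * (norm (?G x))\<^sup>2)"
    unfolding integral_mult_right_zero[symmetric]
    by (rule integral_mono) (use int diffusion_bounds in \<open>auto intro!: mult_right_mono\<close>)
  then show "sqrt lo * L2_norm \<Omega> ?G \<le> E.nrm q"
    unfolding nrm_eq_Y_norm Y_norm_def L2_norm_def real_sqrt_mult[symmetric] by (rule real_sqrt_le_mono)
  have "(LINT x|M. \<alpha> x * (norm (?G x))\<^sup>2) \<le> hi * (LINT x|M. (norm (?G x))\<^sup>2)"
    unfolding integral_mult_right_zero[symmetric]
    by (rule integral_mono) (use int diffusion_bounds in \<open>auto intro!: mult_right_mono\<close>)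
  then show "E.nrm q \<le> sqrt hi * L2_norm \<Omega> ?G"
    unfolding nrm_eq_Y_norm Y_norm_def L2_norm_def real_sqrt_mult[symmetric] by (rule real_sqrt_le_mono)
qed

lemma L2_norm_weak_grad_diff:
  assumes "p \<in> H10 \<Omega>" "q \<in> H10 \<Omega>"
  shows "L2_norm \<Omega> (weak_grad \<Omega> (\<lambda>x. p x - q x)) = L2_norm \<Omega> (\<lambda>x. weak_grad \<Omega> p x - weak_grad \<Omega> q x)"
  using L2_norm_weak_grad[OF H10_pair_add_scaled[OF H10_pair_weak_grad[OF assms(1)] H10_pair_weak_grad[OF assms(2)], of "-1"]]
  by simp

lemma energy_complete: E.complete_carrier
  unfolding E.complete_carrier_def
proof (intro allI impI)
  fix s :: "nat \<Rightarrow> 'a \<Rightarrow> real"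
  assume "\<forall>n. s n \<in> H10 \<Omega>"
  then have s: "\<And>n. s n \<in> H10 \<Omega>" by blast
  assume Cauchy: "\<forall>e>0. \<exists>N. \<forall>m\<ge>N. \<forall>n\<ge>N. E.nrm (\<lambda>x. s m x - s n x) < e"
  have "\<exists>N. \<forall>m\<ge>N. \<forall>n\<ge>N. L2_norm \<Omega> (\<lambda>x. weak_grad \<Omega> (s m) x - weak_grad \<Omega> (s n) x) < e" if "e > 0" for e
  proof -
    have "sqrt lo * e > 0" using lo_pos that by simp
    then obtain N where N: "\<And>m n. m \<ge> N \<Longrightarrow> n \<ge> N \<Longrightarrow> E.nrm (\<lambda>x. s m x - s n x) < sqrt lo * e"
      using Cauchy by blast
    have "L2_norm \<Omega> (\<lambda>x. weak_grad \<Omega> (s m) x - weak_grad \<Omega> (s n) x) < e" if "m \<ge> N" "n \<ge> N" for m n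
    proof -
      have "sqrt lo * L2_norm \<Omega> (\<lambda>x. weak_grad \<Omega> (s m) x - weak_grad \<Omega> (s n) x) < sqrt lo * e"
        using nrm_bounds(1)[OF E.diff_closed[OF s[of m] s[of n]]] N[OF that]
        by (simp add: L2_norm_weak_grad_diff[OF s s])
      then show ?thesis using lo_pos by simp
    qed
    then show ?thesis by blast
  qed
  then obtain w H where wH: "H10_pair \<Omega> w H"
    and lim: "(\<lambda>n. L2_norm \<Omega> (\<lambda>x. weak_grad \<Omega> (s n) x - H x)) \<longlonglongrightarrow> 0"
    by (rule H10_pair_complete[OF H10_pair_weak_grad[OF s]])
  have w: "w \<in> H10 \<Omega>"
    by (rule H10_pair_imp_H10[OF wH])
  have "E.nrm (\<lambda>x. w x - s n x) \<le> sqrt hi * L2_norm \<Omega> (\<lambda>x. weak_grad \<Omega> (s n) x - H x)" for n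
    using nrm_bounds(2)[OF E.diff_closed[OF w s[of n]]]
      L2_norm_weak_grad[OF H10_pair_add_scaled[OF wH H10_pair_weak_grad[OF s[of n]], of "-1"]]
    by (simp add: L2_norm_minus_commute)
  moreover have "(\<lambda>n. sqrt hi * L2_norm \<Omega> (\<lambda>x. weak_grad \<Omega> (s n) x - H x)) \<longlonglongrightarrow> 0"
    using tendsto_mult_left[OF lim, of "sqrt hi"] by simp
  ultimately have "(\<lambda>n. E.nrm (\<lambda>x. w x - s n x)) \<longlonglongrightarrow> 0"
    by (rule squeeze_zero[rotated]) (rule E.nrm_nonneg[OF E.diff_closed[OF w s]])
  then show "\<exists>u\<in>H10 \<Omega>. (\<lambda>n. E.nrm (\<lambda>x. u x - s n x)) \<longlonglongrightarrow> 0"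
    using w by blast
qed

text \<open>Together with its converse below, this identifies the functions admitted in the suprema of the dual
  norm and of \<open>c_vel\<close> as those of positive energy norm.\<close>

lemma nrm_zero_imp_AE_zero:
  assumes q: "q \<in> H10 \<Omega>" and zero: "E.nrm q = 0"
  shows "AE x in M. q x = 0"
proof -
  obtain C where C: "C > 0" "\<And>u G. H10_pair \<Omega> u G \<Longrightarrow> L2_norm \<Omega> u \<le> C * L2_norm \<Omega> G"
    using Poincare by metis
  have "L2_norm \<Omega> (weak_grad \<Omega> q) = 0"
    using nrm_bounds(1)[OF q] zero lo_pos L2_norm_nonneg[of \<Omega> "weak_grad \<Omega> q"] by (simp add: mult_le_0_iff)
  then have "L2_norm \<Omega> q = 0"
    using C(2)[OF H10_pair_weak_grad[OF q]] L2_norm_nonneg[of \<Omega> q] by simp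
  then show ?thesis
    by (rule L2_norm_eq_0_AE[OF H10_L2(1)[OF q]])
qed

text \<open>The zero field is a weak gradient of such a function, and weak gradients are unique.\<close>

lemma AE_zero_imp_nrm_zero:
  assumes q: "q \<in> H10 \<Omega>" and zero: "AE x in M. q x = 0"
  shows "E.nrm q = 0"
proof -
  note qL2 = H10_L2(1)[OF q]
  have "has_weak_grad \<Omega> q (\<lambda>_. 0)"
    unfolding has_weak_grad_def
  proof (intro conjI ballI L2_locally_integrable[OF qL2])
    show "locally_integrable \<Omega> (\<lambda>_. 0 :: 'a)"
      by (rule continuous_imp_locally_integrable) simp
    fix \<phi> and b :: 'a assume "\<phi> \<in> T" "b \<in> Basis"
    then have [measurable]: "(\<lambda>x. frechet_derivative \<phi> (at x) b) \<in> borel_measurable M"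
      by (intro L2_measurable test_function_L2 test_function_frechet)
    have "(LINT x|M. q x * frechet_derivative \<phi> (at x) b) = (LINT x|M. 0)"
      by (rule integral_cong_AE) (use zero L2_measurable[OF qL2] in auto)
    then show "(LINT x|M. q x * frechet_derivative \<phi> (at x) b) = - (LINT x|M. (0 \<bullet> b) * \<phi> x)"
      by simp
  qed
  then have "AE x in M. weak_grad \<Omega> q x = 0"
    by (rule weak_grad_AE_eq[OF open_dom])
  then have "L2_norm \<Omega> (weak_grad \<Omega> q) = L2_norm \<Omega> (\<lambda>_. 0 :: 'a)"
    by (rule L2_norm_cong_AE) (simp_all add: L2_measurable[OF H10_L2(2)[OF q]])
  then show ?thesis
    using nrm_bounds(2)[OF q] E.nrm_nonneg[OF q] by (simp add: L2_norm_def)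
qed

lemma H10_nonzero_iff: "q \<in> H10_nonzero \<Omega> \<longleftrightarrow> q \<in> H10 \<Omega> \<and> 0 < E.nrm q"
proof (cases "q \<in> H10 \<Omega>")
  case True
  then have "(AE x in M. q x = 0) \<longleftrightarrow> E.nrm q = 0"
    using nrm_zero_imp_AE_zero AE_zero_imp_nrm_zero by blast
  moreover have "0 < E.nrm q \<longleftrightarrow> E.nrm q \<noteq> 0"
    using E.nrm_nonneg[OF True] by linarith
  ultimately show ?thesis
    unfolding H10_nonzero_def mem_Collect_eq using True by blast
qed (simp add: H10_nonzero_def)

text \<open>Without a nonzero function the dual norm would be the unspecified supremum of the empty set.\<close>

lemma H10_nonzero_nonempty: "H10_nonzero \<Omega> \<noteq> {}"
proof -
  obtain x where "x \<in> \<Omega>"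
    using nonempty by blast
  then obtain c d where cd: "cbox c d \<subseteq> \<Omega>" and x: "x \<in> box c d"
    by (rule open_contains_cbox[OF open_dom])
  note b = bump_test_function[OF cd, of 1, simplified]
  have "\<not> (AE x in M. bump 1 c d x = 0)"
  proof
    assume "AE x in M. bump 1 c d x = 0"
    then have "AE x in lebesgue. x \<in> \<Omega> \<longrightarrow> bump 1 c d x = 0"
      using dom_lebesgue by (simp add: AE_restrict_space_iff)
    then have "AE x in lebesgue. x \<notin> box c d"
      by (rule eventually_mono) (use cd box_subset_cbox[of c d] in \<open>auto simp: bump_eq_0_iff\<close>)
    then have "negligible (box c d)"
      unfolding negligible_iff_null_sets by (subst (asm) AE_iff_null_sets[symmetric]) auto
    then show False
      using open_not_negligible[of "box c d"] x by auto
  qed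
  then show ?thesis
    using test_function_H10[OF b] by (auto simp: H10_nonzero_def)
qed

section \<open>The dual space\<close>

lemma Y_dual_bounded_functional:
  assumes "f \<in> Y_dual \<Omega> \<alpha>"
  shows "E.bounded_functional f"
proof -
  have zero: "(\<lambda>_. 0) \<in> H10 \<Omega>"
    by (rule test_function_H10[OF test_function_zero])
  have "f (\<lambda>x. p x + c * q x) = f p + c * f q" if p: "p \<in> H10 \<Omega>" and q: "q \<in> H10 \<Omega>" for p q c
  proof -
    have "(\<lambda>x. c * q x) \<in> H10 \<Omega>"
      using H10_add_scaled[OF zero q, of c] by simp
    then show ?thesis
      using assms p q unfolding Y_dual_def by simp
  qed
  moreover have "\<exists>C. \<forall>q\<in>H10 \<Omega>. \<bar>f q\<bar> \<le> C * E.nrm q"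
    using assms unfolding Y_dual_def nrm_eq_Y_norm by blast
  ultimately show ?thesis
    by (simp add: E.bounded_functional_def)
qed

lemma functional_diff:
  assumes "E.bounded_functional f" "p \<in> H10 \<Omega>" "q \<in> H10 \<Omega>"
  shows "f (\<lambda>x. p x - q x) = f p - f q"
proof -
  have "f (\<lambda>x. p x + (-1) *\<^sub>R q x) = f p + (-1) * f q"
    using assms unfolding E.bounded_functional_def by blast
  then show ?thesis by simp
qed

lemma bounded_functional_Y_dual:
  assumes "E.bounded_functional f"
  shows "f \<in> Y_dual \<Omega> \<alpha>"
proof -
  have zero: "(\<lambda>_. 0) \<in> H10 \<Omega>"
    by (rule test_function_H10[OF test_function_zero])
  have lin: "f (\<lambda>x. p x + c * q x) = f p + c * f q" if "p \<in> H10 \<Omega>" "q \<in> H10 \<Omega>" for p q c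
    using assms that by (simp add: E.bounded_functional_def)
  have f0: "f (\<lambda>_. 0) = 0"
    using lin[OF zero zero, of 1] by simp
  have "f (\<lambda>x. p x + q x) = f p + f q" if "p \<in> H10 \<Omega>" "q \<in> H10 \<Omega>" for p q
    using lin[OF that, of 1] by simp
  moreover have "f (\<lambda>x. c * q x) = c * f q" if "q \<in> H10 \<Omega>" for c q
    using lin[OF zero that, of c] f0 by simp
  moreover have "\<exists>C. \<forall>q\<in>H10 \<Omega>. \<bar>f q\<bar> \<le> C * Y_norm \<Omega> \<alpha> q"
    using assms by (simp add: E.bounded_functional_def nrm_eq_Y_norm)
  ultimately show ?thesis
    by (simp add: Y_dual_def)
qed

text \<open>The supremum defining the dual norm is attained at the Riesz representer \<open>z\<close>, unless \<open>z\<close> has norm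
  zero; then all quotients vanish.\<close>

lemma Y_dual_norm_representer:
  assumes z: "z \<in> H10 \<Omega>" and rep: "\<And>q. q \<in> H10 \<Omega> \<Longrightarrow> energy z q = g q"
  shows "Y_dual_norm \<Omega> \<alpha> g = E.nrm z"
proof -
  define S where "S = (\<lambda>q. g q / E.nrm q) ` H10_nonzero \<Omega>"
  have le: "y \<le> E.nrm z" if "y \<in> S" for y :: real
  proof -
    obtain q where "q \<in> H10_nonzero \<Omega>" and y: "y = g q / E.nrm q"
      using \<open>y \<in> S\<close> unfolding S_def by blast
    then have q: "q \<in> H10 \<Omega>" "0 < E.nrm q"
      by (simp_all add: H10_nonzero_iff)
    have "g q \<le> E.nrm z * E.nrm q"
      using E.Cauchy_Schwarz_sqrt[OF z q(1)] rep[OF q(1)] by (simp add: E.nrm_def)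
    then show ?thesis
      using q(2) y by (simp add: divide_le_eq)
  qed
  have "E.nrm z \<in> S"
  proof (cases "E.nrm z = 0")
    case True
    obtain q where q: "q \<in> H10_nonzero \<Omega>"
      using H10_nonzero_nonempty by blast
    then have "g q = 0"
      using E.null_imp_orthogonal[OF z True] rep by (simp add: H10_nonzero_iff)
    then show ?thesis
      using q True by (force simp: S_def)
  next
    case False
    then have "z \<in> H10_nonzero \<Omega>"
      using E.nrm_nonneg[OF z] z by (simp add: H10_nonzero_iff)
    moreover have "g z / E.nrm z = E.nrm z"
      using rep[OF z] E.nrm_power2[OF z] False by (simp add: field_simps power2_eq_square)
    ultimately show ?thesis
      by (force simp: S_def)
  qed
  then have "Sup S = E.nrm z"
    using le by (rule cSup_eq_maximum)
  then show ?thesis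
    by (simp add: S_def Y_dual_norm_def nrm_eq_Y_norm)
qed

lemma test_functions_dense:
  assumes "q \<in> H10 \<Omega>"
  obtains \<phi> where "\<And>k. \<phi> k \<in> T" "(\<lambda>k. E.nrm (\<lambda>x. q x - \<phi> k x)) \<longlonglongrightarrow> 0"
proof -
  obtain \<phi> where \<phi>: "\<And>k. \<phi> k \<in> T"
    and lim: "(\<lambda>k. L2_norm \<Omega> (\<lambda>x. weak_grad \<Omega> q x - grad (\<phi> k) x)) \<longlonglongrightarrow> 0"
    using H10_pair_weak_grad[OF assms] by (auto simp: H10_pair_def)
  have d: "(\<lambda>x. q x - \<phi> k x) \<in> H10 \<Omega>" for k
    by (rule E.diff_closed[OF assms test_function_H10[OF \<phi>]])
  have "E.nrm (\<lambda>x. q x - \<phi> k x) \<le> sqrt hi * L2_norm \<Omega> (\<lambda>x. weak_grad \<Omega> q x - grad (\<phi> k) x)" for k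
    using nrm_bounds(2)[OF d[of k]]
      L2_norm_weak_grad[OF H10_pair_add_scaled[OF H10_pair_weak_grad[OF assms] H10_pair_test_function[OF \<phi>], of "-1" k]]
    by simp
  moreover have "(\<lambda>k. sqrt hi * L2_norm \<Omega> (\<lambda>x. weak_grad \<Omega> q x - grad (\<phi> k) x)) \<longlonglongrightarrow> 0"
    using tendsto_mult_left[OF lim, of "sqrt hi"] by simp
  ultimately have "(\<lambda>k. E.nrm (\<lambda>x. q x - \<phi> k x)) \<longlonglongrightarrow> 0"
    by (rule squeeze_zero[rotated]) (rule E.nrm_nonneg[OF d])
  with \<phi> that show ?thesis by blast
qed

text \<open>This determines the functional chosen in \<open>convection\<close>, whose values are prescribed on test functions only.\<close>

lemma bounded_functional_eq_on_test_functions: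
  assumes f: "E.bounded_functional f" and g: "E.bounded_functional g"
    and eq: "\<And>\<phi>. \<phi> \<in> T \<Longrightarrow> f \<phi> = g \<phi>" and q: "q \<in> H10 \<Omega>"
  shows "f q = g q"
proof -
  obtain C where C: "\<And>q. q \<in> H10 \<Omega> \<Longrightarrow> \<bar>f q\<bar> \<le> C * E.nrm q"
    using f unfolding E.bounded_functional_def by blast
  obtain D where D: "\<And>q. q \<in> H10 \<Omega> \<Longrightarrow> \<bar>g q\<bar> \<le> D * E.nrm q"
    using g unfolding E.bounded_functional_def by blast
  obtain \<phi> where \<phi>: "\<And>k. \<phi> k \<in> T" "(\<lambda>k. E.nrm (\<lambda>x. q x - \<phi> k x)) \<longlonglongrightarrow> 0"
    using test_functions_dense[OF q] by blast
  have bound: "\<bar>f q - g q\<bar> \<le> (C + D) * E.nrm (\<lambda>x. q x - \<phi> k x)" for k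
  proof -
    note \<phi>k = test_function_H10[OF \<phi>(1)[of k]]
    have "f (\<lambda>x. q x - \<phi> k x) = f q - f (\<phi> k)" "g (\<lambda>x. q x - \<phi> k x) = g q - g (\<phi> k)"
      using functional_diff[OF f q \<phi>k] functional_diff[OF g q \<phi>k] by auto
    then have "\<bar>f q - g q\<bar> = \<bar>f (\<lambda>x. q x - \<phi> k x) - g (\<lambda>x. q x - \<phi> k x)\<bar>"
      using eq[OF \<phi>(1)[of k]] by simp
    also have "\<dots> \<le> (C + D) * E.nrm (\<lambda>x. q x - \<phi> k x)"
      using C[OF E.diff_closed[OF q \<phi>k]] D[OF E.diff_closed[OF q \<phi>k]] by (simp add: distrib_right)
    finally show ?thesis .
  qed
  moreover have "(\<lambda>k. (C + D) * E.nrm (\<lambda>x. q x - \<phi> k x)) \<longlonglongrightarrow> 0"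
    using tendsto_mult_left[OF \<phi>(2), of "C + D"] by simp
  ultimately have "\<bar>f q - g q\<bar> \<le> 0"
    by (intro LIMSEQ_le[OF tendsto_const]) auto
  then show ?thesis by simp
qed

end

section \<open>The convection term\<close>

lemma test_function_sum:
  assumes "finite F" "F \<subseteq> test_functions \<Omega>"
  shows "(\<lambda>x. \<Sum>\<phi>\<in>F. \<phi> x) \<in> test_functions \<Omega>"
  using assms
proof (induction F rule: finite_induct)
  case (insert \<phi> F)
  then have "(\<lambda>x. (\<Sum>\<psi>\<in>F. \<psi> x) + 1 * \<phi> x) \<in> test_functions \<Omega>"
    by (intro test_function_add_scaled) auto
  then show ?case
    using insert by (simp add: add.commute)
qed (simp add: test_function_zero)

text \<open>Compactness selects finitely many bumps whose sum is positive on the whole set. This serves as a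
  cutoff function.\<close>

lemma test_function_positive_on_compact:
  fixes \<Omega> :: "'a::euclidean_space set"
  assumes \<Omega>: "open \<Omega>" and K: "compact K" "K \<subseteq> \<Omega>"
  obtains \<psi> \<delta> where "\<psi> \<in> test_functions \<Omega>" "\<delta> > 0" "\<And>x. x \<in> K \<Longrightarrow> \<delta> \<le> \<psi> x"
proof -
  define P where "P = {\<phi> \<in> test_functions \<Omega>. \<forall>x. 0 \<le> \<phi> x}"
  have "open {x. 0 < \<phi> x}" if "\<phi> \<in> P" for \<phi>
    using that test_function_continuous[of \<phi> \<Omega>] by (auto simp: P_def intro!: open_Collect_less)
  moreover have "K \<subseteq> (\<Union>\<phi>\<in>P. {x. 0 < \<phi> x})"
  proof
    fix x assume "x \<in> K"
    then have "x \<in> \<Omega>" using K(2) by blast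
    then obtain c d where cd: "cbox c d \<subseteq> \<Omega>" and x: "x \<in> box c d"
      by (rule open_contains_cbox[OF \<Omega>])
    have "bump 1 c d \<in> P"
      using bump_test_function[OF cd, of 1] by (simp add: P_def bump_bounds)
    moreover have "0 < bump 1 c d x"
      using bump_bounds(1)[of 1 c d x] bump_eq_0_iff[of 1 c d x] x by simp
    ultimately show "x \<in> (\<Union>\<phi>\<in>P. {x. 0 < \<phi> x})" by blast
  qed
  ultimately obtain F where F: "F \<subseteq> P" "finite F" "K \<subseteq> (\<Union>\<phi>\<in>F. {x. 0 < \<phi> x})"
    using compactE_image[OF K(1)] by metis
  define \<psi> where "\<psi> x = (\<Sum>\<phi>\<in>F. \<phi> x)" for x
  have \<psi>: "\<psi> \<in> test_functions \<Omega>"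
    unfolding \<psi>_def[abs_def] using F(1,2) by (intro test_function_sum) (auto simp: P_def)
  have pos: "0 < \<psi> x" if "x \<in> K" for x
  proof -
    obtain \<phi> where "\<phi> \<in> F" "0 < \<phi> x"
      using F(3) \<open>x \<in> K\<close> by blast
    then show ?thesis
      unfolding \<psi>_def using F(1,2) by (intro sum_pos2) (auto simp: P_def)
  qed
  show ?thesis
  proof (cases "K = {}")
    case True
    then show ?thesis
      using that[OF \<psi>, of 1] by simp
  next
    case False
    obtain y where "y \<in> K" "\<And>x. x \<in> K \<Longrightarrow> \<psi> y \<le> \<psi> x"
      using continuous_attains_inf[OF K(1) False continuous_on_subset[OF test_function_continuous[OF \<psi>] subset_UNIV]]
      by blast
    then show ?thesis
      using that[OF \<psi> pos] by blast
  qed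
qed

locale convection_diffusion = diffusion +
  fixes v :: "'a::euclidean_space \<Rightarrow> 'a" and div_v :: "'a \<Rightarrow> real"
  assumes v_integrable: "locally_integrable \<Omega> v"
    and v_div: "has_weak_div \<Omega> v div_v"
    and v_finite: "c_vel \<Omega> v < \<infinity>"
    and v_sign: "AE x in lebesgue_on \<Omega>. div_v x \<le> 0"
begin

lemma v_measurable: "v \<in> borel_measurable M"
  by (rule locally_integrable_measurable[OF open_dom v_integrable])

text \<open>A product \<open>q v\<close> outside \<open>L\<^sup>2\<close> would make a quotient in \<open>c_vel\<close> infinite. Functions that vanish almost
  everywhere do not occur in that supremum; for them the left-hand side is zero.\<close>

lemma velocity_bound:
  obtains C where "C \<ge> 0"
    "\<And>q. q \<in> H10 \<Omega> \<Longrightarrow> (\<lambda>x. q x *\<^sub>R v x) \<in> L2_space \<Omega>"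
    "\<And>q. q \<in> H10 \<Omega> \<Longrightarrow> L2_norm \<Omega> (\<lambda>x. q x *\<^sub>R v x) \<le> C * L2_norm \<Omega> (weak_grad \<Omega> q)"
proof -
  define C where "C = enn2real (c_vel \<Omega> v)"
  have C: "ennreal C = c_vel \<Omega> v" "0 \<le> C"
    using v_finite by (simp_all add: C_def)
  have "(\<lambda>x. q x *\<^sub>R v x) \<in> L2_space \<Omega> \<and> L2_norm \<Omega> (\<lambda>x. q x *\<^sub>R v x) \<le> C * L2_norm \<Omega> (weak_grad \<Omega> q)"
    if q: "q \<in> H10 \<Omega>" for q
  proof (cases "q \<in> H10_nonzero \<Omega>")
    case True
    let ?qv = "\<lambda>x. q x *\<^sub>R v x" and ?g = "L2_norm \<Omega> (weak_grad \<Omega> q)"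
    have "0 < E.nrm q"
      using True by (simp add: H10_nonzero_iff)
    then have "0 < sqrt hi * ?g"
      using nrm_bounds(2)[OF q] by linarith
    then have g: "0 < ?g"
      using hi_pos by (simp add: zero_less_mult_iff)
    have "L2_ennorm \<Omega> ?qv / L2_ennorm \<Omega> (weak_grad \<Omega> q) \<le> c_vel \<Omega> v"
      unfolding c_vel_def by (rule SUP_upper[OF True])
    then have ratio: "L2_ennorm \<Omega> ?qv / ennreal ?g \<le> ennreal C"
      using H10_L2(2)[OF q] by (simp add: L2_ennorm_def C)
    have L2: "?qv \<in> L2_space \<Omega>"
    proof (rule ccontr)
      assume "?qv \<notin> L2_space \<Omega>"
      then have "L2_ennorm \<Omega> ?qv / ennreal ?g = \<infinity>"
        by (simp add: L2_ennorm_def ennreal_top_divide)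
      then show False
        using ratio by (simp add: top_unique)
    qed
    then have "ennreal (L2_norm \<Omega> ?qv / ?g) \<le> ennreal C"
      using ratio g by (simp add: L2_ennorm_def divide_ennreal L2_norm_nonneg)
    then have "L2_norm \<Omega> ?qv / ?g \<le> C"
      using C(2) by (simp add: ennreal_le_iff)
    then show ?thesis
      using L2 g by (simp add: divide_le_eq)
  next
    case False
    then have zero: "AE x in M. 0 = q x *\<^sub>R v x"
      using q by (auto simp: H10_nonzero_def elim: eventually_mono)
    have meas: "(\<lambda>x. q x *\<^sub>R v x) \<in> borel_measurable M"
      by (rule borel_measurable_scaleR[OF L2_measurable[OF H10_L2(1)[OF q]] v_measurable])
    have "(\<lambda>x. q x *\<^sub>R v x) \<in> L2_space \<Omega>"
      by (rule L2_space_cong_AE[OF zero _ meas]) (simp add: L2_space_def)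
    moreover have "L2_norm \<Omega> (\<lambda>x. q x *\<^sub>R v x) = 0"
      using L2_norm_cong_AE[OF zero _ meas] by (simp add: L2_norm_def)
    ultimately show ?thesis
      using C(2) by (simp add: L2_norm_nonneg)
  qed
  with C(2) that show ?thesis by blast
qed

lemma velocity_L2: "q \<in> H10 \<Omega> \<Longrightarrow> (\<lambda>x. q x *\<^sub>R v x) \<in> L2_space \<Omega>"
  using velocity_bound by blast

definition conv :: "('a \<Rightarrow> real) \<Rightarrow> ('a \<Rightarrow> real) \<Rightarrow> real" where
  "conv u q = (LINT x|M. (v x \<bullet> weak_grad \<Omega> u x) * q x)"

lemma conv_eq_inner: "conv u q = (LINT x|M. weak_grad \<Omega> u x \<bullet> (q x *\<^sub>R v x))"
  by (simp add: conv_def inner_commute mult.commute)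

lemma conv_integrable:
  assumes "w \<in> L2_space \<Omega>" "q \<in> H10 \<Omega>"
  shows "integrable M (\<lambda>x. w x \<bullet> (q x *\<^sub>R v x))"
  by (rule L2_inner_integrable[OF assms(1) velocity_L2[OF assms(2)]])

lemma conv_add_scaled_left:
  assumes "p \<in> H10 \<Omega>" "q \<in> H10 \<Omega>" "r \<in> H10 \<Omega>"
  shows "conv (\<lambda>x. p x + c * q x) r = conv p r + c * conv q r"
proof -
  have [measurable]: "(\<lambda>x. w x \<bullet> (r x *\<^sub>R v x)) \<in> borel_measurable M" if "w \<in> L2_space \<Omega>" for w
    using conv_integrable[OF that assms(3)] by (rule borel_measurable_integrable)
  have "conv (\<lambda>x. p x + c * q x) r =
      (LINT x|M. weak_grad \<Omega> p x \<bullet> (r x *\<^sub>R v x) + c * (weak_grad \<Omega> q x \<bullet> (r x *\<^sub>R v x)))"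
    unfolding conv_eq_inner
  proof (rule integral_cong_AE)
    show "AE x in M. weak_grad \<Omega> (\<lambda>x. p x + c * q x) x \<bullet> (r x *\<^sub>R v x) =
        weak_grad \<Omega> p x \<bullet> (r x *\<^sub>R v x) + c * (weak_grad \<Omega> q x \<bullet> (r x *\<^sub>R v x))"
      using weak_grad_add_scaled_AE[OF assms(1,2), of c]
      by (rule eventually_mono) (simp add: inner_add_left algebra_simps)
  qed (use H10_L2(2)[OF assms(1)] H10_L2(2)[OF assms(2)] H10_L2(2)[OF H10_add_scaled[OF assms(1,2), of c]] in measurable)
  also have "\<dots> = conv p r + c * conv q r"
    unfolding conv_eq_inner using conv_integrable[OF H10_L2(2) assms(3)] assms(1,2) by simp
  finally show ?thesis .
qed

lemma conv_add_scaled_right: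
  assumes "p \<in> H10 \<Omega>" "q \<in> H10 \<Omega>" "r \<in> H10 \<Omega>"
  shows "conv r (\<lambda>x. p x + c * q x) = conv r p + c * conv r q"
proof -
  have "conv r (\<lambda>x. p x + c * q x) =
      (LINT x|M. weak_grad \<Omega> r x \<bullet> (p x *\<^sub>R v x) + c * (weak_grad \<Omega> r x \<bullet> (q x *\<^sub>R v x)))"
    unfolding conv_eq_inner by (intro Bochner_Integration.integral_cong) (auto simp: algebra_simps)
  also have "\<dots> = conv r p + c * conv r q"
    unfolding conv_eq_inner using conv_integrable[OF H10_L2(2)[OF assms(3)]] assms(1,2) by simp
  finally show ?thesis .
qed

lemma conv_bounded:
  obtains C where "C \<ge> 0" "\<And>p q. p \<in> H10 \<Omega> \<Longrightarrow> q \<in> H10 \<Omega> \<Longrightarrow> \<bar>conv p q\<bar> \<le> C * E.nrm p * E.nrm q"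
proof -
  obtain C where C: "C \<ge> 0"
    "\<And>q. q \<in> H10 \<Omega> \<Longrightarrow> L2_norm \<Omega> (\<lambda>x. q x *\<^sub>R v x) \<le> C * L2_norm \<Omega> (weak_grad \<Omega> q)"
    using velocity_bound by metis
  have grad_le: "L2_norm \<Omega> (weak_grad \<Omega> q) \<le> E.nrm q / sqrt lo" if "q \<in> H10 \<Omega>" for q
    using nrm_bounds(1)[OF that] lo_pos by (simp add: le_divide_eq mult.commute)
  have "\<bar>conv p q\<bar> \<le> C / lo * E.nrm p * E.nrm q" if p: "p \<in> H10 \<Omega>" and q: "q \<in> H10 \<Omega>" for p q
  proof -
    have "\<bar>conv p q\<bar> \<le> L2_norm \<Omega> (weak_grad \<Omega> p) * L2_norm \<Omega> (\<lambda>x. q x *\<^sub>R v x)"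
      unfolding conv_eq_inner by (rule L2_Cauchy_Schwarz[OF H10_L2(2)[OF p] velocity_L2[OF q]])
    also have "\<dots> \<le> (E.nrm p / sqrt lo) * (C * (E.nrm q / sqrt lo))"
    proof (rule mult_mono[OF grad_le[OF p] _ _ L2_norm_nonneg])
      show "L2_norm \<Omega> (\<lambda>x. q x *\<^sub>R v x) \<le> C * (E.nrm q / sqrt lo)"
        using C(2)[OF q] mult_left_mono[OF grad_le[OF q] C(1)] by linarith
      show "0 \<le> E.nrm p / sqrt lo"
        using E.nrm_nonneg[OF p] lo_pos by simp
    qed
    also have "\<dots> = C / lo * E.nrm p * E.nrm q"
      using lo_pos by (simp add: field_simps)
    finally show ?thesis .
  qed
  moreover have "0 \<le> C / lo" using C(1) lo_pos by simp
  ultimately show ?thesis using that by blast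
qed

lemma conv_bounded_functional:
  assumes "u \<in> H10 \<Omega>"
  shows "E.bounded_functional (conv u)"
proof -
  obtain C where "\<And>p q. p \<in> H10 \<Omega> \<Longrightarrow> q \<in> H10 \<Omega> \<Longrightarrow> \<bar>conv p q\<bar> \<le> C * E.nrm p * E.nrm q"
    using conv_bounded by metis
  then show ?thesis
    using assms conv_add_scaled_right unfolding E.bounded_functional_def real_scaleR_def by blast
qed

text \<open>On a compact set the velocity is dominated by a multiple of \<open>\<psi> v\<close> for a test function \<open>\<psi>\<close>, and
  \<open>\<psi> v\<close> is square integrable.\<close>

lemma conv_locally_integrable:
  assumes u: "u \<in> H10 \<Omega>"
  shows "locally_integrable \<Omega> (\<lambda>x. v x \<bullet> weak_grad \<Omega> u x)"
  unfolding locally_integrable_def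
proof (intro allI impI)
  fix K assume K: "compact K \<and> K \<subseteq> \<Omega>"
  obtain \<psi> \<delta> where \<psi>: "\<psi> \<in> T" "\<delta> > 0" "\<And>x. x \<in> K \<Longrightarrow> \<delta> \<le> \<psi> x"
    using test_function_positive_on_compact[OF open_dom] K by metis
  let ?w = "\<lambda>x. v x \<bullet> weak_grad \<Omega> u x"
  have [measurable]: "v \<in> borel_measurable M" "weak_grad \<Omega> u \<in> borel_measurable M"
    using v_measurable L2_measurable[OF H10_L2(2)[OF u]] .
  have KM: "K \<in> sets M"
    using K compact_lebesgue by (auto simp: sets_restrict_space)
  have "integrable M (\<lambda>x. indicator K x * ?w x)"
  proof (rule Bochner_Integration.integrable_bound)
    show "integrable M (\<lambda>x. inverse \<delta> * (weak_grad \<Omega> u x \<bullet> (\<psi> x *\<^sub>R v x)))"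
      using conv_integrable[OF H10_L2(2)[OF u] test_function_H10[OF \<psi>(1)]] by (rule integrable_mult_right)
    show "(\<lambda>x. indicator K x * ?w x) \<in> borel_measurable M"
      using KM by measurable
    have "\<bar>indicator K x * ?w x\<bar> \<le> \<bar>inverse \<delta> * (weak_grad \<Omega> u x \<bullet> (\<psi> x *\<^sub>R v x))\<bar>" for x
    proof (cases "x \<in> K")
      case True
      have "1 * \<bar>?w x\<bar> \<le> (inverse \<delta> * \<psi> x) * \<bar>?w x\<bar>"
        using \<psi>(2) \<psi>(3)[OF True] by (intro mult_right_mono) (auto simp: field_simps)
      also have "\<dots> = \<bar>inverse \<delta> * (weak_grad \<Omega> u x \<bullet> (\<psi> x *\<^sub>R v x))\<bar>"
        using \<psi>(2) \<psi>(3)[OF True] by (simp add: abs_mult inner_commute)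
      finally show ?thesis using True by simp
    qed simp
    then show "AE x in M. norm (indicator K x * ?w x) \<le> norm (inverse \<delta> * (weak_grad \<Omega> u x \<bullet> (\<psi> x *\<^sub>R v x)))"
      by simp
  qed
  then have "integrable lebesgue (\<lambda>x. indicator \<Omega> x *\<^sub>R (indicator K x * ?w x))"
    using dom_lebesgue by (subst (asm) integrable_restrict_space) simp_all
  moreover have "(\<lambda>x. indicator \<Omega> x *\<^sub>R (indicator K x * ?w x)) = (\<lambda>x. indicator K x *\<^sub>R ?w x)"
    using K by (intro ext) (auto simp: indicator_def)
  ultimately show "?w absolutely_integrable_on K"
    by (simp add: set_integrable_def)
qed

lemma represents_conv:
  assumes "u \<in> H10 \<Omega>"
  shows "represents \<Omega> \<alpha> (\<lambda>x. v x \<bullet> weak_grad \<Omega> u x) (conv u)"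
  unfolding represents_def
  using conv_locally_integrable[OF assms] bounded_functional_Y_dual[OF conv_bounded_functional[OF assms]]
  by (simp add: conv_def)

lemma X_space_eq_H10: "X_space \<Omega> \<alpha> v = H10 \<Omega>"
  using represents_conv by (auto simp: X_space_def)

lemma convection_eq_conv:
  assumes u: "u \<in> H10 \<Omega>" and q: "q \<in> H10 \<Omega>"
  shows "convection \<Omega> \<alpha> v u q = conv u q"
proof -
  have rep: "represents \<Omega> \<alpha> (\<lambda>x. v x \<bullet> weak_grad \<Omega> u x) (convection \<Omega> \<alpha> v u)"
    unfolding convection_def
    by (rule someI[of "represents \<Omega> \<alpha> (\<lambda>x. v x \<bullet> weak_grad \<Omega> u x)"]) (rule represents_conv[OF u])
  show ?thesis
  proof (rule bounded_functional_eq_on_test_functions[OF _ conv_bounded_functional[OF u] _ q])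
    show "E.bounded_functional (convection \<Omega> \<alpha> v u)"
      using rep by (intro Y_dual_bounded_functional) (simp add: represents_def)
    show "convection \<Omega> \<alpha> v u \<phi> = conv u \<phi>" if "\<phi> \<in> T" for \<phi>
      using rep that by (simp add: represents_def conv_def)
  qed
qed

text \<open>For a test function \<open>\<phi>\<close> the convection term is half the integral of the derivative of \<open>\<phi>\<^sup>2\<close> along
  the velocity, that is, minus half the integral of \<open>\<phi>\<^sup>2\<close> against the divergence. Boundedness of the
  form carries the sign over to the closure.\<close>

lemma conv_test_function_nonneg:
  assumes \<phi>: "\<phi> \<in> T"
  shows "0 \<le> conv \<phi> \<phi>"
proof -
  have \<phi>2: "(\<lambda>x. \<phi> x * \<phi> x) \<in> T"
    by (rule test_function_mult_smooth[OF \<phi> test_function_smooth[OF \<phi>]])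
  have [measurable]: "v \<in> borel_measurable M" "weak_grad \<Omega> \<phi> \<in> borel_measurable M"
      "\<phi> \<in> borel_measurable M" "grad \<phi> \<in> borel_measurable M"
    using v_measurable L2_measurable[OF H10_L2(2)[OF test_function_H10[OF \<phi>]]]
      L2_measurable[OF test_function_L2[OF \<phi>]] L2_measurable[OF grad_L2[OF \<phi>]] .
  have "2 * conv \<phi> \<phi> = (LINT x|M. 2 * ((v x \<bullet> weak_grad \<Omega> \<phi> x) * \<phi> x))"
    by (simp add: conv_def)
  also have "\<dots> = (LINT x|M. frechet_derivative (\<lambda>x. \<phi> x * \<phi> x) (at x) (v x))"
  proof (rule integral_cong_AE)
    have eq: "frechet_derivative (\<lambda>x. \<phi> x * \<phi> x) (at x) (v x) = 2 * ((v x \<bullet> grad \<phi> x) * \<phi> x)" for x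
      unfolding grad_inner[OF \<phi>2] grad_mult[OF \<phi> \<phi>]
      by (simp add: inner_add_left inner_commute[of "v x"] mult.commute)
    show "AE x in M. 2 * ((v x \<bullet> weak_grad \<Omega> \<phi> x) * \<phi> x) = frechet_derivative (\<lambda>x. \<phi> x * \<phi> x) (at x) (v x)"
      using H10_pair_weak_grad_AE[OF H10_pair_test_function[OF \<phi>]] unfolding eq
      by (rule eventually_mono) simp
    show "(\<lambda>x. frechet_derivative (\<lambda>x. \<phi> x * \<phi> x) (at x) (v x)) \<in> borel_measurable M"
      unfolding eq by measurable
  qed measurable
  also have "\<dots> = - (LINT x|M. div_v x * (\<phi> x * \<phi> x))"
    using v_div \<phi>2 unfolding has_weak_div_def by blast
  also have "\<dots> = (LINT x|M. - div_v x * (\<phi> x * \<phi> x))"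
    by simp
  also have "\<dots> \<ge> 0"
    by (rule integral_nonneg_AE, use v_sign in \<open>rule eventually_mono\<close>) (auto intro!: mult_nonneg_nonneg simp: mult_le_0_iff)
  finally show ?thesis by simp
qed

lemma conv_nonneg:
  assumes q: "q \<in> H10 \<Omega>"
  shows "0 \<le> conv q q"
proof -
  obtain C where C: "C \<ge> 0" "\<And>p q. p \<in> H10 \<Omega> \<Longrightarrow> q \<in> H10 \<Omega> \<Longrightarrow> \<bar>conv p q\<bar> \<le> C * E.nrm p * E.nrm q"
    using conv_bounded by metis
  obtain \<phi> where \<phi>: "\<And>k. \<phi> k \<in> T" and lim: "(\<lambda>k. E.nrm (\<lambda>x. q x - \<phi> k x)) \<longlonglongrightarrow> 0"
    using test_functions_dense[OF q] by blast
  define \<epsilon> where "\<epsilon> k = E.nrm (\<lambda>x. q x - \<phi> k x)" for k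
  have "- (C * \<epsilon> k * (2 * E.nrm q + \<epsilon> k)) \<le> conv q q" for k
  proof -
    define d where "d x = q x - \<phi> k x" for x
    have d: "d \<in> H10 \<Omega>"
      unfolding d_def[abs_def] by (rule E.diff_closed[OF q test_function_H10[OF \<phi>]])
    have nd: "E.nrm d = \<epsilon> k"
      by (simp add: \<epsilon>_def d_def[abs_def])
    \<comment> \<open>Written with \<open>+\<close> and a scalar so that bilinearity applies as a rewrite rule.\<close>
    have \<phi>k: "\<phi> k = (\<lambda>x. q x + (-1) * d x)"
      by (simp add: d_def)
    note q' = H10_add_scaled[OF q d, of "-1"]
    have "conv (\<phi> k) (\<phi> k) = conv q q - conv q d - conv d q + conv d d"
      unfolding \<phi>k conv_add_scaled_left[OF q d q'] conv_add_scaled_right[OF q d q] conv_add_scaled_right[OF q d d]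
      by simp
    moreover have "0 \<le> conv (\<phi> k) (\<phi> k)"
      by (rule conv_test_function_nonneg[OF \<phi>])
    moreover have "\<bar>conv q d\<bar> \<le> C * E.nrm q * \<epsilon> k" "\<bar>conv d q\<bar> \<le> C * \<epsilon> k * E.nrm q" "\<bar>conv d d\<bar> \<le> C * \<epsilon> k * \<epsilon> k"
      using C(2)[OF q d] C(2)[OF d q] C(2)[OF d d] by (simp_all add: nd)
    ultimately show ?thesis
      by (simp add: algebra_simps)
  qed
  moreover have "(\<lambda>k. - (C * \<epsilon> k * (2 * E.nrm q + \<epsilon> k))) \<longlonglongrightarrow> - (C * 0 * (2 * E.nrm q + 0))"
    using lim unfolding \<epsilon>_def[symmetric] by (intro tendsto_intros)
  ultimately show ?thesis
    using LIMSEQ_le_const2[of "\<lambda>k. - (C * \<epsilon> k * (2 * E.nrm q + \<epsilon> k))"] by auto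
qed

section \<open>Well-posedness of the variational problem\<close>

lemma variational_solution_iff:
  "variational_solution \<Omega> \<alpha> v f u \<longleftrightarrow> u \<in> H10 \<Omega> \<and> (\<forall>q\<in>H10 \<Omega>. energy u q + conv u q = f q)"
  by (auto simp: variational_solution_def X_space_eq_H10 b_form_def energy_def[symmetric] convection_eq_conv)

lemma variational_solution_exists:
  assumes "f \<in> Y_dual \<Omega> \<alpha>"
  obtains u where "variational_solution \<Omega> \<alpha> v f u"
proof -
  obtain C where C: "\<And>p q. p \<in> H10 \<Omega> \<Longrightarrow> q \<in> H10 \<Omega> \<Longrightarrow> \<bar>conv p q\<bar> \<le> C * E.nrm p * E.nrm q"
    using conv_bounded by metis
  obtain u where "u \<in> H10 \<Omega>" "\<And>q. q \<in> H10 \<Omega> \<Longrightarrow> energy u q + conv u q = f q"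
  proof (rule E.Lax_Milgram[OF energy_complete _ Y_dual_bounded_functional[OF assms],
        where a = "\<lambda>u q. energy u q + conv u q" and C = "1 + C" and \<kappa> = 1])
    show "H10 \<Omega> \<noteq> {}"
      using H10_nonzero_nonempty by (auto simp: H10_nonzero_def)
    fix p q assume p: "p \<in> H10 \<Omega>" and q: "q \<in> H10 \<Omega>"
    show "\<bar>energy p q + conv p q\<bar> \<le> (1 + C) * E.nrm p * E.nrm q"
      using E.Cauchy_Schwarz_sqrt[OF p q] C[OF p q]
      unfolding E.nrm_def[symmetric] by (simp add: distrib_right)
    fix r c assume r: "r \<in> H10 \<Omega>"
    show "energy (\<lambda>x. p x + c *\<^sub>R q x) r + conv (\<lambda>x. p x + c *\<^sub>R q x) r =
        energy p r + conv p r + c * (energy q r + conv q r)"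
      using energy_add_scaled[OF p q r] conv_add_scaled_left[OF p q r] by (simp add: algebra_simps)
    show "energy r (\<lambda>x. p x + c *\<^sub>R q x) + conv r (\<lambda>x. p x + c *\<^sub>R q x) =
        energy r p + conv r p + c * (energy r q + conv r q)"
      using energy_add_scaled[OF p q r] conv_add_scaled_right[OF p q r]
        E.sym[OF r H10_add_scaled[OF p q, of c]] E.sym[OF r p] E.sym[OF r q] by (simp add: algebra_simps)
  next
    fix p assume "p \<in> H10 \<Omega>"
    then show "1 * (E.nrm p)\<^sup>2 \<le> energy p p + conv p p"
      using conv_nonneg E.nrm_power2 by simp
  qed simp_all
  then show ?thesis
    using that variational_solution_iff by blast
qed

lemma variational_solution_unique:
  assumes "variational_solution \<Omega> \<alpha> v f u" "variational_solution \<Omega> \<alpha> v f w"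
  shows "AE x in M. w x = u x"
proof -
  have u: "u \<in> H10 \<Omega>" and w: "w \<in> H10 \<Omega>"
    using assms by (simp_all add: variational_solution_iff)
  define e where "e x = w x - u x" for x
  have e: "e \<in> H10 \<Omega>"
    unfolding e_def[abs_def] by (rule E.diff_closed[OF w u])
  have "energy e e = energy w e - energy u e"
    unfolding e_def[abs_def] by (rule E.diff_left[OF w u e[unfolded e_def[abs_def]]])
  moreover have "conv e e = conv w e - conv u e"
    using conv_add_scaled_left[OF w u e, of "-1"] by (simp add: e_def[abs_def])
  moreover have "energy w e + conv w e = energy u e + conv u e"
    using assms e by (simp add: variational_solution_iff)
  ultimately have "energy e e + conv e e = 0"
    by simp
  then have "E.nrm e = 0"
    using conv_nonneg[OF e] E.nrm_power2[OF e] E.nonneg[OF e] by (simp add: E.nrm_def)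
  then have "AE x in M. e x = 0"
    by (rule nrm_zero_imp_AE_zero[OF e])
  then show ?thesis
    by (rule eventually_mono) (simp add: e_def)
qed

text \<open>If \<open>z\<close> represents the convection functional of \<open>u\<close>, then \<open>u + z\<close> represents \<open>f\<close>. The square of
  its norm is the squared graph norm plus twice the convection term at \<open>(u, u)\<close>, which is
  nonnegative.\<close>

lemma variational_solution_norm_le:
  assumes "variational_solution \<Omega> \<alpha> v f u"
  shows "X_norm \<Omega> \<alpha> v u \<le> Y_dual_norm \<Omega> \<alpha> f"
proof -
  have u: "u \<in> H10 \<Omega>" and sol: "\<And>q. q \<in> H10 \<Omega> \<Longrightarrow> energy u q + conv u q = f q"
    using assms by (simp_all add: variational_solution_iff)
  have "H10 \<Omega> \<noteq> {}" using u by blast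
  then obtain z where z: "z \<in> H10 \<Omega>" "\<And>q. q \<in> H10 \<Omega> \<Longrightarrow> energy z q = conv u q"
    using E.Riesz[OF energy_complete conv_bounded_functional[OF u]] by blast
  have uz: "(\<lambda>x. u x + 1 * z x) \<in> H10 \<Omega>"
    by (rule H10_add_scaled[OF u z(1)])
  have "energy (\<lambda>x. u x + 1 * z x) q = f q" if "q \<in> H10 \<Omega>" for q
    using energy_add_scaled[OF u z(1) that, of 1] z(2)[OF that] sol[OF that] by simp
  then have f_norm: "Y_dual_norm \<Omega> \<alpha> f = E.nrm (\<lambda>x. u x + 1 * z x)"
    by (rule Y_dual_norm_representer[OF uz])
  have conv_norm: "Y_dual_norm \<Omega> \<alpha> (convection \<Omega> \<alpha> v u) = E.nrm z"
    by (rule Y_dual_norm_representer[OF z(1)]) (simp add: z(2) convection_eq_conv[OF u])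
  have "(E.nrm u)\<^sup>2 + (E.nrm z)\<^sup>2 \<le> energy u u + 2 * energy u z + energy z z"
    using E.nrm_power2[OF u] E.nrm_power2[OF z(1)] E.sym[OF u z(1)] z(2)[OF u] conv_nonneg[OF u] by simp
  also have "\<dots> = (E.nrm (\<lambda>x. u x + 1 * z x))\<^sup>2"
    using E.expand[OF u z(1), of 1] E.nrm_power2[OF uz] by simp
  finally have "sqrt ((E.nrm u)\<^sup>2 + (E.nrm z)\<^sup>2) \<le> E.nrm (\<lambda>x. u x + 1 * z x)"
    by (rule real_le_lsqrt[OF E.nrm_nonneg[OF uz]])
  then show ?thesis
    unfolding X_norm_def conv_norm f_norm nrm_eq_Y_norm[symmetric] .
qed

end

theorem lemma2p5:
  fixes \<Omega> :: "(real ^ 'n::finite) set"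
    and \<alpha> :: "real ^ 'n \<Rightarrow> real"
    and \<alpha>_lo \<alpha>_hi :: real
    and v :: "real ^ 'n \<Rightarrow> real ^ 'n"
    and div_v :: "real ^ 'n \<Rightarrow> real"
    and f :: "(real ^ 'n \<Rightarrow> real) \<Rightarrow> real"
  assumes "CARD('n) \<in> {1, 2, 3}"
    and "bounded_lipschitz_domain \<Omega>"
    and "\<alpha> \<in> borel_measurable (lebesgue_on \<Omega>)"
    and "0 < \<alpha>_lo"
    and "\<And>x. x \<in> \<Omega> \<Longrightarrow> \<alpha>_lo \<le> \<alpha> x \<and> \<alpha> x \<le> \<alpha>_hi"
    and "locally_integrable \<Omega> v"
    and "has_weak_div \<Omega> v div_v"
    and "c_vel \<Omega> v < \<infinity>"
    and "AE x in lebesgue_on \<Omega>. div_v x \<le> 0"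
    and "f \<in> Y_dual \<Omega> \<alpha>"
  shows "\<exists>u. variational_solution \<Omega> \<alpha> v f u \<and>
             (\<forall>w. variational_solution \<Omega> \<alpha> v f w \<longrightarrow> (AE x in lebesgue_on \<Omega>. w x = u x)) \<and>
             X_norm \<Omega> \<alpha> v u \<le> Y_dual_norm \<Omega> \<alpha> f"
proof -
  have "\<Omega> \<noteq> {}" "open \<Omega>" "bounded \<Omega>"
    using assms(2) by (simp_all add: bounded_lipschitz_domain_def)
  then interpret convection_diffusion \<Omega> \<alpha> \<alpha>_lo \<alpha>_hi v div_v
    using assms by unfold_locales auto
  obtain u where "variational_solution \<Omega> \<alpha> v f u"
    using variational_solution_exists[OF assms(10)] .
  then show ?thesis
    using variational_solution_unique variational_solution_norm_le by blast
qed

end
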